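(* Let $S\subset\partial\mathbb{D}$ be a nonempty closed subset, and let $$\mathcal{M}(AP(S))\stackrel{r_S}{\longrightarrow}\mathcal{M}(R_S)\stackrel{c_S}{\longrightarrow}\mathcal{M}(C(\partial\mathbb{D}))\cong\partial\mathbb{D}$$ be the continuous surjective maps dual to the embeddings $C(\partial\mathbb{D})\hookrightarrow R_S\hookrightarrow AP(S)$. Then: (1) For each $z\in S$ the preimage $c_S^{-1}(z)$ consists of two points $z_+$ and $z_-$, which are naturally identified with the counterclockwise and clockwise orientations of $\partial\mathbb{D}$ at $z$ (that is, $z_\pm$ is the character $f\mapsto\lim_{t\to0+}f(ze^{\pm it})$ of $R_S$). (2) $c_S:\mathcal{M}(R_S)\setminus c_S^{-1}(S)\to\partial\mathbb{D}\setminus S$ is a homeomorphism. (3) $c_S^{-1}(S)\subset\mathcal{M}(R_S)$ is a totally disconnected compact Hausdorff space. (4) For each $\xi\in c_S^{-1}(S)$ the preimage $r_S^{-1}(\xi)$ is homeomorphic to the Bohr compactification $b\mathbb{R}$ of $\mathbb{R}$. (5) The map $r_S:\mathcal{M}(AP(S))\setminus(c_S\circ r_S)^{-1}(S)\to\mathcal{M}(R_S)\setminus c_S^{-1}(S)\cong\partial\mathbb{D}\setminus S$ is a homeomorphism.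
   Context: $\mathbb{D}\subset\mathbb{C}$ is the open unit disk; $\partial\mathbb{D}$ carries the counterclockwise orientation. A continuous function $f:\mathbb{R}\to\mathbb{C}$ is almost periodic if for any $\epsilon>0$ there is $l(\epsilon)>0$ such that for every $t_0\in\mathbb{R}$ the interval $[t_0,t_0+l(\epsilon)]$ contains a number $\tau$ with $|f(t)-f(t+\tau)|<\epsilon$ for all $t\in\mathbb{R}$. For $t_0\in\mathbb{R}$, $k\in\{-1,1\}$, $0<s\le 2\pi$ set $\gamma_{t_0^k}(s):=\{e^{i(t_0+kt)}: 0<t<s\}$. A continuous function $f_k:\gamma_{t_0^k}(s)\to\mathbb{C}$ is almost periodic if the function $\widehat f_k:(-\infty,0)\to\mathbb{C}$, $\widehat f_k(t):=f_k(e^{i(t_0+kse^t)})$, is the restriction of an almost periodic function on $\mathbb{R}$. $AP(\partial\mathbb{D})\subset L^\infty(\partial\mathbb{D})$ is the uniform subalgebra of functions $f$ such that for each $t_0\in\mathbb{R}$ and $\epsilon>0$ there are $s=s(t_0,\epsilon)\in(0,\pi)$ and almost periodic functions $f_k:\gamma_{t_0^k}(s)\to\mathbb{C}$, $k\in\{-1,1\}$, with $\operatorname{ess\,sup}_{\gamma_{t_0^k}(s)}|f-f_k|<\epsilon$ for both $k$. For a nonempty closed $S\subset\partial\mathbb{D}$, $AP(S)\subset AP(\partial\mathbb{D})$ is the uniform algebra of functions from $AP(\partial\mathbb{D})$ that are continuous on $\partial\mathbb{D}\setminus S$. $R_S\subset L^\infty(\partial\mathbb{D})$ is the uniform algebra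 of complex functions allowing discontinuities of the first kind at points of $S$ (i.e. both one-sided limits exist, possibly with distinct values) and continuous on $\partial\mathbb{D}\setminus S$. For a uniform (commutative unital Banach) algebra $A$, $\mathcal{M}(A)$ is its maximal ideal space, i.e. the set of characters (nonzero homomorphisms $A\to\mathbb{C}$) with the weak$^*$ (Gelfand) topology. The map dual to an embedding of algebras is restriction of characters. $\mathcal{M}(C(\partial\mathbb{D}))\cong\partial\mathbb{D}$ via point evaluations. $b\mathbb{R}$ is the compact abelian group homeomorphic to the maximal ideal space of the algebra of continuous almost periodic functions on $\mathbb{R}$. *)

theory Defs
  imports "HOL-Probability.Essential_Supremum" "HOL-Library.Function_Algebras"
begin

class complex_comm_algebra_1 = comm_ring_1 +
  fixes scaleC :: "complex \<Rightarrow> 'a \<Rightarrow> 'a"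
  assumes scaleC_add_right: "scaleC a (x + y) = scaleC a x + scaleC a y"
    and scaleC_add_left: "scaleC (a + b) x = scaleC a x + scaleC b x"
    and scaleC_scaleC: "scaleC a (scaleC b x) = scaleC (a * b) x"
    and scaleC_one: "scaleC 1 x = x"
    and mult_scaleC_left: "scaleC a x * y = scaleC a (x * y)"

instantiation complex :: complex_comm_algebra_1
begin
definition scaleC_complex :: "complex \<Rightarrow> complex \<Rightarrow> complex"
  where "scaleC_complex a x = a * x"
instance by standard (simp_all add: scaleC_complex_def algebra_simps)
end

instantiation "fun" :: (type, complex_comm_algebra_1) complex_comm_algebra_1
begin
definition scaleC_fun :: "complex \<Rightarrow> ('a \<Rightarrow> 'b) \<Rightarrow> 'a \<Rightarrow> 'b"
  where "scaleC_fun a f = (\<lambda>x. scaleC a (f x))"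
instance
  by standard
    (simp_all add: scaleC_fun_def fun_eq_iff scaleC_add_right scaleC_add_left scaleC_scaleC
      scaleC_one mult_scaleC_left)
end

text \<open>
  A subalgebra is given by its carrier \<open>A\<close>.  A character of it is a functional on \<open>A\<close>, encoded as
  a function that is \<open>undefined\<close> outside \<open>A\<close>; so restriction of characters to a subalgebra \<open>B\<close> is
  the library's \<open>\<lambda>\<phi>. restrict \<phi> B\<close>.
\<close>

definition characters :: "'a::complex_comm_algebra_1 set \<Rightarrow> ('a \<Rightarrow> complex) set" where
  "characters A = {\<phi> \<in> extensional A.
     (\<forall>x\<in>A. \<forall>y\<in>A. \<phi> (x + y) = \<phi> x + \<phi> y) \<and>
     (\<forall>c. \<forall>x\<in>A. \<phi> (scaleC c x) = c * \<phi> x) \<and>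
     (\<forall>x\<in>A. \<forall>y\<in>A. \<phi> (x * y) = \<phi> x * \<phi> y) \<and>
     (\<exists>x\<in>A. \<phi> x \<noteq> 0)}"

text \<open>The Gelfand (weak*) topology is the topology of pointwise convergence on \<open>A\<close>.\<close>

definition max_ideal_space :: "'a::complex_comm_algebra_1 set \<Rightarrow> ('a \<Rightarrow> complex) topology" where
  "max_ideal_space A = subtopology (product_topology (\<lambda>_. euclidean) A) (characters A)"

definition totally_disconnected_space :: "'a topology \<Rightarrow> bool" where
  "totally_disconnected_space X \<longleftrightarrow> (\<forall>C. connectedin X C \<longrightarrow> (\<exists>a. C \<subseteq> {a}))"

abbreviation circle :: "complex set" where
  "circle \<equiv> sphere 0 1"

definition arc_length :: "complex measure" where
  "arc_length = distr (restrict_space lborel {0..<2 * pi}) (restrict_space borel circle) cis"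

lemma space_arc_length [simp]: "space arc_length = circle"
  by (simp add: arc_length_def space_restrict_space)

lemma cis_measurable_circle:
  "cis \<in> restrict_space lborel {0..<2 * pi} \<rightarrow>\<^sub>M restrict_space borel circle"
proof (rule measurable_restrict_space2)
  show "cis \<in> space (restrict_space lborel {0..<2 * pi}) \<rightarrow> circle"
    by auto
  have "cis \<in> borel_measurable borel"
    by (intro borel_measurable_continuous_onI continuous_intros)
  then show "cis \<in> borel_measurable (restrict_space lborel {0..<2 * pi})"
    by (intro measurable_restrict_space1) simp
qed

lemma emeasure_arc_length_circle: "emeasure arc_length circle = ennreal (2 * pi)"
proof -
  have "circle \<in> sets (restrict_space borel circle)"
    using sets.top[of "restrict_space borel circle"] by (simp add: space_restrict_space)
  moreover have "cis -` circle \<inter> {0..<2 * pi} = {0..<2 * pi}"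
    by auto
  ultimately show ?thesis
    unfolding arc_length_def
    by (simp add: emeasure_distr[OF cis_measurable_circle] space_restrict_space
        emeasure_restrict_space)
qed

text \<open>
  Functions on the circle are represented by functions on \<open>\<complex>\<close> whose values off the circle are
  irrelevant.
\<close>

definition ess_bounded :: "(complex \<Rightarrow> complex) set" where
  "ess_bounded = {f \<in> borel_measurable arc_length. \<exists>B. AE z in arc_length. cmod (f z) \<le> B}"

definition ae_eq :: "(complex \<Rightarrow> complex) \<Rightarrow> (complex \<Rightarrow> complex) \<Rightarrow> bool" where
  "ae_eq f g \<longleftrightarrow> f \<in> ess_bounded \<and> g \<in> ess_bounded \<and> (AE z in arc_length. f z = g z)"

lemma ess_bounded_const: "(\<lambda>_. c) \<in> ess_bounded"
  by (auto simp: ess_bounded_def intro!: exI[of _ "cmod c"])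

lemma ess_bounded_add:
  assumes "f \<in> ess_bounded" "g \<in> ess_bounded"
  shows "(\<lambda>z. f z + g z) \<in> ess_bounded"
proof -
  obtain B C where "AE z in arc_length. cmod (f z) \<le> B" "AE z in arc_length. cmod (g z) \<le> C"
    using assms by (auto simp: ess_bounded_def)
  then have "AE z in arc_length. cmod (f z + g z) \<le> B + C"
    by eventually_elim (meson add_mono norm_triangle_le)
  then show ?thesis
    using assms by (auto simp: ess_bounded_def)
qed

lemma ess_bounded_mult:
  assumes "f \<in> ess_bounded" "g \<in> ess_bounded"
  shows "(\<lambda>z. f z * g z) \<in> ess_bounded"
proof -
  obtain B C where "AE z in arc_length. cmod (f z) \<le> B" "AE z in arc_length. cmod (g z) \<le> C"
    using assms by (auto simp: ess_bounded_def)
  then have "AE z in arc_length. cmod (f z * g z) \<le> \<bar>B\<bar> * \<bar>C\<bar>"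
    by eventually_elim (auto simp: norm_mult intro!: mult_mono)
  then show ?thesis
    using assms by (auto simp: ess_bounded_def)
qed

lemma ess_bounded_uminus: "f \<in> ess_bounded \<Longrightarrow> (\<lambda>z. - f z) \<in> ess_bounded"
  using ess_bounded_mult[OF ess_bounded_const[of "-1"], of f] by simp

lemma ess_bounded_diff:
  "f \<in> ess_bounded \<Longrightarrow> g \<in> ess_bounded \<Longrightarrow> (\<lambda>z. f z - g z) \<in> ess_bounded"
  using ess_bounded_add[OF _ ess_bounded_uminus, of f g] by simp

quotient_type circle_Linf = "complex \<Rightarrow> complex" / partial: ae_eq
proof (rule part_equivpI)
  show "\<exists>f. ae_eq f f"
    using ess_bounded_const by (auto simp: ae_eq_def)
  show "symp ae_eq"
    by (auto simp: symp_def ae_eq_def elim: AE_mp)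
  show "transp ae_eq"
  proof (rule transpI)
    fix f g h assume *: "ae_eq f g" "ae_eq g h"
    then have "AE z in arc_length. f z = g z" "AE z in arc_length. g z = h z"
      by (auto simp: ae_eq_def)
    then have "AE z in arc_length. f z = h z"
      by eventually_elim simp
    with * show "ae_eq f h" by (simp add: ae_eq_def)
  qed
qed

text \<open>
  The class of \<open>f\<close> in \<open>L\<^sup>\<infinity>\<close>; it is only meaningful for \<open>f \<in> ess_bounded\<close>.
\<close>

abbreviation ae_class :: "(complex \<Rightarrow> complex) \<Rightarrow> circle_Linf" where
  "ae_class \<equiv> abs_circle_Linf"

lemma ae_class_eq_iff:
  assumes "f \<in> ess_bounded" "g \<in> ess_bounded"
  shows "ae_class f = ae_class g \<longleftrightarrow> (AE z in arc_length. f z = g z)"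
  using Quotient3_rel_abs[OF Quotient3_circle_Linf, of f g]
    Quotient3_rel[OF Quotient3_circle_Linf, of f g] assms
  by (auto simp: ae_eq_def)

instantiation circle_Linf :: complex_comm_algebra_1
begin

lift_definition zero_circle_Linf :: circle_Linf is "\<lambda>_. 0"
  by (simp add: ae_eq_def ess_bounded_const)

lift_definition one_circle_Linf :: circle_Linf is "\<lambda>_. 1"
  by (simp add: ae_eq_def ess_bounded_const)

lift_definition plus_circle_Linf :: "circle_Linf \<Rightarrow> circle_Linf \<Rightarrow> circle_Linf"
  is "\<lambda>f g z. f z + g z"
  by (auto simp: ae_eq_def ess_bounded_add)

lift_definition minus_circle_Linf :: "circle_Linf \<Rightarrow> circle_Linf \<Rightarrow> circle_Linf"
  is "\<lambda>f g z. f z - g z"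
  by (auto simp: ae_eq_def ess_bounded_diff)

lift_definition uminus_circle_Linf :: "circle_Linf \<Rightarrow> circle_Linf"
  is "\<lambda>f z. - f z"
  by (auto simp: ae_eq_def ess_bounded_uminus)

lift_definition times_circle_Linf :: "circle_Linf \<Rightarrow> circle_Linf \<Rightarrow> circle_Linf"
  is "\<lambda>f g z. f z * g z"
  by (auto simp: ae_eq_def ess_bounded_mult)

lift_definition scaleC_circle_Linf :: "complex \<Rightarrow> circle_Linf \<Rightarrow> circle_Linf"
  is "\<lambda>c f z. c * f z"
  by (auto simp: ae_eq_def ess_bounded_mult ess_bounded_const)

instance
proof
  show "(0 :: circle_Linf) \<noteq> 1"
  proof
    assume "(0 :: circle_Linf) = 1"
    then have "AE z in arc_length. (0::complex) = 1"
      by transfer (simp add: ae_eq_def)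
    then obtain N where N: "{z \<in> space arc_length. \<not> False} \<subseteq> N"
        "emeasure arc_length N = 0" "N \<in> sets arc_length"
      by (auto elim!: AE_E)
    have "emeasure arc_length circle \<le> emeasure arc_length N"
      using N by (intro emeasure_mono) auto
    then show False
      using N by (simp add: emeasure_arc_length_circle)
  qed
qed (transfer; auto simp: ae_eq_def algebra_simps ess_bounded_add ess_bounded_mult
      ess_bounded_diff ess_bounded_uminus ess_bounded_const)+

end

definition almost_periodic :: "(real \<Rightarrow> complex) \<Rightarrow> bool" where
  "almost_periodic f \<longleftrightarrow> continuous_on UNIV f \<and>
     (\<forall>\<epsilon>>0. \<exists>l>0. \<forall>t0. \<exists>\<tau>\<in>{t0..t0 + l}. \<forall>t. cmod (f t - f (t + \<tau>)) < \<epsilon>)"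

text \<open>Only the homeomorphism type matters here, so the group structure is omitted.\<close>

definition bohr_compactification :: "((real \<Rightarrow> complex) \<Rightarrow> complex) topology" where
  "bohr_compactification = max_ideal_space {f. almost_periodic f}"

definition circle_arc :: "real \<Rightarrow> real \<Rightarrow> real \<Rightarrow> complex set" where
  "circle_arc t0 k s = {cis (t0 + k * t) |t. 0 < t \<and> t < s}"

definition almost_periodic_on_arc :: "real \<Rightarrow> real \<Rightarrow> real \<Rightarrow> (complex \<Rightarrow> complex) \<Rightarrow> bool" where
  "almost_periodic_on_arc t0 k s h \<longleftrightarrow> continuous_on (circle_arc t0 k s) h \<and>
     (\<exists>g. almost_periodic g \<and> (\<forall>t<0. h (cis (t0 + k * s * exp t)) = g t))"

definition C_circle :: "circle_Linf set" where
  "C_circle = {ae_class f |f. f \<in> ess_bounded \<and> continuous_on circle f}"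

definition AP_circle :: "circle_Linf set" where
  "AP_circle = {ae_class f |f. f \<in> ess_bounded \<and>
     (\<forall>t0. \<forall>\<epsilon>>0. \<exists>s\<in>{0<..<pi}. \<exists>h :: real \<Rightarrow> complex \<Rightarrow> complex. \<forall>k\<in>{-1, 1}.
        almost_periodic_on_arc t0 k s (h k) \<and>
        esssup (restrict_space arc_length (circle_arc t0 k s)) (\<lambda>z. ereal (cmod (f z - h k z))) < ereal \<epsilon>)}"

definition AP_alg :: "complex set \<Rightarrow> circle_Linf set" where
  "AP_alg S = AP_circle \<inter> {ae_class f |f. f \<in> ess_bounded \<and> continuous_on (circle - S) f}"

definition first_kind :: "complex set \<Rightarrow> (complex \<Rightarrow> complex) set" where
  "first_kind S = {f \<in> ess_bounded. continuous_on (circle - S) f \<and>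
     (\<forall>z\<in>S. \<forall>k\<in>{-1, 1}. \<exists>L. ((\<lambda>t. f (z * cis (k * t))) \<longlongrightarrow> L) (at_right 0))}"

definition R_alg :: "complex set \<Rightarrow> circle_Linf set" where
  "R_alg S = ae_class ` first_kind S"

text \<open>
  A class in \<open>C_circle\<close> has exactly one continuous representative on the circle, so the choice
  below is immaterial.
\<close>

definition point_eval :: "complex \<Rightarrow> circle_Linf \<Rightarrow> complex" where
  "point_eval z = (\<lambda>F\<in>C_circle.
     (SOME f. f \<in> ess_bounded \<and> continuous_on circle f \<and> F = ae_class f) z)"

definition r_map :: "complex set \<Rightarrow> (circle_Linf \<Rightarrow> complex) \<Rightarrow> circle_Linf \<Rightarrow> complex" where
  "r_map S \<eta> = restrict \<eta> (R_alg S)"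

text \<open>
  The map dual to \<open>C_circle \<subseteq> R_alg S\<close>, followed by the identification of the characters of \<open>C_circle\<close>
  with the points of the circle.
\<close>

definition c_map :: "(circle_Linf \<Rightarrow> complex) \<Rightarrow> complex" where
  "c_map \<phi> = inv_into circle point_eval (restrict \<phi> C_circle)"

definition c_fibre :: "complex set \<Rightarrow> complex set \<Rightarrow> (circle_Linf \<Rightarrow> complex) set" where
  "c_fibre S T = {\<phi> \<in> characters (R_alg S). c_map \<phi> \<in> T}"

end

theory Submission
  imports Defs
begin

text \<open>
  Near a point \<open>e\<^sup>i\<^sup>t\<close> every \<open>f \<in> AP(S)\<close> agrees on either side, up to an error tending to \<open>0\<close>, with
  \<open>g (ln u)\<close> for a unique almost periodic \<open>g\<close>, the germ of \<open>f\<close>; it is constant when \<open>f \<in> R\<^sub>S\<close> or when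
  \<open>f\<close> is continuous at the point.  A character \<open>\<phi>\<close> of a self-adjoint, inverse closed algebra is
  approximated on finitely many elements by values of these elements on sets of positive measure.
  Hence over \<open>z \<notin> S\<close> a character is the evaluation at \<open>z\<close>.  Over \<open>z \<in> S\<close> the branch of the argument
  with jump at \<open>z\<close> belongs to \<open>R\<^sub>S\<close> and a character maps it to one of its two one-sided limits.  This
  chooses a side of \<open>z\<close>, and the character then factors through the germ on that side, which gives
  \<open>z\<^sub>+\<close>, \<open>z\<^sub>-\<close> on \<open>R\<^sub>S\<close>, and a character of the almost periodic functions on \<open>\<real>\<close> on \<open>AP(S)\<close>.
\<close>

section \<open>Almost periodic functions\<close>

text \<open>Classes modulo null sets have no values at points of S, so everything near S is read
  along the filter \<open>essR\<close>. The coordinate \<open>ln u\<close> turns the approach of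
  \<open>u\<close> to 0 into a passage to minus infinity, where an almost periodic function comes
  back near each of its values; hence a bound near the base point is a bound on the whole line,
  which yields uniqueness, existence and invertibility of germs alike. Characters are purely
  algebraic: their boundedness, and with it compactness, has to come from the invertibility of
  functions bounded away from 0. Germs are lifted back to the circle by a linear map that is
  multiplicative only up to functions with germ 0 on the chosen side; such functions tend to 0 there
  and are annihilated by every character that has chosen this side. Total disconnectedness cannot
  come from S, which may contain arcs or be the whole circle. It comes from the jumps: if a
  connected set over S had two base points, it would have infinitely many, and two of these carry
  jumps whose difference is finitely valued yet separates two others.\<close>

lemma almost_periodic_continuous: "almost_periodic f \<Longrightarrow> continuous_on UNIV f"
  by (simp add: almost_periodic_def)

lemma almost_periodic_translation:
  assumes "almost_periodic f" "\<epsilon> > 0"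
  obtains l where "l > 0" "\<And>t0. \<exists>\<tau>\<in>{t0..t0 + l}. \<forall>t. cmod (f t - f (t + \<tau>)) < \<epsilon>"
  using assms by (auto simp: almost_periodic_def)

text \<open>A translation number for \<epsilon>/3 moves both points into one compact interval, where
  continuity is uniform. The margin 1 on either side of \<open>[0, l]\<close> is room for the second
  point, hence \<open>min d 1\<close>.\<close>

lemma almost_periodic_uniformly_continuous:
  assumes "almost_periodic f" "\<epsilon> > 0"
  obtains \<delta> where "\<delta> > 0" "\<And>s t. \<bar>s - t\<bar> < \<delta> \<Longrightarrow> cmod (f s - f t) < \<epsilon>"
proof -
  obtain l where l: "l > 0" "\<And>t0. \<exists>\<tau>\<in>{t0..t0 + l}. \<forall>t. cmod (f t - f (t + \<tau>)) < \<epsilon>/3"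
    using almost_periodic_translation[OF assms(1), of "\<epsilon>/3"] assms(2) by auto
  have "uniformly_continuous_on {-1..l+1} f"
    by (rule compact_uniformly_continuous)
       (auto intro: continuous_on_subset[OF almost_periodic_continuous[OF assms(1)]])
  then obtain d where d: "d > 0" "\<And>s t. s \<in> {-1..l+1} \<Longrightarrow> t \<in> {-1..l+1} \<Longrightarrow> dist s t < d \<Longrightarrow> dist (f s) (f t) < \<epsilon>/3"
    unfolding uniformly_continuous_on_def using assms(2) by (metis divide_pos_pos zero_less_numeral dist_commute)
  show ?thesis
  proof (rule that[of "min d 1"])
    show "min d 1 > 0" using d by simp
    fix s t :: real assume st: "\<bar>s - t\<bar> < min d 1"
    obtain \<tau> where \<tau>: "\<tau> \<in> {-s..-s + l}" "\<And>t. cmod (f t - f (t + \<tau>)) < \<epsilon>/3"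
      using l(2) by blast
    have "cmod (f (s + \<tau>) - f (t + \<tau>)) < \<epsilon>/3"
    proof -
      have "s + \<tau> \<in> {-1..l+1}" "t + \<tau> \<in> {-1..l+1}"
        using st \<tau>(1) unfolding atLeastAtMost_iff by linarith+
      then show ?thesis
        using d(2)[of "s + \<tau>" "t + \<tau>"] st by (simp add: dist_norm)
    qed
    moreover have eq: "f s - f t = (f s - f (s + \<tau>)) + (f (s + \<tau>) - f (t + \<tau>)) - (f t - f (t + \<tau>))"
      by simp
    ultimately show "cmod (f s - f t) < \<epsilon>"
      using \<tau>(2)[of s] \<tau>(2)[of t] norm_triangle_ineq[of "f s - f (s + \<tau>)" "f (s + \<tau>) - f (t + \<tau>)"]
        norm_triangle_ineq4[of "(f s - f (s + \<tau>)) + (f (s + \<tau>) - f (t + \<tau>))" "f t - f (t + \<tau>)"]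
      by (subst eq) linarith
  qed
qed

lemma almost_periodic_bounded:
  assumes "almost_periodic f"
  obtains B where "B > 0" "\<And>t. cmod (f t) \<le> B"
proof -
  obtain l where l: "l > 0" "\<And>t0. \<exists>\<tau>\<in>{t0..t0 + l}. \<forall>t. cmod (f t - f (t + \<tau>)) < 1"
    using almost_periodic_translation[OF assms, of 1] by auto
  have "compact (f ` {0..l})"
    by (intro compact_continuous_image continuous_on_subset[OF almost_periodic_continuous[OF assms]]) auto
  then obtain B where B: "B > 0" "\<And>t. t \<in> {0..l} \<Longrightarrow> cmod (f t) \<le> B"
    by (metis compact_imp_bounded bounded_pos imageI)
  show ?thesis
  proof (rule that[of "B + 1"])
    fix t
    obtain \<tau> where \<tau>: "\<tau> \<in> {-t..-t + l}" "\<And>t. cmod (f t - f (t + \<tau>)) < 1"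
      using l(2) by blast
    have "t + \<tau> \<in> {0..l}" using \<tau>(1) by auto
    then show "cmod (f t) \<le> B + 1"
      using B(2)[of "t + \<tau>"] \<tau>(2)[of t] norm_triangle_sub[of "f t" "f (t + \<tau>)"] by linarith
  qed (use B in auto)
qed

text \<open>Bochner's criterion: the translates of \<open>f\<close> are totally bounded in the sup
  norm. An almost period brings the shift \<open>a\<close> into \<open>[0, l]\<close>, and uniform
  continuity makes a finite \<delta>-net of this interval suffice.\<close>

lemma almost_periodic_finite_net:
  assumes "almost_periodic f" "\<epsilon> > 0"
  obtains A :: "real set" where "finite A"
    "\<And>a. \<exists>b\<in>A. \<forall>t. cmod (f (t + a) - f (t + b)) < \<epsilon>"
proof -
  obtain l where l: "l > 0" "\<And>t0. \<exists>\<tau>\<in>{t0..t0 + l}. \<forall>t. cmod (f t - f (t + \<tau>)) < \<epsilon>/2"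
    using almost_periodic_translation[OF assms(1), of "\<epsilon>/2"] assms(2) by auto
  obtain \<delta> where \<delta>: "\<delta> > 0" "\<And>s t. \<bar>s - t\<bar> < \<delta> \<Longrightarrow> cmod (f s - f t) < \<epsilon>/2"
    using almost_periodic_uniformly_continuous[OF assms(1), of "\<epsilon>/2"] assms(2) by auto
  obtain A where A: "finite A" "{0..l} \<subseteq> (\<Union>b\<in>A. ball b \<delta>)"
    using compact_eq_totally_bounded[of "{0..l}"] \<delta>(1) by auto
  show ?thesis
  proof (rule that[OF A(1)])
    fix a
    obtain \<tau> where \<tau>: "\<tau> \<in> {-a..-a + l}" "\<And>t. cmod (f t - f (t + \<tau>)) < \<epsilon>/2"
      using l(2) by blast
    then have "a + \<tau> \<in> {0..l}" by auto
    then obtain b where b: "b \<in> A" "dist b (a + \<tau>) < \<delta>" using A(2) by auto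
    have "cmod (f (t + a) - f (t + b)) < \<epsilon>" for t
    proof -
      have "cmod (f (t + a + \<tau>) - f (t + b)) < \<epsilon>/2"
        using \<delta>(2)[of "t + a + \<tau>" "t + b"] b(2) by (simp add: dist_norm abs_minus_commute)
      then show ?thesis
        using \<tau>(2)[of "t + a"] norm_diff_triangle_less by (metis field_sum_of_halves)
    qed
    with b(1) show "\<exists>b\<in>A. \<forall>t. cmod (f (t + a) - f (t + b)) < \<epsilon>" by blast
  qed
qed

text \<open>By compactness (Bochner) \<open>f\<close> and \<open>g\<close> have common \<open>\<delta>\<close>-periods, and these are \<open>\<epsilon>\<close>-periods of \<open>h\<close>.\<close>

lemma almost_periodic_combine:
  assumes f: "almost_periodic f" and g: "almost_periodic g" and h: "continuous_on UNIV h"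
    and dep: "\<And>\<epsilon>. \<epsilon> > 0 \<Longrightarrow>
      \<exists>\<delta>>0. \<forall>s t. cmod (f s - f t) < \<delta> \<longrightarrow> cmod (g s - g t) < \<delta> \<longrightarrow> cmod (h s - h t) < \<epsilon>"
  shows "almost_periodic h"
  unfolding almost_periodic_def
proof (intro conjI h allI impI)
  fix \<epsilon> :: real assume "\<epsilon> > 0"
  then obtain \<delta> where \<delta>: "\<delta> > 0"
    "\<And>s t. cmod (f s - f t) < \<delta> \<Longrightarrow> cmod (g s - g t) < \<delta> \<Longrightarrow> cmod (h s - h t) < \<epsilon>"
    using dep by blast
  obtain A where A: "finite A" "\<And>a. \<exists>b\<in>A. \<forall>t. cmod (f (t + a) - f (t + b)) < \<delta>/2"
    using almost_periodic_finite_net[OF f, of "\<delta>/2"] \<delta>(1) by auto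
  obtain B where B: "finite B" "\<And>a. \<exists>b\<in>B. \<forall>t. cmod (g (t + a) - g (t + b)) < \<delta>/2"
    using almost_periodic_finite_net[OF g, of "\<delta>/2"] \<delta>(1) by auto
  define P where "P a p \<longleftrightarrow> (\<forall>t. cmod (f (t + a) - f (t + fst p)) < \<delta>/2) \<and>
    (\<forall>t. cmod (g (t + a) - g (t + snd p)) < \<delta>/2)" for a p
  have ex: "\<exists>p\<in>A \<times> B. P a p" for a
    using A(2)[of a] B(2)[of a] by (auto simp: P_def)
  \<comment> \<open>Shifts fall into finitely many classes \<open>p\<close>, and two shifts in one
    class differ by a common \<delta>-period of \<open>f\<close> and \<open>g\<close>. Subtracting
    the representative \<open>c p\<close> of the class of \<open>t0 + M\<close> thus gives a period,
    and it lies in \<open>[t0, t0 + 2 M]\<close> because the representatives are at most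
    \<open>M\<close> in absolute value.\<close>
  define c where "c p = (SOME a. P a p)" for p
  have c: "P a p \<Longrightarrow> P (c p) p" for a p
    unfolding c_def by (rule someI)
  define M where "M = Max (insert 1 ((\<lambda>p. \<bar>c p\<bar>) ` (A \<times> B)))"
  have fin: "finite (insert 1 ((\<lambda>p. \<bar>c p\<bar>) ` (A \<times> B)))" using A(1) B(1) by auto
  have M: "M \<ge> 1" "\<And>p. p \<in> A \<times> B \<Longrightarrow> \<bar>c p\<bar> \<le> M"
    unfolding M_def using fin by (auto intro!: Max_ge)
  have key: "cmod (u (t + a) - u (t + b)) < \<delta>"
    if "\<And>t. cmod (u (t + a) - u (t + x)) < \<delta>/2" "\<And>t. cmod (u (t + b) - u (t + x)) < \<delta>/2"
    for u :: "real \<Rightarrow> complex" and a b x t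
    using norm_diff_triangle_less[OF that(1)[of t], of "u (t + b)" "\<delta>/2"] that(2)[of t]
    by (simp add: norm_minus_commute)
  show "\<exists>l>0. \<forall>t0. \<exists>\<tau>\<in>{t0..t0 + l}. \<forall>t. cmod (h t - h (t + \<tau>)) < \<epsilon>"
  proof (intro exI[of _ "2 * M"] conjI allI)
    show "2 * M > 0" using M by simp
    fix t0
    obtain p where p: "p \<in> A \<times> B" "P (t0 + M) p" using ex by blast
    let ?\<tau> = "t0 + M - c p"
    have "cmod (h t - h (t + ?\<tau>)) < \<epsilon>" for t
    proof (rule \<delta>(2))
      have *: "P (c p) p" using c p by blast
      show "cmod (f t - f (t + ?\<tau>)) < \<delta>"
        using key[of f "c p" "fst p" "t0 + M" "t - c p"] p(2) *
        by (simp add: P_def algebra_simps)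
      show "cmod (g t - g (t + ?\<tau>)) < \<delta>"
        using key[of g "c p" "snd p" "t0 + M" "t - c p"] p(2) *
        by (simp add: P_def algebra_simps)
    qed
    moreover have "?\<tau> \<in> {t0..t0 + 2 * M}" using M(2)[OF p(1)] by auto
    ultimately show "\<exists>\<tau>\<in>{t0..t0 + 2 * M}. \<forall>t. cmod (h t - h (t + \<tau>)) < \<epsilon>" by blast
  qed
qed

lemma almost_periodic_const: "almost_periodic (\<lambda>_. c)"
  unfolding almost_periodic_def
proof (intro conjI allI impI exI[of _ "1::real"])
  show "\<exists>\<tau>\<in>{t0..t0 + 1}. \<forall>t. cmod (c - c) < \<epsilon>" if "\<epsilon> > 0" for \<epsilon> t0 :: real
    using that by (intro bexI[of _ t0]) auto
qed auto

lemma almost_periodic_add: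
  assumes "almost_periodic f" "almost_periodic g"
  shows "almost_periodic (\<lambda>t. f t + g t)"
proof (rule almost_periodic_combine[OF assms])
  show "continuous_on UNIV (\<lambda>t. f t + g t)"
    using assms by (intro continuous_intros almost_periodic_continuous)
  fix \<epsilon> :: real assume e: "\<epsilon> > 0"
  have "cmod (f s + g s - (f t + g t)) < \<epsilon>"
    if "cmod (f s - f t) < \<epsilon>/2" "cmod (g s - g t) < \<epsilon>/2" for s t
    using norm_triangle_lt[of "f s - f t" "g s - g t" \<epsilon>] that by (simp add: algebra_simps)
  with e show "\<exists>\<delta>>0. \<forall>s t. cmod (f s - f t) < \<delta> \<longrightarrow> cmod (g s - g t) < \<delta> \<longrightarrow> cmod (f s + g s - (f t + g t)) < \<epsilon>"
    by (intro exI[of _ "\<epsilon>/2"]) auto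
qed

lemma almost_periodic_mult:
  assumes "almost_periodic f" "almost_periodic g"
  shows "almost_periodic (\<lambda>t. f t * g t)"
proof (rule almost_periodic_combine[OF assms])
  show "continuous_on UNIV (\<lambda>t. f t * g t)"
    using assms by (intro continuous_intros almost_periodic_continuous)
  obtain B C where B: "B > 0" "\<And>t. cmod (f t) \<le> B" and C: "C > 0" "\<And>t. cmod (g t) \<le> C"
    using assms almost_periodic_bounded by metis
  fix \<epsilon> :: real assume e: "\<epsilon> > 0"
  have "cmod (f s * g s - f t * g t) < \<epsilon>"
    if "cmod (f s - f t) < \<epsilon>/(B+C)" "cmod (g s - g t) < \<epsilon>/(B+C)" for s t
  proof -
    have "f s * g s - f t * g t = f s * (g s - g t) + (f s - f t) * g t"
      by (simp add: algebra_simps)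
    then have "cmod (f s * g s - f t * g t) \<le> B * cmod (g s - g t) + cmod (f s - f t) * C"
      using B(1) C(1) by (auto simp: norm_mult intro!: norm_triangle_le add_mono mult_mono B(2) C(2))
    also have "\<dots> < B * (\<epsilon>/(B+C)) + (\<epsilon>/(B+C)) * C"
      using that B(1) C(1) by (intro add_strict_mono mult_strict_left_mono mult_strict_right_mono) auto
    also have "\<dots> = \<epsilon>/(B+C) * (B + C)" by (simp only: ring_distribs mult.commute[of B] mult.commute[of C])
    also have "\<dots> = \<epsilon>" using B(1) C(1) by simp
    finally show ?thesis .
  qed
  with e B(1) C(1) show "\<exists>\<delta>>0. \<forall>s t. cmod (f s - f t) < \<delta> \<longrightarrow> cmod (g s - g t) < \<delta> \<longrightarrow> cmod (f s * g s - f t * g t) < \<epsilon>"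
    by (intro exI[of _ "\<epsilon>/(B+C)"]) auto
qed

lemma almost_periodic_diff:
  "almost_periodic f \<Longrightarrow> almost_periodic g \<Longrightarrow> almost_periodic (\<lambda>t. f t - g t)"
  using almost_periodic_add[of f "\<lambda>t. - 1 * g t"] almost_periodic_mult[OF almost_periodic_const[of "-1"], of g]
  by simp

lemma almost_periodic_cnj:
  assumes "almost_periodic f"
  shows "almost_periodic (\<lambda>t. cnj (f t))"
proof (rule almost_periodic_combine[OF assms assms])
  show "continuous_on UNIV (\<lambda>t. cnj (f t))"
    using assms by (intro continuous_intros almost_periodic_continuous)
qed (metis complex_cnj_diff complex_mod_cnj)

lemma almost_periodic_inverse:
  assumes f: "almost_periodic f" and c: "c > 0" "\<And>t. cmod (f t) \<ge> c"
  shows "almost_periodic (\<lambda>t. inverse (f t))"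
proof (rule almost_periodic_combine[OF f f])
  have nz: "f t \<noteq> 0" for t using c(2)[of t] c(1) by auto
  show "continuous_on UNIV (\<lambda>t. inverse (f t))"
    using f nz by (intro continuous_intros almost_periodic_continuous) auto
  fix \<epsilon> :: real assume e: "\<epsilon> > 0"
  have "cmod (inverse (f s) - inverse (f t)) < \<epsilon>" if "cmod (f s - f t) < \<epsilon> * c * c" for s t
  proof -
    have "inverse (f s) - inverse (f t) = (f t - f s) / (f s * f t)"
      using nz by (simp add: field_simps)
    then have "cmod (inverse (f s) - inverse (f t)) = cmod (f s - f t) / (cmod (f s) * cmod (f t))"
      by (simp add: norm_divide norm_mult norm_minus_commute)
    also have "\<dots> \<le> cmod (f s - f t) / (c * c)"
      using c by (intro divide_left_mono mult_mono mult_pos_pos) (auto simp: nz)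
    also have "\<dots> < \<epsilon>"
      using that c(1) by (simp add: divide_less_eq mult.assoc)
    finally show ?thesis .
  qed
  with e c show "\<exists>\<delta>>0. \<forall>s t. cmod (f s - f t) < \<delta> \<longrightarrow> cmod (f s - f t) < \<delta> \<longrightarrow> cmod (inverse (f s) - inverse (f t)) < \<epsilon>"
    by (intro exI[of _ "\<epsilon>*c*c"]) auto
qed

lemma almost_periodic_shift:
  assumes "almost_periodic f"
  shows "almost_periodic (\<lambda>t. f (t + a))"
  unfolding almost_periodic_def
proof (intro conjI allI impI)
  show "continuous_on UNIV (\<lambda>t. f (t + a))"
    by (rule continuous_on_compose2[OF almost_periodic_continuous[OF assms]]) (auto intro: continuous_intros)
  fix \<epsilon> :: real assume "\<epsilon> > 0"
  then obtain l where l: "l > 0" "\<And>t0. \<exists>\<tau>\<in>{t0..t0 + l}. \<forall>t. cmod (f t - f (t + \<tau>)) < \<epsilon>"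
    using almost_periodic_translation[OF assms] by metis
  have "\<exists>\<tau>\<in>{t0..t0 + l}. \<forall>t. cmod (f (t + a) - f (t + \<tau> + a)) < \<epsilon>" for t0
    using l(2)[of t0] by (metis add.assoc add.commute)
  with l(1) show "\<exists>l>0. \<forall>t0. \<exists>\<tau>\<in>{t0..t0 + l}. \<forall>t. cmod (f (t + a) - f (t + \<tau> + a)) < \<epsilon>"
    by blast
qed

lemma almost_periodic_uniform_limit:
  assumes f: "\<And>n. almost_periodic (f n)" and lim: "uniform_limit UNIV f g sequentially"
  shows "almost_periodic g"
  unfolding almost_periodic_def
proof (intro conjI allI impI)
  show "continuous_on UNIV g"
    using f by (intro uniform_limit_theorem[OF _ lim]) (auto simp: almost_periodic_def)
  fix \<epsilon> :: real assume e: "\<epsilon> > 0"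
  then have "\<forall>\<^sub>F n in sequentially. \<forall>t. dist (f n t) (g t) < \<epsilon>/3"
    using uniform_limitD[OF lim, of "\<epsilon>/3"] by simp
  then obtain n where n: "\<And>t. dist (f n t) (g t) < \<epsilon>/3"
    by (auto simp: eventually_sequentially)
  obtain l where l: "l > 0" "\<And>t0. \<exists>\<tau>\<in>{t0..t0 + l}. \<forall>t. cmod (f n t - f n (t + \<tau>)) < \<epsilon>/3"
    using almost_periodic_translation[OF f[of n], of "\<epsilon>/3"] e by auto
  have "cmod (g t - g (t + \<tau>)) < \<epsilon>" if "cmod (f n t - f n (t + \<tau>)) < \<epsilon>/3" for t \<tau>
    using n[of t] n[of "t + \<tau>"] that
    by (smt (verit) dist_norm dist_commute dist_triangle2 dist_triangle_third)
  then show "\<exists>l>0. \<forall>t0. \<exists>\<tau>\<in>{t0..t0 + l}. \<forall>t. cmod (g t - g (t + \<tau>)) < \<epsilon>"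
    using l by meson
qed

section \<open>Essential one-sided limits\<close>

text \<open>Right neighbourhoods of 0 modulo Lebesgue null sets: limits along this filter depend
  only on the class of a function in L-infinity, unlike limits along
  \<open>at_right 0\<close>.\<close>

definition essR :: "real filter" where
  "essR = inf (ae_filter lborel) (at_right 0)"

lemma eventually_essR:
  "eventually P essR \<longleftrightarrow> (\<exists>s>0. AE u in lborel. 0 < u \<and> u < s \<longrightarrow> P u)"
proof
  assume "eventually P essR"
  then obtain Q R where QR: "AE u in lborel. Q u" "eventually R (at_right 0)" "\<And>u. Q u \<Longrightarrow> R u \<Longrightarrow> P u"
    by (auto simp: essR_def eventually_inf)
  then obtain s where s: "s > 0" "\<And>u. 0 < u \<Longrightarrow> u < s \<Longrightarrow> R u"
    by (auto simp: eventually_at_right_field)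
  have "AE u in lborel. 0 < u \<and> u < s \<longrightarrow> P u"
    using QR(1) by eventually_elim (use s QR in auto)
  with s show "\<exists>s>0. AE u in lborel. 0 < u \<and> u < s \<longrightarrow> P u" by blast
next
  assume "\<exists>s>0. AE u in lborel. 0 < u \<and> u < s \<longrightarrow> P u"
  then obtain s where s: "s > 0" "AE u in lborel. 0 < u \<and> u < s \<longrightarrow> P u" by blast
  have "eventually (\<lambda>u. 0 < u \<and> u < s) (at_right (0::real))"
    using s(1) by (auto simp: eventually_at_right_field)
  then show "eventually P essR"
    unfolding essR_def eventually_inf using s(2)
    by (intro exI[of _ "\<lambda>u. 0 < u \<and> u < s \<longrightarrow> P u"] exI[of _ "\<lambda>u. 0 < u \<and> u < s"]) auto
qed

lemma essR_le: "essR \<le> at_right 0"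
  by (simp add: essR_def)

lemma AE_lborel_dense:
  assumes "AE u in lborel. P (u::real)" "open U" "U \<noteq> {}"
  shows "\<exists>u\<in>U. P u"
proof (rule ccontr)
  assume "\<not> ?thesis"
  then have "AE u in lborel. u \<notin> U" using assms(1) by (auto elim: AE_mp)
  then have "U \<in> null_sets lborel" using assms(2) by (subst (asm) AE_iff_null_sets[symmetric]) auto
  then have "negligible U" by (simp add: negligible_iff_null_sets null_sets_completionI)
  then show False using assms open_not_negligible by blast
qed

lemma essR_neq_bot [simp]: "essR \<noteq> bot"
proof
  assume "essR = bot"
  then have "eventually (\<lambda>_. False) essR" by simp
  then obtain s :: real where s: "s > 0" "AE u in lborel. 0 < u \<and> u < s \<longrightarrow> False"
    unfolding eventually_essR by (elim exE conjE) (rule that)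
  then show False using AE_lborel_dense[OF s(2), of "{0<..<s}"] by auto
qed

text \<open>By continuity the points that violate the condition form an open set, and a null open
  set is empty.\<close>

lemma eventually_essR_imp_at_right:
  assumes ev: "eventually (\<lambda>u. \<phi> u \<in> K) essR" and "closed K" and "continuous_on {0<..} \<phi>"
  shows "\<exists>s>0. \<forall>u\<in>{0<..<s}. \<phi> u \<in> K"
proof -
  obtain s where s: "s > 0" "AE u in lborel. 0 < u \<and> u < s \<longrightarrow> \<phi> u \<in> K"
    using ev by (auto simp: eventually_essR)
  have "\<phi> u \<in> K" if u: "u \<in> {0<..<s}" for u
  proof (rule ccontr)
    assume n: "\<phi> u \<notin> K"
    have "open ({0<..<s} \<inter> \<phi> -` (- K))"
      using assms by (intro continuous_open_preimage) (auto intro: continuous_on_subset)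
    moreover have "u \<in> {0<..<s} \<inter> \<phi> -` (- K)" using n u by auto
    ultimately obtain v where "v \<in> {0<..<s} \<inter> \<phi> -` (- K)" "0 < v \<and> v < s \<longrightarrow> \<phi> v \<in> K"
      using AE_lborel_dense[OF s(2)] by (metis empty_iff)
    then show False by auto
  qed
  with s show ?thesis by blast
qed

text \<open>Rigidity: almost periods far to the left reproduce every value of \<open>g\<close>, up
  to any error, near minus infinity, that is at \<open>ln u\<close> for \<open>u\<close> near 0. A
  closed condition that holds near 0 therefore holds on the whole line.\<close>

lemma almost_periodic_ln_closed:
  assumes g: "almost_periodic g" and K: "closed K"
    and ev: "eventually (\<lambda>u. g (ln u) \<in> K) essR"
  shows "g t \<in> K"
proof (rule ccontr)
  assume n: "g t \<notin> K"
  obtain r where r: "r > 0" "ball (g t) r \<subseteq> - K"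
    using K n by (metis open_Compl ComplI openE)
  have "continuous_on {0<..} (\<lambda>u. g (ln u))"
    by (rule continuous_on_compose2[OF almost_periodic_continuous[OF g]]) (auto intro!: continuous_intros)
  then obtain s where s: "s > 0" "\<forall>u\<in>{0<..<s}. g (ln u) \<in> K"
    using eventually_essR_imp_at_right[OF ev K] by blast
  obtain l where l: "l > 0" "\<And>t0. \<exists>\<tau>\<in>{t0..t0 + l}. \<forall>t. cmod (g t - g (t + \<tau>)) < r"
    using almost_periodic_translation[OF g r(1)] by metis
  \<comment> \<open>The interval starts so far left that \<open>t + \<tau> \<le> ln s - 1\<close>,
    so \<open>exp (t + \<tau>)\<close> lies in \<open>(0, s)\<close>.\<close>
  obtain \<tau> where \<tau>: "\<tau> \<in> {ln s - t - 1 - l..ln s - t - 1 - l + l}" "\<And>t. cmod (g t - g (t + \<tau>)) < r"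
    using l(2)[of "ln s - t - 1 - l"] by blast
  have "exp (t + \<tau>) < exp (ln s)" using \<tau>(1) by (subst exp_less_cancel_iff) auto
  then have "exp (t + \<tau>) \<in> {0<..<s}" using s(1) by auto
  then have "g (ln (exp (t + \<tau>))) \<in> K" using s(2) by blast
  then have "g (t + \<tau>) \<in> K" by simp
  moreover have "g (t + \<tau>) \<in> ball (g t) r" using \<tau>(2) by (auto simp: dist_norm)
  ultimately show False using r by blast
qed

lemma almost_periodic_ln_tendsto_unique:
  assumes "almost_periodic g" "((\<lambda>u. g (ln u)) \<longlongrightarrow> L) essR"
  shows "g t = L"
proof -
  have "cmod (g t - L) \<le> \<epsilon>" if "\<epsilon> > 0" for \<epsilon>
  proof -
    have "eventually (\<lambda>u. g (ln u) \<in> cball L \<epsilon>) essR"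
      using tendstoD[OF assms(2) that] by eventually_elim (auto simp: dist_commute)
    then show ?thesis
      using almost_periodic_ln_closed[OF assms(1), of "cball L \<epsilon>" t] by (auto simp: dist_norm norm_minus_commute)
  qed
  then have "cmod (g t - L) \<le> 0" by (rule field_le_epsilon[where y=0, simplified])
  then show ?thesis by simp
qed

section \<open>Null sets for arc length\<close>

lemma sets_arc_length: "sets arc_length = sets (restrict_space borel circle)"
  by (simp add: arc_length_def)

lemma arc_length_sets_iff: "A \<in> sets arc_length \<longleftrightarrow> A \<in> sets borel \<and> A \<subseteq> circle"
  by (auto simp: sets_arc_length sets_restrict_space_iff)

lemma measurable_arc_length_cong: "borel_measurable arc_length = borel_measurable (restrict_space borel circle)"
  by (rule measurable_cong_sets) (simp_all add: sets_arc_length)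

lemma borel_measurable_arc_length: "f \<in> borel_measurable borel \<Longrightarrow> f \<in> borel_measurable arc_length"
  unfolding measurable_arc_length_cong by (rule measurable_restrict_space1)

lemma cis_reduce: "\<exists>n::int. t - 2 * pi * of_int n \<in> {0..<2 * pi}"
proof -
  have "t / (2*pi) - of_int \<lfloor>t / (2*pi)\<rfloor> \<ge> 0" "t / (2*pi) - of_int \<lfloor>t / (2*pi)\<rfloor> < 1"
    by linarith+
  then have "t - 2 * pi * of_int \<lfloor>t / (2*pi)\<rfloor> \<ge> 0" "t - 2 * pi * of_int \<lfloor>t / (2*pi)\<rfloor> < 2 * pi"
    by (simp_all add: field_simps)
  then show ?thesis by (intro exI[of _ "\<lfloor>t / (2*pi)\<rfloor>"]) simp
qed

lemma cis_minus_2pi_int: "cis (t - 2 * pi * of_int n) = cis t"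
  using cis_multiple_2pi[of "of_int n"] by (simp add: cis_divide[symmetric])

text \<open>Affine maps of slope 1 or -1 preserve null sets. Countability puts the quantifier over
  \<open>n\<close> inside the AE statement, so one exceptional set serves all determinations of an
  argument modulo 2 pi.\<close>

lemma AE_lborel_affine_sign:
  assumes "AE u in lborel. P (u::real)" "k \<in> {-1,1}"
  shows "AE u in lborel. \<forall>n::int. P (a + k * u - 2 * pi * of_int n)"
proof -
  obtain N where N: "{u. \<not> P u} \<subseteq> N" "N \<in> null_sets lborel"
    using assms(1) by (auto simp: eventually_ae_filter)
  have Nb: "N \<in> sets borel" using N(2) by auto
  have *: "AE u in lborel. u \<notin> N" by (rule AE_not_in[OF N(2)])
  have "AE u in lborel. (a - 2 * pi * of_int n) + k * u \<notin> N" for n :: int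
    using assms(2) Nb by (intro AE_borel_affine[OF _ _ *]) auto
  then have "AE u in lborel. \<forall>n::int. (a - 2 * pi * of_int n) + k * u \<notin> N"
    by (simp add: AE_all_countable)
  then show ?thesis
    by eventually_elim (use N(1) in \<open>auto simp: algebra_simps\<close>)
qed

lemma AE_arc_length_imp_lborel:
  assumes "AE z in arc_length. P z" "k \<in> {-1,1}"
  shows "AE u in lborel. P (cis (t0 + k * u))"
proof -
  have "AE t in restrict_space lborel {0..<2*pi}. P (cis t)"
    using AE_distrD[OF cis_measurable_circle assms(1)[unfolded arc_length_def]] .
  then have "AE t in lborel. t \<in> {0..<2*pi} \<longrightarrow> P (cis t)"
    by (subst (asm) AE_restrict_space_iff) auto
  from AE_lborel_affine_sign[OF this assms(2), of t0]
  show ?thesis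
  proof eventually_elim
    case (elim u)
    then show ?case using cis_reduce[of "t0 + k * u"] by (auto simp: cis_minus_2pi_int)
  qed
qed

text \<open>Along an image measure an AE statement pulls back freely, but it pushes forward by
  \<open>AE_distr_iff\<close> for a measurable set; this is where the second assumption
  enters.\<close>

lemma AE_arc_length_if_lborel:
  assumes "AE t in lborel. P (cis t)" "{z \<in> circle. P z} \<in> sets arc_length"
  shows "AE z in arc_length. P z"
proof -
  have "{z \<in> space (restrict_space borel circle). P z} \<in> sets (restrict_space borel circle)"
    using assms(2) by (simp add: space_restrict_space sets_arc_length)
  moreover have "AE t in restrict_space lborel {0..<2*pi}. P (cis t)"
    using assms(1) by (subst AE_restrict_space_iff) auto
  ultimately show ?thesis
    unfolding arc_length_def by (subst AE_distr_iff[OF cis_measurable_circle])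
qed

text \<open>An open interval is a countable union of compact ones, whose images under
  \<open>cis\<close> are compact; this argument is indifferent to arcs that wrap around.\<close>

lemma circle_arc_sets [measurable]: "circle_arc t0 k s \<in> sets borel"
proof -
  have "circle_arc t0 k s = (\<Union>n::nat. (\<lambda>u. cis (t0 + k * u)) ` {inverse (Suc n)..s - inverse (Suc n)})"
  proof (intro set_eqI iffI)
    fix z assume "z \<in> circle_arc t0 k s"
    then obtain t where t: "z = cis (t0 + k * t)" "0 < t" "t < s" by (auto simp: circle_arc_def)
    obtain n where "inverse (Suc n) < min t (s - t)"
      using reals_Archimedean[of "min t (s - t)"] t by auto
    then show "z \<in> (\<Union>n::nat. (\<lambda>u. cis (t0 + k * u)) ` {inverse (Suc n)..s - inverse (Suc n)})"
      using t by (intro UN_I[of n]) auto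
  next
    fix z assume "z \<in> (\<Union>n::nat. (\<lambda>u. cis (t0 + k * u)) ` {inverse (Suc n)..s - inverse (Suc n)})"
    then obtain n u where u: "z = cis (t0 + k * u)" "inverse (Suc n) \<le> u" "u \<le> s - inverse (Suc n)"
      by auto
    moreover have "inverse (real (Suc n)) > 0" by simp
    ultimately have "0 < u" "u < s" by linarith+
    with u show "z \<in> circle_arc t0 k s" by (auto simp: circle_arc_def)
  qed
  moreover have "closed ((\<lambda>u. cis (t0 + k * u)) ` {inverse (Suc n)..s - inverse (Suc n)})" for n :: nat
    by (intro compact_imp_closed compact_continuous_image continuous_intros) auto
  then have "(\<Union>n::nat. (\<lambda>u. cis (t0 + k * u)) ` {inverse (Suc n)..s - inverse (Suc n)}) \<in> sets borel"
    by (intro sets.countable_UN) auto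
  ultimately show ?thesis by simp
qed

lemma circle_arc_subset: "circle_arc t0 k s \<subseteq> circle"
  by (auto simp: circle_arc_def)

lemma circle_arc_arc_length: "circle_arc t0 k s \<in> sets arc_length"
  by (simp add: arc_length_sets_iff circle_arc_subset circle_arc_sets)

lemma AE_circle_arc_imp_essR:
  assumes "AE z in arc_length. z \<in> circle_arc t0 k s \<longrightarrow> P z" "k \<in> {-1,1}" "s > 0"
  shows "eventually (\<lambda>u. P (cis (t0 + k * u))) essR"
proof -
  have "AE u in lborel. cis (t0 + k * u) \<in> circle_arc t0 k s \<longrightarrow> P (cis (t0 + k * u))"
    using AE_arc_length_imp_lborel[OF assms(1,2)] .
  then have "AE u in lborel. 0 < u \<and> u < s \<longrightarrow> P (cis (t0 + k * u))"
    by eventually_elim (auto simp: circle_arc_def)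
  with assms(3) show ?thesis by (auto simp: eventually_essR)
qed

lemma AE_imp_essR:
  assumes "AE z in arc_length. P z" "k \<in> {-1,1}"
  shows "eventually (\<lambda>u. P (cis (t0 + k * u))) essR"
  by (rule AE_circle_arc_imp_essR[of t0 k 1]) (use assms in \<open>auto elim: eventually_mono\<close>)

lemma essR_imp_AE_circle_arc:
  assumes ev: "eventually (\<lambda>u. P (cis (t0 + k * u))) essR" and k: "k \<in> {-1,1}"
    and P: "\<And>s. {z \<in> circle_arc t0 k s. P z} \<in> sets borel"
  shows "\<exists>s>0. AE z in arc_length. z \<in> circle_arc t0 k s \<longrightarrow> P z"
proof -
  obtain s where s: "s > 0" "AE u in lborel. 0 < u \<and> u < s \<longrightarrow> P (cis (t0 + k * u))"
    using ev by (auto simp: eventually_essR)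
  have "AE z in arc_length. z \<in> circle_arc t0 k s \<longrightarrow> P z"
  proof (rule AE_arc_length_if_lborel)
    have "{z \<in> circle. z \<in> circle_arc t0 k s \<longrightarrow> P z} = (circle - circle_arc t0 k s) \<union> {z \<in> circle_arc t0 k s. P z}"
      by (auto simp: circle_arc_def)
    then show "{z \<in> circle. z \<in> circle_arc t0 k s \<longrightarrow> P z} \<in> sets arc_length"
      using P circle_arc_subset[of t0 k s]
      by (subst arc_length_sets_iff) (simp add: circle_arc_sets, blast)
    \<comment> \<open>As \<open>k = 1 / k\<close>, the substitution \<open>t0 + k * u\<close> for
      \<open>t\<close> is inverted by \<open>- k * t0 + k * t\<close>. The winding number
      \<open>n\<close> is multiplied by \<open>k\<close> too, which is why its sign flips below for
      \<open>k = -1\<close>.\<close>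
    from AE_lborel_affine_sign[OF s(2) k, of "- k * t0"]
    show "AE t in lborel. cis t \<in> circle_arc t0 k s \<longrightarrow> P (cis t)"
    proof eventually_elim
      case (elim t)
      show ?case
      proof
        assume "cis t \<in> circle_arc t0 k s"
        then obtain u where u: "cis t = cis (t0 + k * u)" "0 < u" "u < s"
          by (auto simp: circle_arc_def)
        have "cis (t - (t0 + k * u)) = 1"
          using u(1) by (metis cis_divide cis_neq_zero divide_self)
        then obtain n :: int where n: "t - (t0 + k * u) = 2 * pi * of_int n"
          by (auto simp: complex_eq_iff cos_one_2pi_int)
        have "- k * t0 + k * t - 2 * pi * of_int (if k = 1 then n else - n) = u"
          using k n by (auto simp: algebra_simps)
        then show "P (cis t)" using elim[rule_format, of "if k = 1 then n else - n"] u by auto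
      qed
    qed
  qed
  with s show ?thesis by blast
qed

lemma AE_arc_length_dense:
  assumes "AE z in arc_length. P z" "open U" "w \<in> U" "w \<in> circle"
  shows "\<exists>z\<in>U \<inter> circle. P z"
proof -
  have "AE u in lborel. P (cis (0 + 1 * u))" by (rule AE_arc_length_imp_lborel[OF assms(1)]) simp
  moreover have "open (cis -` U)"
    using assms(2) by (intro open_vimage continuous_intros) auto
  moreover have "cis (Arg w) = w" using assms(4) by (subst cis_Arg) (auto simp: sgn_div_norm)
  then have "cis -` U \<noteq> {}" using assms(3) by (metis empty_iff vimage_eq)
  ultimately obtain u where "u \<in> cis -` U" "P (cis (0 + 1 * u))"
    using AE_lborel_dense by blast
  then show ?thesis by (intro bexI[of _ "cis u"]) auto
qed

section \<open>Arc coordinates at a point of the circle\<close>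

text \<open>For \<open>z \<noteq> w\<close> on the circle this is the \<open>t \<in> (0, 2\<pi>)\<close> with \<open>z = w * cis (k * t)\<close>.\<close>

definition arc_coord :: "complex \<Rightarrow> real \<Rightarrow> complex \<Rightarrow> real" where
  "arc_coord w k z = (if k = 1 then Arg2pi (z / w) else 2 * pi - Arg2pi (z / w))"

lemma circle_eq_cis: "w \<in> circle \<Longrightarrow> \<exists>t. w = cis t"
  by (metis cis_Arg norm_zero sgn_div_norm zero_neq_one mem_sphere_0 div_by_1 inverse_1 scaleR_one)

lemma Arg2pi_cis: "0 \<le> t \<Longrightarrow> t < 2 * pi \<Longrightarrow> Arg2pi (cis t) = t"
  by (rule Arg2pi_unique[of 1]) (auto simp: cis_conv_exp)

lemma arc_coord_cis:
  assumes "k \<in> {-1,1}" "0 < u" "u < 2 * pi"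
  shows "arc_coord (cis t0) k (cis (t0 + k * u)) = u"
proof (cases "k = 1")
  case True
  then show ?thesis using assms by (simp add: arc_coord_def cis_divide Arg2pi_cis)
next
  case False
  then have "k = -1" using assms by simp
  moreover have "cis (- u) = cis (2 * pi - u)" by (simp add: cis_divide[symmetric] flip: cis_inverse) (simp add: field_simps)
  ultimately show ?thesis using assms by (simp add: arc_coord_def cis_divide Arg2pi_cis)
qed

lemma arc_coord_bounds: "0 \<le> arc_coord w k z" "arc_coord w k z \<le> 2 * pi"
  using Arg2pi_ge_0[of "z / w"] Arg2pi_lt_2pi[of "z / w"] by (auto simp: arc_coord_def)

lemma Arg2pi_divide_pos:
  assumes "w \<in> circle" "z \<in> circle" "z \<noteq> w"
  shows "0 < Arg2pi (z / w)" "z / w \<notin> \<real>\<^sub>\<ge>\<^sub>0"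
proof -
  have "z / w \<notin> \<real>\<^sub>\<ge>\<^sub>0"
  proof
    assume "z / w \<in> \<real>\<^sub>\<ge>\<^sub>0"
    then obtain r where r: "z / w = of_real r" "r \<ge> 0" by (auto elim: nonneg_Reals_cases)
    moreover have "cmod (z / w) = 1" using assms by (simp add: norm_divide)
    ultimately have "z / w = 1" by simp
    then show False using assms by (auto simp: divide_eq_1_iff)
  qed
  then show "z / w \<notin> \<real>\<^sub>\<ge>\<^sub>0" .
  then have "Arg2pi (z / w) \<noteq> 0"
    by (auto simp: Arg2pi_eq_0 complex_nonneg_Reals_iff complex_is_Real_iff)
  then show "0 < Arg2pi (z / w)" using Arg2pi_ge_0[of "z / w"] by linarith
qed

lemma arc_coord_strict_bounds:
  assumes "w \<in> circle" "z \<in> circle" "z \<noteq> w"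
  shows "0 < arc_coord w k z" "arc_coord w k z < 2 * pi"
  using Arg2pi_divide_pos[OF assms] Arg2pi_lt_2pi[of "z / w"] by (auto simp: arc_coord_def)

lemma cis_arc_coord:
  assumes "w \<in> circle" "z \<in> circle" "k \<in> {-1,1}"
  shows "z = w * cis (k * arc_coord w k z)"
proof -
  have nz: "w \<noteq> 0" "z \<noteq> 0" using assms by auto
  have "cmod (z / w) = 1" using assms by (simp add: norm_divide)
  then have "cis (Arg2pi (z / w)) = z / w"
    using Arg2pi_eq[of "z / w"] by (simp add: cis_conv_exp)
  moreover have "cis (Arg2pi (z / w) - 2 * pi) = cis (Arg2pi (z / w))"
    by (simp add: cis_divide[symmetric])
  ultimately show ?thesis using assms(3) nz by (auto simp: arc_coord_def)
qed

lemma continuous_on_arc_coord: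
  assumes "w \<in> circle"
  shows "continuous_on (circle - {w}) (arc_coord w k)"
proof -
  have "continuous_on (circle - {w}) (\<lambda>z. Arg2pi (z / w))"
  proof (rule continuous_on_compose2[where g=Arg2pi and t="- \<real>\<^sub>\<ge>\<^sub>0"])
    show "continuous_on (- \<real>\<^sub>\<ge>\<^sub>0) Arg2pi"
      by (intro continuous_at_imp_continuous_on) (auto intro: continuous_at_Arg2pi)
    show "continuous_on (circle - {w}) (\<lambda>z. z / w)"
      using assms by (intro continuous_intros) auto
    show "(\<lambda>z. z / w) ` (circle - {w}) \<subseteq> - \<real>\<^sub>\<ge>\<^sub>0"
      using Arg2pi_divide_pos(2)[OF assms] by blast
  qed
  then show ?thesis
    unfolding arc_coord_def by (cases "k = 1") (auto intro!: continuous_intros)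
qed

text \<open>\<open>Arg2pi\<close> is continuous off the nonnegative real ray and vanishes on it, so
  it equals its product with the indicator of the complement of the ray.\<close>

lemma arc_coord_measurable [measurable]: "arc_coord w k \<in> borel_measurable borel"
proof -
  have "(\<lambda>z. indicator (- \<real>\<^sub>\<ge>\<^sub>0) z *\<^sub>R Arg2pi z) \<in> borel_measurable borel"
    by (intro borel_measurable_continuous_on_indicator continuous_at_imp_continuous_on)
       (auto intro: continuous_at_Arg2pi)
  moreover have "(\<lambda>z. indicator (- \<real>\<^sub>\<ge>\<^sub>0) z *\<^sub>R Arg2pi z) = Arg2pi"
    by (auto simp: fun_eq_iff indicator_def Arg2pi_eq_0 complex_nonneg_Reals_iff complex_is_Real_iff)
  ultimately have [measurable]: "Arg2pi \<in> borel_measurable borel" by simp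
  have "(\<lambda>z. z / w) \<in> borel_measurable borel" by measurable
  then show ?thesis unfolding arc_coord_def by measurable
qed

text \<open>Counterpart of the \<open>exp\<close> in \<open>almost_periodic_on_arc\<close>: small
  arcs at \<open>w\<close> correspond to half-lines reaching to minus infinity. The lift lives on
  the whole punctured circle and not only on a short arc.\<close>

definition arc_lift :: "complex \<Rightarrow> real \<Rightarrow> (real \<Rightarrow> complex) \<Rightarrow> complex \<Rightarrow> complex" where
  "arc_lift w k g z = g (ln (arc_coord w k z))"

lemma arc_lift_cis:
  "k \<in> {-1,1} \<Longrightarrow> 0 < u \<Longrightarrow> u < 2 * pi \<Longrightarrow> arc_lift (cis t0) k g (cis (t0 + k * u)) = g (ln u)"
  by (simp add: arc_lift_def arc_coord_cis)

lemma continuous_on_arc_lift: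
  assumes "w \<in> circle" "continuous_on UNIV g"
  shows "continuous_on (circle - {w}) (arc_lift w k g)"
  unfolding arc_lift_def
proof (rule continuous_on_compose2[OF assms(2)])
  show "continuous_on (circle - {w}) (\<lambda>z. ln (arc_coord w k z))"
    using arc_coord_strict_bounds(1)[OF assms(1), of _ k]
    by (intro continuous_intros continuous_on_arc_coord assms) (metis Diff_iff insertCI less_irrefl)
qed auto

lemma arc_lift_measurable:
  assumes "continuous_on UNIV g"
  shows "arc_lift w k g \<in> borel_measurable borel"
proof -
  have [measurable]: "g \<in> borel_measurable borel"
    using assms by (rule borel_measurable_continuous_onI)
  show ?thesis unfolding arc_lift_def by measurable
qed

lemma arc_in_punctured_circle:
  assumes "k \<in> {-1,1}" "s \<le> 2 * pi"
  shows "circle_arc t0 k s \<subseteq> circle - {cis t0}"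
proof
  fix z assume "z \<in> circle_arc t0 k s"
  then obtain u where u: "z = cis (t0 + k * u)" "0 < u" "u < s" by (auto simp: circle_arc_def)
  have "z \<noteq> cis t0"
  proof
    assume "z = cis t0"
    \<comment> \<open>At its own base point the coordinate takes an end value, 0 or 2 pi, and never
      an interior value such as \<open>u\<close>.\<close>
    then have "arc_coord (cis t0) 1 z = 0 \<and> arc_coord (cis t0) (-1) z = 2 * pi"
      by (simp add: arc_coord_def Arg2pi_of_real[of 1, simplified])
    moreover have "arc_coord (cis t0) k z = u" using arc_coord_cis[OF assms(1), of u t0] u assms by simp
    ultimately show False using assms u by auto
  qed
  then show "z \<in> circle - {cis t0}" using u by auto
qed

section \<open>Almost periodic germs\<close>

text \<open>The definition of AP uses the parameter \<open>s * exp t\<close> and one approximation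
  for each \<epsilon>. Here the length \<open>s\<close> is absorbed by a translation of
  \<open>g\<close> by \<open>ln s\<close>, and all approximations are merged into one limit, so that
  each side of a point has a single germ.\<close>

definition ap_germ :: "real \<Rightarrow> real \<Rightarrow> (complex \<Rightarrow> complex) \<Rightarrow> (real \<Rightarrow> complex) \<Rightarrow> bool" where
  "ap_germ t0 k f g \<longleftrightarrow> almost_periodic g \<and> ((\<lambda>u. f (cis (t0 + k * u)) - g (ln u)) \<longlongrightarrow> 0) essR"

lemma ap_germ_AE_cong:
  assumes "ap_germ t0 k f g" "AE z in arc_length. f z = f' z" "k \<in> {-1,1}"
  shows "ap_germ t0 k f' g"
proof -
  have "eventually (\<lambda>u. f (cis (t0 + k * u)) = f' (cis (t0 + k * u))) essR"
    by (rule AE_imp_essR[OF assms(2,3)])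
  then have "eventually (\<lambda>u. f (cis (t0 + k * u)) - g (ln u) = f' (cis (t0 + k * u)) - g (ln u)) essR"
    by eventually_elim simp
  from tendsto_cong[OF this] show ?thesis using assms(1) by (simp add: ap_germ_def)
qed

text \<open>The difference of two germs tends to 0 along \<open>essR\<close>, and rigidity makes it
  vanish identically.\<close>

lemma ap_germ_unique:
  assumes "ap_germ t0 k f g" "ap_germ t0 k f g'"
  shows "g = g'"
proof
  fix t
  have "((\<lambda>u. (f (cis (t0 + k * u)) - g' (ln u)) - (f (cis (t0 + k * u)) - g (ln u))) \<longlongrightarrow> 0 - 0) essR"
    using assms by (intro tendsto_diff) (auto simp: ap_germ_def)
  then have "((\<lambda>u. (\<lambda>t. g t - g' t) (ln u)) \<longlongrightarrow> 0) essR" by simp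
  from almost_periodic_ln_tendsto_unique[OF _ this, of t] show "g t = g' t"
    using assms by (auto simp: ap_germ_def almost_periodic_diff)
qed

lemma ap_germ_tendsto:
  assumes "((\<lambda>u. f (cis (t0 + k * u))) \<longlongrightarrow> L) (at_right 0)"
  shows "ap_germ t0 k f (\<lambda>_. L)"
proof -
  have "((\<lambda>u. f (cis (t0 + k * u))) \<longlongrightarrow> L) essR"
    using assms essR_le by (rule tendsto_mono[rotated])
  then have "((\<lambda>u. f (cis (t0 + k * u)) - L) \<longlongrightarrow> L - L) essR"
    by (intro tendsto_intros)
  then show ?thesis by (simp add: ap_germ_def almost_periodic_const)
qed

lemma ap_germ_const: "ap_germ t0 k (\<lambda>_. c) (\<lambda>_. c)"
  by (rule ap_germ_tendsto) simp

lemma ap_germ_add: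
  assumes "ap_germ t0 k f1 g1" "ap_germ t0 k f2 g2"
  shows "ap_germ t0 k (\<lambda>z. f1 z + f2 z) (\<lambda>t. g1 t + g2 t)"
proof -
  have "((\<lambda>u. (f1 (cis (t0 + k * u)) - g1 (ln u)) + (f2 (cis (t0 + k * u)) - g2 (ln u))) \<longlongrightarrow> 0 + 0) essR"
    using assms by (intro tendsto_add) (auto simp: ap_germ_def)
  then show ?thesis using assms by (simp add: ap_germ_def almost_periodic_add algebra_simps)
qed

text \<open>\<open>h\<close> is left arbitrary because it will be \<open>ln u\<close> on one side of
  a base point and \<open>ln (2 * pi - u)\<close> on the other.\<close>

lemma tendsto_mult_ap_0:
  assumes "(d \<longlongrightarrow> 0) F" "almost_periodic g"
  shows "((\<lambda>u. d u * g (h u)) \<longlongrightarrow> 0) F"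
proof -
  obtain B where B: "B > 0" "\<And>t. cmod (g t) \<le> B" using almost_periodic_bounded[OF assms(2)] by blast
  have "((\<lambda>u. cmod (d u) * B) \<longlongrightarrow> 0 * B) F"
    using tendsto_norm_zero[OF assms(1)] by (intro tendsto_intros)
  then have "((\<lambda>u. cmod (d u) * B) \<longlongrightarrow> 0) F" by simp
  then show ?thesis
    by (rule Lim_null_comparison[rotated]) (auto simp: norm_mult intro!: always_eventually mult_left_mono B)
qed

lemma ap_germ_mult:
  assumes "ap_germ t0 k f1 g1" "ap_germ t0 k f2 g2"
  shows "ap_germ t0 k (\<lambda>z. f1 z * f2 z) (\<lambda>t. g1 t * g2 t)"
proof -
  define d1 where "d1 u = f1 (cis (t0 + k * u)) - g1 (ln u)" for u
  define d2 where "d2 u = f2 (cis (t0 + k * u)) - g2 (ln u)" for u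
  have d: "(d1 \<longlongrightarrow> 0) essR" "(d2 \<longlongrightarrow> 0) essR"
    using assms by (simp_all add: ap_germ_def d1_def[abs_def] d2_def[abs_def])
  have ap: "almost_periodic g1" "almost_periodic g2" using assms by (auto simp: ap_germ_def)
  have "((\<lambda>u. d1 u * d2 u + d1 u * g2 (ln u) + d2 u * g1 (ln u)) \<longlongrightarrow> 0 * 0 + 0 + 0) essR"
    by (intro tendsto_add tendsto_mult tendsto_mult_ap_0 d ap)
  then show ?thesis using ap by (simp add: ap_germ_def almost_periodic_mult d1_def d2_def algebra_simps)
qed

lemma ap_germ_cnj:
  assumes "ap_germ t0 k f g"
  shows "ap_germ t0 k (\<lambda>z. cnj (f z)) (\<lambda>t. cnj (g t))"
proof -
  have "((\<lambda>u. cnj (f (cis (t0 + k * u)) - g (ln u))) \<longlongrightarrow> cnj 0) essR"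
    using assms by (intro tendsto_cnj) (auto simp: ap_germ_def)
  then show ?thesis using assms by (simp add: ap_germ_def almost_periodic_cnj)
qed

text \<open>Near the base point the error is below \<open>c/2\<close>, so the germ is at least
  \<open>c/2\<close> in modulus there. Rigidity, applied to the complement of an open ball, extends
  this bound to the whole line, and the inverse of the germ is again almost periodic.\<close>

lemma ap_germ_inverse:
  assumes fg: "ap_germ t0 k f g" and c: "c > 0" "AE z in arc_length. cmod (f z) \<ge> c" and k: "k \<in> {-1,1}"
  shows "ap_germ t0 k (\<lambda>z. inverse (f z)) (\<lambda>t. inverse (g t))"
proof -
  define d where "d u = f (cis (t0 + k * u)) - g (ln u)" for u
  have d: "(d \<longlongrightarrow> 0) essR" using fg by (simp add: ap_germ_def d_def[abs_def])
  have ap: "almost_periodic g" using fg by (simp add: ap_germ_def)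
  have ev: "eventually (\<lambda>u. cmod (f (cis (t0 + k * u))) \<ge> c) essR"
    by (rule AE_imp_essR[OF c(2) k])
  have "eventually (\<lambda>u. cmod (d u) < c/2) essR"
    using tendstoD[OF d, of "c/2"] c(1) by simp
  with ev have "eventually (\<lambda>u. g (ln u) \<in> - ball 0 (c/2)) essR"
  proof eventually_elim
    case (elim u)
    then show ?case
      using norm_triangle_ineq[of "d u" "g (ln u)"] by (simp add: d_def)
  qed
  then have "g t \<in> - ball 0 (c/2)" for t
    by (rule almost_periodic_ln_closed[OF ap, rotated]) auto
  then have gb: "cmod (g t) \<ge> c/2" for t by (auto simp: not_less)
  then have gnz: "g t \<noteq> 0" for t using c(1) by (metis half_gt_zero norm_zero not_less)
  have api: "almost_periodic (\<lambda>t. inverse (g t))"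
    using almost_periodic_inverse[OF ap, of "c/2"] c(1) gb by simp
  have "((\<lambda>u. cmod (d u) * (2 / (c * c))) \<longlongrightarrow> 0 * (2 / (c * c))) essR"
    using tendsto_norm_zero[OF d] by (intro tendsto_mult tendsto_const)
  then have "((\<lambda>u. cmod (d u) * (2 / (c * c))) \<longlongrightarrow> 0) essR" by simp
  then have "((\<lambda>u. inverse (f (cis (t0 + k * u))) - inverse (g (ln u))) \<longlongrightarrow> 0) essR"
  proof (rule Lim_null_comparison[rotated])
    show "\<forall>\<^sub>F u in essR. cmod (inverse (f (cis (t0 + k * u))) - inverse (g (ln u))) \<le> cmod (d u) * (2 / (c * c))"
      using ev
    proof eventually_elim
      case (elim u)
      let ?a = "f (cis (t0 + k * u))" and ?b = "g (ln u)"
      have nz: "?a \<noteq> 0" using elim c(1) by auto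
      have "inverse ?a - inverse ?b = (?b - ?a) / (?a * ?b)"
        using nz gnz[of "ln u"] by (simp add: field_simps)
      then have "cmod (inverse ?a - inverse ?b) = cmod (d u) / (cmod ?a * cmod ?b)"
        by (simp add: norm_divide norm_mult norm_minus_commute d_def)
      also have "\<dots> \<le> cmod (d u) / (c * (c / 2))"
        using elim gb[of "ln u"] c(1) nz gnz[of "ln u"] by (intro divide_left_mono mult_mono mult_pos_pos) auto
      finally show ?case by simp
    qed
  qed
  then show ?thesis using api by (simp add: ap_germ_def)
qed

text \<open>The germ is the uniform limit of the almost periodic functions that approximate \<open>f\<close> up to \<open>1/n\<close>
  near the base point: two of these differ by at most \<open>1/m + 1/n\<close> near \<open>-\<infinity>\<close>, hence on all of \<open>\<real>\<close>.\<close>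

lemma ap_germ_exists:
  assumes "\<And>\<epsilon>. \<epsilon> > 0 \<Longrightarrow> \<exists>g. almost_periodic g \<and> eventually (\<lambda>u. cmod (f (cis (t0 + k * u)) - g (ln u)) \<le> \<epsilon>) essR"
  shows "\<exists>g. ap_germ t0 k f g"
proof -
  have "\<exists>g. almost_periodic g \<and> eventually (\<lambda>u. cmod (f (cis (t0 + k * u)) - g (ln u)) \<le> inverse (real (Suc n))) essR" for n
    by (rule assms) simp
  then obtain g where g: "\<And>n. almost_periodic (g n)"
    "\<And>n. eventually (\<lambda>u. cmod (f (cis (t0 + k * u)) - g n (ln u)) \<le> inverse (real (Suc n))) essR"
    by metis
  have close: "cmod (g m t - g n t) \<le> inverse (real (Suc m)) + inverse (real (Suc n))" for m n t
  proof -
    have "eventually (\<lambda>u. g m (ln u) - g n (ln u) \<in> cball 0 (inverse (real (Suc m)) + inverse (real (Suc n)))) essR"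
      using g(2)[of m] g(2)[of n]
    proof eventually_elim
      case (elim u)
      have "g m (ln u) - g n (ln u) = (f (cis (t0 + k * u)) - g n (ln u)) - (f (cis (t0 + k * u)) - g m (ln u))"
        by simp
      then show ?case
        using norm_triangle_ineq4[of "f (cis (t0 + k * u)) - g n (ln u)" "f (cis (t0 + k * u)) - g m (ln u)"] elim
        by simp
    qed
    from almost_periodic_ln_closed[OF almost_periodic_diff[OF g(1) g(1)] _ this, of t]
    show ?thesis by simp
  qed
  have "uniformly_Cauchy_on UNIV g"
  proof (rule uniformly_Cauchy_onI)
    fix e :: real assume "e > 0"
    then obtain N where N: "inverse (real (Suc N)) < e/2" using reals_Archimedean[of "e/2"] by auto
    have "dist (g m t) (g n t) < e" if "m \<ge> N" "n \<ge> N" for m n t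
    proof -
      have "inverse (real (Suc m)) \<le> inverse (real (Suc N))" "inverse (real (Suc n)) \<le> inverse (real (Suc N))"
        using that by (auto intro!: le_imp_inverse_le)
      then show ?thesis using close[of m t n] N unfolding dist_norm by linarith
    qed
    then show "\<exists>M. \<forall>x\<in>UNIV. \<forall>m\<ge>M. \<forall>n\<ge>M. dist (g m x) (g n x) < e" by blast
  qed
  then obtain l where l: "uniform_limit UNIV g l sequentially"
    using Cauchy_uniformly_convergent by (auto simp: uniformly_convergent_on_def)
  have ap: "almost_periodic l" by (rule almost_periodic_uniform_limit[OF g(1) l])
  have "((\<lambda>u. f (cis (t0 + k * u)) - l (ln u)) \<longlongrightarrow> 0) essR"
  proof (rule tendstoI)
    fix e :: real assume e: "e > 0"
    obtain N where N: "inverse (real (Suc N)) < e/2" using reals_Archimedean[of "e/2"] e by auto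
    have "\<forall>\<^sub>F n in sequentially. \<forall>t\<in>UNIV. dist (g n t) (l t) < e/2"
      using uniform_limitD[OF l, of "e/2"] e by simp
    then obtain M where M: "\<And>n t. n \<ge> M \<Longrightarrow> dist (g n t) (l t) < e/2"
      by (auto simp: eventually_sequentially)
    define n where "n = max M N"
    have "inverse (real (Suc n)) \<le> inverse (real (Suc N))"
      by (rule le_imp_inverse_le) (auto simp: n_def)
    with N have n: "inverse (real (Suc n)) < e/2" by linarith
    show "\<forall>\<^sub>F u in essR. dist (f (cis (t0 + k * u)) - l (ln u)) 0 < e"
      using g(2)[of n]
    proof eventually_elim
      case (elim u)
      have "dist (g n (ln u)) (l (ln u)) < e/2" by (rule M) (simp add: n_def)
      then show ?case
        using norm_triangle_ineq[of "f (cis (t0 + k * u)) - g n (ln u)" "g n (ln u) - l (ln u)"] elim n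
        by (simp add: dist_norm)
    qed
  qed
  with ap show ?thesis by (auto simp: ap_germ_def)
qed

text \<open>A model of AP(S) by functions instead of classes, in which one representative carries
  both the continuity and the germs; \<open>AP_alg_eq\<close> shows that it describes the same
  algebra.\<close>

definition ap_fun :: "complex set \<Rightarrow> (complex \<Rightarrow> complex) set" where
  "ap_fun S = {f \<in> ess_bounded. continuous_on (circle - S) f \<and>
     (\<forall>t0. \<forall>k\<in>{-1, 1}. \<exists>g. ap_germ t0 k f g)}"

text \<open>A bound on the essential supremum over an arc is a bound along \<open>essR\<close>. With
  \<open>u = s * exp t\<close> the almost periodic function of \<open>t\<close> becomes its
  translate by \<open>- ln s\<close>, evaluated at \<open>ln u\<close>.\<close>

lemma ap_germ_if_AP_circle:
  assumes f: "f \<in> ess_bounded" and k: "k \<in> {-1,1}"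
    and approx: "\<forall>\<epsilon>>0. \<exists>s\<in>{0<..<pi}. \<exists>h :: real \<Rightarrow> complex \<Rightarrow> complex. \<forall>k\<in>{-1, 1}.
        almost_periodic_on_arc t0 k s (h k) \<and>
        esssup (restrict_space arc_length (circle_arc t0 k s)) (\<lambda>z. ereal (cmod (f z - h k z))) < ereal \<epsilon>"
  shows "\<exists>g. ap_germ t0 k f g"
proof (rule ap_germ_exists)
  fix \<epsilon> :: real assume "\<epsilon> > 0"
  then obtain s h where s: "s \<in> {0<..<pi}" and h: "almost_periodic_on_arc t0 k s (h k)"
    "esssup (restrict_space arc_length (circle_arc t0 k s)) (\<lambda>z. ereal (cmod (f z - h k z))) < ereal \<epsilon>"
    using approx k by meson
  obtain g where g: "almost_periodic g" "\<And>t. t < 0 \<Longrightarrow> h k (cis (t0 + k * s * exp t)) = g t"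
    using h(1) by (auto simp: almost_periodic_on_arc_def)
  have "AE z in restrict_space arc_length (circle_arc t0 k s). ereal (cmod (f z - h k z)) \<le> ereal \<epsilon>"
    using esssup_AE[of "\<lambda>z. ereal (cmod (f z - h k z))" "restrict_space arc_length (circle_arc t0 k s)"]
    by eventually_elim (use h(2) in order)
  then have "AE z in arc_length. z \<in> circle_arc t0 k s \<longrightarrow> cmod (f z - h k z) \<le> \<epsilon>"
    by (subst (asm) AE_restrict_space_iff) (auto intro!: sets.Int circle_arc_arc_length sets.top simp flip: space_arc_length)
  then have "\<forall>\<^sub>F u in essR. cmod (f (cis (t0 + k * u)) - h k (cis (t0 + k * u))) \<le> \<epsilon>"
    by (rule AE_circle_arc_imp_essR) (use k s in auto)
  moreover have "\<forall>\<^sub>F u in essR. 0 < u \<and> u < s"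
    unfolding eventually_essR using s by (intro exI[of _ s]) auto
  ultimately have "\<forall>\<^sub>F u in essR. cmod (f (cis (t0 + k * u)) - g (ln u + - ln s)) \<le> \<epsilon>"
  proof eventually_elim
    case (elim u)
    have "ln u + - ln s < 0" "s * exp (ln u + - ln s) = u"
      using elim s by (auto simp: exp_diff)
    then show ?case using g(2)[of "ln u + - ln s"] elim by (simp add: mult.assoc)
  qed
  then show "\<exists>g. almost_periodic g \<and> (\<forall>\<^sub>F u in essR. cmod (f (cis (t0 + k * u)) - g (ln u)) \<le> \<epsilon>)"
    using almost_periodic_shift[OF g(1), of "- ln s"] by (intro exI[of _ "\<lambda>t. g (t + - ln s)"]) auto
qed

text \<open>The lift of the germ itself serves as the approximating function on a short arc; on an
  arc of length \<open>r\<close> its profile is the translate of the germ by \<open>ln r\<close>,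
  again almost periodic.\<close>

lemma AP_circle_if_ap_germ:
  assumes f: "f \<in> ess_bounded" and germ: "\<And>k. k \<in> {-1,1} \<Longrightarrow> \<exists>g. ap_germ t0 k f g" and e: "\<epsilon> > 0"
  shows "\<exists>s\<in>{0<..<pi}. \<exists>h :: real \<Rightarrow> complex \<Rightarrow> complex. \<forall>k\<in>{-1, 1}.
        almost_periodic_on_arc t0 k s (h k) \<and>
        esssup (restrict_space arc_length (circle_arc t0 k s)) (\<lambda>z. ereal (cmod (f z - h k z))) < ereal \<epsilon>"
proof -
  obtain g where g: "\<And>k. k \<in> {-1,1} \<Longrightarrow> ap_germ t0 k f (g k)" using germ by metis
  have apg: "k \<in> {-1,1} \<Longrightarrow> almost_periodic (g k)" for k using g by (auto simp: ap_germ_def)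
  define h where "h k = arc_lift (cis t0) k (g k)" for k
  have meas: "k \<in> {-1,1} \<Longrightarrow> h k \<in> borel_measurable borel" for k
    unfolding h_def using apg by (intro arc_lift_measurable almost_periodic_continuous)
  have fm: "f \<in> borel_measurable arc_length" using f by (simp add: ess_bounded_def)
  have dm: "k \<in> {-1,1} \<Longrightarrow> (\<lambda>z. cmod (f z - h k z)) \<in> borel_measurable arc_length" for k
    using fm borel_measurable_arc_length[OF meas] by measurable
  \<comment> \<open>An AE bound yields only a weak inequality for the essential supremum; halving
    \<epsilon> makes it strict in the end.\<close>
  have "\<exists>s>0. AE z in arc_length. z \<in> circle_arc t0 k s \<longrightarrow> cmod (f z - h k z) \<le> \<epsilon>/2" if k: "k \<in> {-1,1}" for k
  proof (rule essR_imp_AE_circle_arc[OF _ k])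
    have "\<forall>\<^sub>F u in essR. dist (f (cis (t0 + k * u)) - g k (ln u)) 0 < \<epsilon>/2"
      using g[OF k] e by (intro tendstoD) (auto simp: ap_germ_def)
    moreover have "\<forall>\<^sub>F u in essR. 0 < u \<and> u < 2 * pi"
      unfolding eventually_essR by (intro exI[of _ "2 * pi"]) auto
    ultimately show "\<forall>\<^sub>F u in essR. cmod (f (cis (t0 + k * u)) - h k (cis (t0 + k * u))) \<le> \<epsilon>/2"
      by eventually_elim (use k in \<open>simp add: h_def arc_lift_cis\<close>)
    fix s
    have "{z \<in> space arc_length. cmod (f z - h k z) \<le> \<epsilon>/2} \<in> sets arc_length"
      using dm[OF k] by measurable
    then have "{z \<in> circle. cmod (f z - h k z) \<le> \<epsilon>/2} \<in> sets borel"
      unfolding arc_length_sets_iff by simp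
    moreover have "{z \<in> circle_arc t0 k s. cmod (f z - h k z) \<le> \<epsilon>/2} = {z \<in> circle. cmod (f z - h k z) \<le> \<epsilon>/2} \<inter> circle_arc t0 k s"
      by (auto simp: circle_arc_def)
    ultimately show "{z \<in> circle_arc t0 k s. cmod (f z - h k z) \<le> \<epsilon>/2} \<in> sets borel"
      by (simp only: circle_arc_sets sets.Int)
  qed
  then have "\<forall>k\<in>{-1,1}. \<exists>s>0. AE z in arc_length. z \<in> circle_arc t0 k s \<longrightarrow> cmod (f z - h k z) \<le> \<epsilon>/2"
    by blast
  from bchoice[OF this] obtain s where s: "\<And>k. k \<in> {-1,1} \<Longrightarrow> s k > 0"
    "\<And>k. k \<in> {-1,1} \<Longrightarrow> AE z in arc_length. z \<in> circle_arc t0 k (s k) \<longrightarrow> cmod (f z - h k z) \<le> \<epsilon>/2"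
    by blast
  \<comment> \<open>Both sides must share one arc length below pi; the 1 guarantees the
    latter.\<close>
  define r where "r = min (min (s 1) (s (-1))) 1"
  have r: "0 < r" "r < pi" "\<And>k. k \<in> {-1,1} \<Longrightarrow> r \<le> s k"
    using s(1)[of 1] s(1)[of "-1"] pi_gt3 unfolding r_def by auto
  have "almost_periodic_on_arc t0 k r (h k)" if k: "k \<in> {-1,1}" for k
    unfolding almost_periodic_on_arc_def
  proof
    show "continuous_on (circle_arc t0 k r) (h k)"
      unfolding h_def
      by (rule continuous_on_subset[OF continuous_on_arc_lift[OF _ almost_periodic_continuous[OF apg[OF k]]]
            arc_in_punctured_circle[OF k]])
         (use r in auto)
    have "h k (cis (t0 + k * r * exp t)) = g k (t + ln r)" if "t < 0" for t
    proof -
      have "r * exp t < r * 1" using that r by (intro mult_strict_left_mono) auto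
      then have "r * exp t < 2 * pi" using r by linarith
      then have "h k (cis (t0 + k * (r * exp t))) = g k (ln (r * exp t))"
        unfolding h_def using r k by (intro arc_lift_cis) auto
      then show ?thesis using r by (simp add: ln_mult mult.assoc add.commute)
    qed
    then show "\<exists>ga. almost_periodic ga \<and> (\<forall>t<0. h k (cis (t0 + k * r * exp t)) = ga t)"
      using almost_periodic_shift[OF apg[OF k], of "ln r"] by blast
  qed
  moreover have "esssup (restrict_space arc_length (circle_arc t0 k r)) (\<lambda>z. ereal (cmod (f z - h k z))) < ereal \<epsilon>"
    if k: "k \<in> {-1,1}" for k
  proof -
    have sub: "circle_arc t0 k r \<subseteq> circle_arc t0 k (s k)" using r(3)[OF k] by (fastforce simp: circle_arc_def)
    have "esssup (restrict_space arc_length (circle_arc t0 k r)) (\<lambda>z. ereal (cmod (f z - h k z))) \<le> ereal (\<epsilon>/2)"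
    proof (rule esssup_I)
      show "(\<lambda>z. ereal (cmod (f z - h k z))) \<in> borel_measurable (restrict_space arc_length (circle_arc t0 k r))"
        by (intro measurable_restrict_space1 borel_measurable_ereal dm k)
      have "AE z in arc_length. z \<in> circle_arc t0 k r \<longrightarrow> ereal (cmod (f z - h k z)) \<le> ereal (\<epsilon>/2)"
        using s(2)[OF k] by eventually_elim (use sub in auto)
      then show "AE z in restrict_space arc_length (circle_arc t0 k r). ereal (cmod (f z - h k z)) \<le> ereal (\<epsilon>/2)"
        by (subst AE_restrict_space_iff) (auto intro!: sets.Int circle_arc_arc_length sets.top simp flip: space_arc_length)
    qed
    also have "\<dots> < ereal \<epsilon>" using e by simp
    finally show ?thesis .
  qed
  ultimately show ?thesis using r(1,2) by (intro bexI[of _ r] exI[of _ h]) auto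
qed

text \<open>The definition of \<open>AP_alg\<close> allows different representatives for almost
  periodicity and for continuity off \<open>S\<close>. They agree almost everywhere and germs do not
  see null sets, so the continuous one has the germs as well.\<close>

lemma AP_alg_eq: "AP_alg S = ae_class ` ap_fun S"
proof (intro set_eqI iffI)
  fix F assume "F \<in> AP_alg S"
  then obtain f1 f2 where f1: "F = ae_class f1" "f1 \<in> ess_bounded" "\<forall>t0. \<forall>\<epsilon>>0. \<exists>s\<in>{0<..<pi}. \<exists>h :: real \<Rightarrow> complex \<Rightarrow> complex. \<forall>k\<in>{-1, 1}.
        almost_periodic_on_arc t0 k s (h k) \<and>
        esssup (restrict_space arc_length (circle_arc t0 k s)) (\<lambda>z. ereal (cmod (f1 z - h k z))) < ereal \<epsilon>"
    and f2: "F = ae_class f2" "f2 \<in> ess_bounded" "continuous_on (circle - S) f2"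
    unfolding AP_alg_def AP_circle_def by blast
  have ae: "AE z in arc_length. f1 z = f2 z" using f1 f2 by (metis ae_class_eq_iff)
  have "\<exists>g. ap_germ t0 k f2 g" if k: "k \<in> {-1,1}" for t0 k
    using ap_germ_if_AP_circle[OF f1(2) k spec[OF f1(3)]] ap_germ_AE_cong[OF _ ae k] by blast
  then show "F \<in> ae_class ` ap_fun S" using f2 by (auto simp: ap_fun_def)
next
  fix F assume "F \<in> ae_class ` ap_fun S"
  then obtain f where f: "F = ae_class f" "f \<in> ap_fun S" by blast
  then have f': "f \<in> ess_bounded" "\<And>t0 k. k \<in> {-1,1} \<Longrightarrow> \<exists>g. ap_germ t0 k f g" by (auto simp: ap_fun_def)
  have "F \<in> AP_circle"
    unfolding AP_circle_def mem_Collect_eq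
    using f(1) f' AP_circle_if_ap_germ[OF f'] by blast
  with f show "F \<in> AP_alg S" by (auto simp: AP_alg_def ap_fun_def)
qed

section \<open>Maximal ideal spaces\<close>

lemma topspace_max_ideal_space [simp]: "topspace (max_ideal_space A) = characters A"
  by (auto simp: max_ideal_space_def characters_def PiE_def)

lemma continuous_map_max_ideal_space_eval:
  "F \<in> A \<Longrightarrow> continuous_map (max_ideal_space A) euclidean (\<lambda>\<phi>. \<phi> F)"
  unfolding max_ideal_space_def
  by (intro continuous_map_from_subtopology continuous_map_product_projection)

lemma continuous_map_into_max_ideal_space:
  assumes "\<And>x. x \<in> topspace X \<Longrightarrow> h x \<in> characters A"
    and "\<And>F. F \<in> A \<Longrightarrow> continuous_map X euclidean (\<lambda>x. h x F)"
  shows "continuous_map X (max_ideal_space A) h"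
  unfolding max_ideal_space_def continuous_map_in_subtopology continuous_map_componentwise
  using assms by (auto simp: characters_def)

lemma Hausdorff_max_ideal_space: "Hausdorff_space (max_ideal_space A)"
  unfolding max_ideal_space_def
  by (intro Hausdorff_space_subtopology) (auto simp: Hausdorff_space_product_topology)

lemma character_extensional: "\<phi> \<in> characters A \<Longrightarrow> \<phi> \<in> extensional A"
  by (simp add: characters_def)

lemma character_one:
  assumes "\<phi> \<in> characters A" "1 \<in> A"
  shows "\<phi> 1 = 1"
proof -
  obtain x where "x \<in> A" "\<phi> x \<noteq> 0" using assms by (auto simp: characters_def)
  moreover have "\<phi> (1 * x) = \<phi> 1 * \<phi> x"
    using assms \<open>x \<in> A\<close> unfolding characters_def by blast
  ultimately show ?thesis by simp
qed

lemma restrict_character: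
  assumes "\<phi> \<in> characters A" "B \<subseteq> A" "1 \<in> B"
    and "\<And>x y. x \<in> B \<Longrightarrow> y \<in> B \<Longrightarrow> x + y \<in> B" "\<And>x y. x \<in> B \<Longrightarrow> y \<in> B \<Longrightarrow> x * y \<in> B"
    "\<And>c x. x \<in> B \<Longrightarrow> scaleC c x \<in> B"
  shows "restrict \<phi> B \<in> characters B"
proof -
  have "restrict \<phi> B 1 \<noteq> 0" using character_one[OF assms(1)] assms(2,3) by auto
  then have "\<exists>x\<in>B. restrict \<phi> B x \<noteq> 0" using assms(3) by blast
  then show ?thesis
    using assms(1,2,4-6) unfolding characters_def by (auto simp: subset_eq)
qed

lemma continuous_map_complex_mult:
  fixes f g :: "'a \<Rightarrow> complex"
  shows "continuous_map X euclidean f \<Longrightarrow> continuous_map X euclidean g \<Longrightarrow>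
    continuous_map X euclidean (\<lambda>x. f x * g x)"
  by (simp add: continuous_map_atin tendsto_mult)

text \<open>Banach-Alaoglu argument: the characters form a closed subset of a product of discs,
  which is compact by Tychonoff. Being nonzero is not a closed condition, so it is replaced by
  \<open>\<phi> 1 = 1\<close>.\<close>

lemma compact_space_max_ideal_space:
  assumes A: "1 \<in> A" "\<And>x y. x \<in> A \<Longrightarrow> y \<in> A \<Longrightarrow> x + y \<in> A" "\<And>x y. x \<in> A \<Longrightarrow> y \<in> A \<Longrightarrow> x * y \<in> A"
    "\<And>c x. x \<in> A \<Longrightarrow> scaleC c x \<in> A"
    and bd: "\<And>x. x \<in> A \<Longrightarrow> \<exists>B. \<forall>\<phi>\<in>characters A. cmod (\<phi> x) \<le> B"
  shows "compact_space (max_ideal_space A)"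
proof -
  let ?P = "product_topology (\<lambda>_. euclidean :: complex topology) A"
  obtain B where B: "\<And>x \<phi>. x \<in> A \<Longrightarrow> \<phi> \<in> characters A \<Longrightarrow> cmod (\<phi> x) \<le> B x"
    using bd by metis
  have comp: "compactin ?P (PiE A (\<lambda>x. cball 0 (B x)))"
    unfolding compactin_PiE by simp
  have cont: "F \<in> A \<Longrightarrow> continuous_map ?P euclidean (\<lambda>\<phi>. \<phi> F)" for F
    by (rule continuous_map_product_projection)
  have eqcl: "closedin ?P {\<phi> \<in> topspace ?P. f \<phi> = g \<phi>}"
    if "continuous_map ?P euclidean f" "continuous_map ?P euclidean g" for f g :: "_ \<Rightarrow> complex"
    using that by (intro closedin_continuous_maps_eq[where Y=euclidean]) auto
  define K where "K R = {\<phi> \<in> topspace ?P. R \<phi>}" for R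
  have eq: "characters A = K (\<lambda>\<phi>. \<phi> 1 = 1) \<inter> ((\<Inter>x\<in>A. \<Inter>y\<in>A. K (\<lambda>\<phi>. \<phi> (x + y) = \<phi> x + \<phi> y)) \<inter>
    ((\<Inter>x\<in>A. \<Inter>y\<in>A. K (\<lambda>\<phi>. \<phi> (x * y) = \<phi> x * \<phi> y)) \<inter>
    (\<Inter>c. \<Inter>x\<in>A. K (\<lambda>\<phi>. \<phi> (scaleC c x) = c * \<phi> x))))" (is "_ = ?C")
  proof (intro set_eqI iffI)
    fix \<phi> assume *: "\<phi> \<in> characters A"
    then have "\<phi> \<in> extensional A" unfolding characters_def by blast
    then have "\<phi> \<in> topspace ?P" by (simp add: PiE_iff)
    then show "\<phi> \<in> ?C"
      using character_one[OF * A(1)] * unfolding characters_def K_def by blast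
  next
    fix \<phi> assume *: "\<phi> \<in> ?C"
    then have "\<phi> \<in> topspace ?P" "\<phi> 1 = 1" unfolding K_def by blast+
    then have "\<phi> \<in> extensional A" "\<exists>x\<in>A. \<phi> x \<noteq> 0" using A(1) by (auto simp: PiE_def intro!: bexI[of _ 1])
    moreover have "\<forall>x\<in>A. \<forall>y\<in>A. \<phi> (x + y) = \<phi> x + \<phi> y" "\<forall>x\<in>A. \<forall>y\<in>A. \<phi> (x * y) = \<phi> x * \<phi> y"
      "\<forall>c. \<forall>x\<in>A. \<phi> (scaleC c x) = c * \<phi> x"
      using * by (simp_all add: K_def)
    ultimately show "\<phi> \<in> characters A" by (simp add: characters_def)
  qed
  have "closedin ?P ?C"
    unfolding K_def
    by (intro closedin_Int closedin_INT eqcl continuous_map_add continuous_map_complex_mult cont A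
        continuous_map_canonical_const) (use A(1) in auto)
  then have "closedin ?P (characters A)" by (simp only: eq)
  moreover have "characters A \<subseteq> PiE A (\<lambda>x. cball 0 (B x))"
    using B by (auto intro: extensional_arb[OF character_extensional])
  ultimately have "compactin ?P (characters A)" using comp closed_compactin by blast
  then show ?thesis unfolding max_ideal_space_def by (rule compact_space_subtopology)
qed

section \<open>Inverse closed self-adjoint algebras of bounded functions\<close>

lemma ae_class_add:
  "f \<in> ess_bounded \<Longrightarrow> g \<in> ess_bounded \<Longrightarrow> ae_class (\<lambda>z. f z + g z) = ae_class f + ae_class g"
  by (subst plus_circle_Linf.abs_eq) (auto simp: ae_eq_def)

lemma ae_class_mult:
  "f \<in> ess_bounded \<Longrightarrow> g \<in> ess_bounded \<Longrightarrow> ae_class (\<lambda>z. f z * g z) = ae_class f * ae_class g"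
  by (subst times_circle_Linf.abs_eq) (auto simp: ae_eq_def)

lemma ae_class_scaleC: "f \<in> ess_bounded \<Longrightarrow> ae_class (\<lambda>z. c * f z) = scaleC c (ae_class f)"
  by (subst scaleC_circle_Linf.abs_eq) (auto simp: ae_eq_def)

lemma ae_class_one: "ae_class (\<lambda>_. 1) = 1"
  by (simp add: one_circle_Linf_def)

text \<open>Functions are used instead of classes, so that continuity and germs make sense.
  \<open>ident_mem\<close> provides the coordinate function, whose value under a character is the
  base point of the character; \<open>cnj_mem\<close> and \<open>inverse_mem\<close> are what makes
  a character follow actual values of functions.\<close>

locale fun_alg =
  fixes \<A> :: "(complex \<Rightarrow> complex) set"
  assumes ess_bdd: "f \<in> \<A> \<Longrightarrow> f \<in> ess_bounded"
    and const_mem: "(\<lambda>_. c) \<in> \<A>"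
    and ident_mem: "(\<lambda>z. z) \<in> \<A>"
    and add_mem: "f \<in> \<A> \<Longrightarrow> g \<in> \<A> \<Longrightarrow> (\<lambda>z. f z + g z) \<in> \<A>"
    and mult_mem: "f \<in> \<A> \<Longrightarrow> g \<in> \<A> \<Longrightarrow> (\<lambda>z. f z * g z) \<in> \<A>"
    and cnj_mem: "f \<in> \<A> \<Longrightarrow> (\<lambda>z. cnj (f z)) \<in> \<A>"
    and inverse_mem: "f \<in> \<A> \<Longrightarrow> (\<delta>::real) > 0 \<Longrightarrow> AE z in arc_length. \<delta> \<le> cmod (f z) \<Longrightarrow> (\<lambda>z. inverse (f z)) \<in> \<A>"
begin

abbreviation alg :: "circle_Linf set" where "alg \<equiv> ae_class ` \<A>"

lemma diff_const_mem: "f \<in> \<A> \<Longrightarrow> (\<lambda>z. f z - c) \<in> \<A>"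
  using add_mem[OF _ const_mem[of "- c"], of f] by simp

lemma alg_one: "1 \<in> alg"
  by (metis ae_class_one const_mem imageI)

lemma alg_add: "F \<in> alg \<Longrightarrow> G \<in> alg \<Longrightarrow> F + G \<in> alg"
  by (auto simp flip: ae_class_add simp: ess_bdd intro!: imageI add_mem)

lemma alg_mult: "F \<in> alg \<Longrightarrow> G \<in> alg \<Longrightarrow> F * G \<in> alg"
  by (auto simp flip: ae_class_mult simp: ess_bdd intro!: imageI mult_mem)

lemma alg_scaleC: "F \<in> alg \<Longrightarrow> scaleC c F \<in> alg"
  by (auto simp flip: ae_class_scaleC simp: ess_bdd intro!: imageI mult_mem const_mem)

lemma char_add:
  "\<phi> \<in> characters alg \<Longrightarrow> f \<in> \<A> \<Longrightarrow> g \<in> \<A> \<Longrightarrow> \<phi> (ae_class (\<lambda>z. f z + g z)) = \<phi> (ae_class f) + \<phi> (ae_class g)"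
  by (simp add: ae_class_add ess_bdd characters_def)

lemma char_mult:
  "\<phi> \<in> characters alg \<Longrightarrow> f \<in> \<A> \<Longrightarrow> g \<in> \<A> \<Longrightarrow> \<phi> (ae_class (\<lambda>z. f z * g z)) = \<phi> (ae_class f) * \<phi> (ae_class g)"
  by (simp add: ae_class_mult ess_bdd characters_def)

lemma char_const: "\<phi> \<in> characters alg \<Longrightarrow> \<phi> (ae_class (\<lambda>_. c)) = c"
proof -
  assume \<phi>: "\<phi> \<in> characters alg"
  have "\<phi> (scaleC c 1) = c * \<phi> 1" using \<phi> alg_one unfolding characters_def by blast
  moreover have "scaleC c 1 = ae_class (\<lambda>_. c)"
    using ae_class_scaleC[OF ess_bdd[OF const_mem[of 1]], of c] by (simp add: ae_class_one)
  ultimately show ?thesis using character_one[OF \<phi> alg_one] by simp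
qed

lemma char_diff_const:
  "\<phi> \<in> characters alg \<Longrightarrow> f \<in> \<A> \<Longrightarrow> \<phi> (ae_class (\<lambda>z. f z - c)) = \<phi> (ae_class f) - c"
  using char_add[of \<phi> f "\<lambda>_. - c"] const_mem by (simp add: char_const)

text \<open>Under the last assumption \<open>|f - \<phi>(f)|\<^sup>2 + |g - \<phi>(g)|\<^sup>2\<close> is an invertible element of the kernel of \<open>\<phi>\<close>.\<close>

lemma char_not_AE_far:
  assumes \<phi>: "\<phi> \<in> characters alg" and f: "f \<in> \<A>" and g: "g \<in> \<A>" and e: "\<epsilon> > 0"
    and far: "AE z in arc_length. \<not> (cmod (f z - \<phi> (ae_class f)) < \<epsilon> \<and> cmod (g z - \<phi> (ae_class g)) < \<epsilon>)"
  shows False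
proof -
  define d where "d f z = (f z - \<phi> (ae_class f)) * cnj (f z - \<phi> (ae_class f))" for f :: "complex \<Rightarrow> complex" and z
  have d: "d f \<in> \<A>" "\<phi> (ae_class (d f)) = 0" if "f \<in> \<A>" for f
  proof -
    have m: "(\<lambda>z. f z - \<phi> (ae_class f)) \<in> \<A>" "(\<lambda>z. cnj (f z - \<phi> (ae_class f))) \<in> \<A>"
      using diff_const_mem[OF that] cnj_mem by blast+
    from mult_mem[OF this] show "d f \<in> \<A>" by (simp add: d_def[abs_def])
    show "\<phi> (ae_class (d f)) = 0"
      using char_mult[OF \<phi> m] by (simp add: d_def[abs_def] char_diff_const[OF \<phi> that])
  qed
  define D where "D z = d f z + d g z" for z
  have D: "D \<in> \<A>" "\<phi> (ae_class D) = 0"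
    using add_mem[OF d(1)[OF f] d(1)[OF g]] char_add[OF \<phi> d(1)[OF f] d(1)[OF g]] d(2)[OF f] d(2)[OF g]
    by (simp_all add: D_def[abs_def])
  have dn: "d f z = of_real ((cmod (f z - \<phi> (ae_class f)))\<^sup>2)" for f z
    by (simp only: d_def complex_norm_square)
  have Dn: "cmod (D z) = (cmod (f z - \<phi> (ae_class f)))\<^sup>2 + (cmod (g z - \<phi> (ae_class g)))\<^sup>2" for z
    unfolding D_def dn of_real_add[symmetric] norm_of_real by simp
  have lower: "AE z in arc_length. \<epsilon>\<^sup>2 \<le> cmod (D z)"
    using far
  proof eventually_elim
    case (elim z)
    then have "\<epsilon> \<le> cmod (f z - \<phi> (ae_class f)) \<or> \<epsilon> \<le> cmod (g z - \<phi> (ae_class g))" by auto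
    then have "\<epsilon>\<^sup>2 \<le> (cmod (f z - \<phi> (ae_class f)))\<^sup>2 \<or> \<epsilon>\<^sup>2 \<le> (cmod (g z - \<phi> (ae_class g)))\<^sup>2"
      using e by (auto intro: power_mono)
    then show ?case unfolding Dn by (smt (verit) zero_le_power2)
  qed
  have inv: "(\<lambda>z. inverse (D z)) \<in> \<A>"
    using inverse_mem[OF D(1) _ lower] e by simp
  have "AE z in arc_length. D z * inverse (D z) = 1"
    using lower by eventually_elim (use e in \<open>auto intro!: right_inverse\<close>)
  then have "ae_class (\<lambda>z. D z * inverse (D z)) = ae_class (\<lambda>_. 1)"
    by (subst ae_class_eq_iff) (auto intro!: ess_bdd mult_mem D inv const_mem)
  then have "1 = \<phi> (ae_class D) * \<phi> (ae_class (\<lambda>z. inverse (D z)))"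
    using char_mult[OF \<phi> D(1) inv] char_const[OF \<phi>, of 1] by simp
  then show False using D(2) by simp
qed

text \<open>A value outside \<open>K\<close> is the centre of a ball that \<open>f\<close> avoids
  almost everywhere, against \<open>char_not_AE_far\<close> with \<open>f\<close> in both places.
  Closed discs give the boundedness of characters, finite sets will give their discreteness on
  suitable functions.\<close>

lemma char_mem_closed:
  assumes \<phi>: "\<phi> \<in> characters alg" and f: "f \<in> \<A>" and K: "closed K" and AE: "AE z in arc_length. f z \<in> K"
  shows "\<phi> (ae_class f) \<in> K"
proof (rule ccontr)
  assume n: "\<phi> (ae_class f) \<notin> K"
  then obtain e where e: "e > 0" "ball (\<phi> (ae_class f)) e \<subseteq> - K"
    using K by (metis open_Compl ComplI openE)
  show False
  proof (rule char_not_AE_far[OF \<phi> f f e(1)])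
    show "AE z in arc_length. \<not> (cmod (f z - \<phi> (ae_class f)) < e \<and> cmod (f z - \<phi> (ae_class f)) < e)"
      using AE by eventually_elim (use e(2) in \<open>auto simp: dist_norm norm_minus_commute subset_eq\<close>)
  qed
qed

lemma compact_space_alg: "compact_space (max_ideal_space alg)"
proof (rule compact_space_max_ideal_space[OF alg_one alg_add alg_mult alg_scaleC])
  fix F assume "F \<in> alg"
  then obtain f where f: "F = ae_class f" "f \<in> \<A>" by blast
  then obtain B where "AE z in arc_length. f z \<in> cball 0 B"
    using ess_bdd[of f] by (auto simp: ess_bounded_def)
  then show "\<exists>B. \<forall>\<phi>\<in>characters alg. cmod (\<phi> F) \<le> B"
    using char_mem_closed[OF _ f(2), of _ "cball 0 B"] f(1) by auto
qed

lemma char_ident_circle: "\<phi> \<in> characters alg \<Longrightarrow> \<phi> (ae_class (\<lambda>z. z)) \<in> circle"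
  by (rule char_mem_closed[OF _ ident_mem]) (auto intro: AE_I2)

text \<open>Pairing \<open>f\<close> with the coordinate function localizes: where \<open>z\<close>
  is close to \<open>w\<close>, \<open>f z\<close> is close to \<open>f w\<close> and hence far from
  any other value. Since only continuity at \<open>w\<close> enters, this also serves for particular
  functions at points of \<open>S\<close>.\<close>

lemma char_eval_continuous:
  assumes \<phi>: "\<phi> \<in> characters alg" and f: "f \<in> \<A>" and w: "\<phi> (ae_class (\<lambda>z. z)) = w"
    and cont: "continuous (at w within circle) f"
  shows "\<phi> (ae_class f) = f w"
proof (rule ccontr)
  assume n: "\<phi> (ae_class f) \<noteq> f w"
  define e where "e = dist (\<phi> (ae_class f)) (f w) / 2"
  have e: "e > 0" using n by (simp add: e_def)
  obtain d where d: "d > 0" "\<And>z. z \<in> circle \<Longrightarrow> dist z w < d \<Longrightarrow> dist (f z) (f w) < e"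
    using cont e by (auto simp: continuous_within_eps_delta)
  have far: "\<not> (cmod (f z - \<phi> (ae_class f)) < min d e \<and> cmod (z - \<phi> (ae_class (\<lambda>z. z))) < min d e)"
    if "z \<in> circle" for z
  proof
    assume *: "cmod (f z - \<phi> (ae_class f)) < min d e \<and> cmod (z - \<phi> (ae_class (\<lambda>z. z))) < min d e"
    then have "dist (f z) (f w) < e" using d(2)[OF that] w by (simp add: dist_norm)
    moreover have "dist (f z) (\<phi> (ae_class f)) < e" using * by (simp add: dist_norm)
    ultimately show False
      unfolding e_def by (metis dist_commute dist_triangle_half_l less_irrefl)
  qed
  show False
    by (rule char_not_AE_far[OF \<phi> f ident_mem, of "min d e"]) (use d e far in \<open>auto intro!: AE_I2\<close>)
qed

text \<open>Passes from functions to classes through a chosen representative; the choice is harmless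
  once \<open>H\<close> respects equality almost everywhere.\<close>

definition char_of :: "((complex \<Rightarrow> complex) \<Rightarrow> complex) \<Rightarrow> circle_Linf \<Rightarrow> complex" where
  "char_of H = (\<lambda>F\<in>alg. H (SOME f. f \<in> \<A> \<and> ae_class f = F))"

lemma char_of_ae_class:
  assumes "\<And>f g. f \<in> \<A> \<Longrightarrow> g \<in> \<A> \<Longrightarrow> AE z in arc_length. f z = g z \<Longrightarrow> H f = H g" "f \<in> \<A>"
  shows "char_of H (ae_class f) = H f"
proof -
  let ?g = "SOME g. g \<in> \<A> \<and> ae_class g = ae_class f"
  have *: "?g \<in> \<A> \<and> ae_class ?g = ae_class f" by (rule someI[of _ f]) (use assms in auto)
  then have "AE z in arc_length. ?g z = f z" using assms(2) ess_bdd by (metis ae_class_eq_iff)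
  then have "H ?g = H f" using assms * by blast
  then show ?thesis using assms(2) by (simp add: char_of_def)
qed

lemma char_of_character:
  assumes AE: "\<And>f g. f \<in> \<A> \<Longrightarrow> g \<in> \<A> \<Longrightarrow> AE z in arc_length. f z = g z \<Longrightarrow> H f = H g"
    and add: "\<And>f g. f \<in> \<A> \<Longrightarrow> g \<in> \<A> \<Longrightarrow> H (\<lambda>z. f z + g z) = H f + H g"
    and mult: "\<And>f g. f \<in> \<A> \<Longrightarrow> g \<in> \<A> \<Longrightarrow> H (\<lambda>z. f z * g z) = H f * H g"
    and const: "\<And>c. H (\<lambda>_. c) = c"
  shows "char_of H \<in> characters alg"
proof -
  note co = char_of_ae_class[of H, OF AE]
  have "char_of H (ae_class f + ae_class g) = char_of H (ae_class f) + char_of H (ae_class g)"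
    if "f \<in> \<A>" "g \<in> \<A>" for f g
    using that by (simp flip: ae_class_add add: ess_bdd co add_mem add)
  moreover have mul: "char_of H (ae_class f * ae_class g) = char_of H (ae_class f) * char_of H (ae_class g)"
    if "f \<in> \<A>" "g \<in> \<A>" for f g
    using that by (simp flip: ae_class_mult add: ess_bdd co mult_mem mult)
  moreover have "char_of H (scaleC c (ae_class f)) = c * char_of H (ae_class f)"
    if "f \<in> \<A>" for f c
    using that mult[OF const_mem[of c] that] mult_mem[OF const_mem[of c] that]
    by (simp flip: ae_class_scaleC add: ess_bdd co const)
  moreover have "char_of H (ae_class (\<lambda>_. 1)) \<noteq> 0" by (simp add: co const const_mem)
  moreover have "char_of H \<in> extensional alg" by (simp add: char_of_def)
  ultimately show ?thesis using const_mem unfolding characters_def by blast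
qed

lemma character_eqI:
  assumes "\<phi> \<in> characters alg" "\<psi> \<in> characters alg" "\<And>f. f \<in> \<A> \<Longrightarrow> \<phi> (ae_class f) = \<psi> (ae_class f)"
  shows "\<phi> = \<psi>"
  by (rule extensionalityI[of _ alg]) (use assms in \<open>auto simp: characters_def\<close>)

end

section \<open>The function algebras behind R_S and AP(S)\<close>

lemma ess_bounded_cnj: "f \<in> ess_bounded \<Longrightarrow> (\<lambda>z. cnj (f z)) \<in> ess_bounded"
  unfolding ess_bounded_def
  by (auto intro!: measurable_compose[of f _ borel cnj] borel_measurable_continuous_onI continuous_intros)

lemma ess_bounded_inverse:
  assumes "f \<in> ess_bounded" "c > 0" "AE z in arc_length. c \<le> cmod (f z)"
  shows "(\<lambda>z. inverse (f z)) \<in> ess_bounded"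
proof -
  have "AE z in arc_length. cmod (inverse (f z)) \<le> inverse c"
    using assms(3) by eventually_elim (use assms(2) in \<open>auto simp: norm_inverse intro!: le_imp_inverse_le\<close>)
  then show ?thesis using assms(1) by (auto simp: ess_bounded_def)
qed

lemma ess_boundedI:
  assumes "f \<in> borel_measurable borel" "\<And>z. z \<in> circle \<Longrightarrow> cmod (f z) \<le> B"
  shows "f \<in> ess_bounded"
  using assms by (auto simp: ess_bounded_def intro!: borel_measurable_arc_length exI[of _ B] AE_I2)

text \<open>The points of \<open>circle - S\<close> that violate the condition form an open subset
  of the circle, and such a set is null only if it is empty.\<close>

lemma AE_continuous_on_closed:
  assumes "closed S" "continuous_on (circle - S) f" "AE z in arc_length. f z \<in> K" "closed K" "w \<in> circle - S"
  shows "f w \<in> K"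
proof (rule ccontr)
  assume n: "f w \<notin> K"
  have "open (- K)" using assms(4) by auto
  then obtain U where U: "open U" "U \<inter> (circle - S) = f -` (- K) \<inter> (circle - S)"
    using assms(2) unfolding continuous_on_open_invariant by blast
  have "w \<in> U \<inter> - S" using U n assms(5) by blast
  moreover have "open (U \<inter> - S)" using U(1) assms(1) by auto
  ultimately obtain z where "z \<in> (U \<inter> - S) \<inter> circle" "f z \<in> K"
    using AE_arc_length_dense[OF assms(3), of "U \<inter> - S" w] assms(5) by blast
  then show False using U(2) by blast
qed

lemma continuous_within_circle:
  assumes "closed S" "continuous_on (circle - S) f" "w \<in> circle - S"
  shows "continuous (at w within circle) f"
proof -
  have "at w within circle = at w within (circle - S)"
    by (rule at_within_nhd[of w "- S"]) (use assms in auto)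
  then show ?thesis using assms by (simp add: continuous_on_eq_continuous_within)
qed

lemma tendsto_cis_circle:
  assumes "continuous (at (cis t0) within circle) f"
  shows "((\<lambda>u. f (cis (t0 + k * u))) \<longlongrightarrow> f (cis t0)) (at_right 0)"
proof (rule continuous_within_tendsto_compose'[OF assms])
  have "((\<lambda>u. cis (t0 + k * u)) \<longlongrightarrow> cis (t0 + k * 0)) (at_right 0)"
    by (intro tendsto_intros)
  then show "((\<lambda>u. cis (t0 + k * u)) \<longlongrightarrow> cis t0) (at_right 0)" by simp
qed auto

lemma first_kindI:
  assumes "f \<in> ess_bounded" "continuous_on (circle - S) f"
    "\<And>z k. z \<in> S \<Longrightarrow> k \<in> {-1,1} \<Longrightarrow> \<exists>L. ((\<lambda>t. f (z * cis (k * t))) \<longlongrightarrow> L) (at_right 0)"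
  shows "f \<in> first_kind S"
  unfolding first_kind_def using assms by (intro CollectI conjI ballI)

lemma first_kindD:
  assumes "f \<in> first_kind S"
  shows "f \<in> ess_bounded" "continuous_on (circle - S) f"
  using assms by (simp_all add: first_kind_def)

lemma first_kind_limit:
  assumes "f \<in> first_kind S" "z \<in> S" "k \<in> {-1,1}"
  obtains L where "((\<lambda>t. f (z * cis (k * t))) \<longlongrightarrow> L) (at_right 0)"
  using assms unfolding first_kind_def by blast

locale closed_in_circle =
  fixes S :: "complex set"
  assumes closed_S: "closed S" and S_circle: "S \<subseteq> circle"
begin

text \<open>The limit may be taken along \<open>essR\<close>, where a bound almost everywhere is
  visible. This keeps the one-sided limits nonzero when an inverse is formed.\<close>

lemma first_kind_tendsto_bound:
  assumes "f \<in> first_kind S" "AE z in arc_length. c \<le> cmod (f z)" "z \<in> S" "k \<in> {-1,1}"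
    "((\<lambda>t. f (z * cis (k * t))) \<longlongrightarrow> L) (at_right 0)"
  shows "c \<le> cmod L"
proof -
  obtain t0 where t0: "z = cis t0" using assms(3) S_circle circle_eq_cis by blast
  have "((\<lambda>t. f (cis (t0 + k * t))) \<longlongrightarrow> L) essR"
    using assms(5) essR_le unfolding t0 by (simp add: cis_mult tendsto_mono)
  then have "((\<lambda>t. cmod (f (cis (t0 + k * t)))) \<longlongrightarrow> cmod L) essR" by (rule tendsto_norm)
  then show ?thesis
    by (rule tendsto_lowerbound[OF _ AE_imp_essR[OF assms(2,4)]]) simp
qed

lemma fun_alg_first_kind: "fun_alg (first_kind S)"
proof
  show "f \<in> ess_bounded" if "f \<in> first_kind S" for f using that by (simp add: first_kind_def)
  show "(\<lambda>_. c) \<in> first_kind S" for c by (auto simp: first_kind_def ess_bounded_const)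
  have "((\<lambda>t. z * cis (k * t)) \<longlongrightarrow> z * cis (k * 0)) (at_right 0)" for z k
    by (intro tendsto_intros)
  moreover have "(\<lambda>z. z) \<in> ess_bounded" by (rule ess_boundedI[of _ 1]) auto
  ultimately show "(\<lambda>z. z) \<in> first_kind S"
    by (intro first_kindI continuous_on_id exI)
  fix f assume f: "f \<in> first_kind S"
  show "(\<lambda>z. cnj (f z)) \<in> first_kind S"
    by (intro first_kindI ess_bounded_cnj continuous_intros first_kindD[OF f])
       (metis first_kind_limit[OF f] tendsto_cnj)
  show "(\<lambda>z. inverse (f z)) \<in> first_kind S" if c: "(c::real) > 0" "AE z in arc_length. c \<le> cmod (f z)" for c
  proof (rule first_kindI)
    show "(\<lambda>z. inverse (f z)) \<in> ess_bounded" using f c by (intro ess_bounded_inverse) (auto simp: first_kind_def)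
    have "f w \<in> - ball 0 c" if "w \<in> circle - S" for w
      by (rule AE_continuous_on_closed[OF closed_S _ _ _ that]) (use f c in \<open>auto simp: first_kind_def\<close>)
    then have "f w \<noteq> 0" if "w \<in> circle - S" for w using that c(1) by force
    then show "continuous_on (circle - S) (\<lambda>z. inverse (f z))"
      using f by (intro continuous_intros) (auto simp: first_kind_def)
    fix z k assume zk: "z \<in> S" "k \<in> {-1,1::real}"
    then obtain L where L: "((\<lambda>t. f (z * cis (k * t))) \<longlongrightarrow> L) (at_right 0)"
      using first_kind_limit[OF f zk] by blast
    from first_kind_tendsto_bound[OF f c(2) zk L] have "L \<noteq> 0" using c(1) by auto
    then show "\<exists>L. ((\<lambda>t. inverse (f (z * cis (k * t)))) \<longlongrightarrow> L) (at_right 0)"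
      using tendsto_inverse[OF L] by blast
  qed
  fix g assume g: "g \<in> first_kind S"
  show "(\<lambda>z. f z + g z) \<in> first_kind S"
  proof (rule first_kindI)
    fix z k assume zk: "z \<in> S" "k \<in> {-1,1::real}"
    obtain L where L: "((\<lambda>t. f (z * cis (k * t))) \<longlongrightarrow> L) (at_right 0)"
      using first_kind_limit[OF f zk] by blast
    obtain M where "((\<lambda>t. g (z * cis (k * t))) \<longlongrightarrow> M) (at_right 0)"
      using first_kind_limit[OF g zk] by blast
    from tendsto_add[OF L this]
    show "\<exists>L. ((\<lambda>t. f (z * cis (k * t)) + g (z * cis (k * t))) \<longlongrightarrow> L) (at_right 0)" by blast
  qed (intro ess_bounded_add continuous_intros first_kindD[OF f] first_kindD[OF g])+
  show "(\<lambda>z. f z * g z) \<in> first_kind S"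
  proof (rule first_kindI)
    fix z k assume zk: "z \<in> S" "k \<in> {-1,1::real}"
    obtain L where L: "((\<lambda>t. f (z * cis (k * t))) \<longlongrightarrow> L) (at_right 0)"
      using first_kind_limit[OF f zk] by blast
    obtain M where "((\<lambda>t. g (z * cis (k * t))) \<longlongrightarrow> M) (at_right 0)"
      using first_kind_limit[OF g zk] by blast
    from tendsto_mult[OF L this]
    show "\<exists>L. ((\<lambda>t. f (z * cis (k * t)) * g (z * cis (k * t))) \<longlongrightarrow> L) (at_right 0)" by blast
  qed (intro ess_bounded_mult continuous_intros first_kindD[OF f] first_kindD[OF g])+
qed

lemma fun_alg_ap_fun: "fun_alg (ap_fun S)"
proof
  show "f \<in> ess_bounded" if "f \<in> ap_fun S" for f using that by (simp add: ap_fun_def)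
  show "(\<lambda>_. c) \<in> ap_fun S" for c
    using ap_germ_const[of _ _ c] by (auto simp: ap_fun_def ess_bounded_const)
  have "ap_germ t0 k (\<lambda>z. z) (\<lambda>_. cis t0)" for t0 k
    by (rule ap_germ_tendsto[OF tendsto_cis_circle]) (rule continuous_ident)
  then show "(\<lambda>z. z) \<in> ap_fun S"
    by (auto simp: ap_fun_def intro!: ess_boundedI[of _ 1])
  fix f assume f: "f \<in> ap_fun S"
  show "(\<lambda>z. cnj (f z)) \<in> ap_fun S"
    using f ap_germ_cnj unfolding ap_fun_def
    by (intro CollectI conjI ess_bounded_cnj continuous_intros) blast+
  show "(\<lambda>z. inverse (f z)) \<in> ap_fun S" if c: "(c::real) > 0" "AE z in arc_length. c \<le> cmod (f z)" for c
    unfolding ap_fun_def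
  proof (intro CollectI conjI ballI allI)
    show "(\<lambda>z. inverse (f z)) \<in> ess_bounded" using f c by (intro ess_bounded_inverse) (auto simp: ap_fun_def)
    have "f w \<in> - ball 0 c" if "w \<in> circle - S" for w
      by (rule AE_continuous_on_closed[OF closed_S _ _ _ that]) (use f c in \<open>auto simp: ap_fun_def\<close>)
    then have "f w \<noteq> 0" if "w \<in> circle - S" for w using that c(1) by force
    then show "continuous_on (circle - S) (\<lambda>z. inverse (f z))"
      using f by (intro continuous_intros) (auto simp: ap_fun_def)
    fix t0 k assume k: "k \<in> {-1,1::real}"
    then obtain g where "ap_germ t0 k f g" using f unfolding ap_fun_def by blast
    from ap_germ_inverse[OF this c k] show "\<exists>g. ap_germ t0 k (\<lambda>z. inverse (f z)) g" by blast
  qed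
  fix g assume g: "g \<in> ap_fun S"
  show "(\<lambda>z. f z + g z) \<in> ap_fun S"
    using f g ap_germ_add unfolding ap_fun_def
    by (intro CollectI conjI ess_bounded_add continuous_intros) blast+
  show "(\<lambda>z. f z * g z) \<in> ap_fun S"
    using f g ap_germ_mult unfolding ap_fun_def
    by (intro CollectI conjI ess_bounded_mult continuous_intros) blast+
qed

lemma first_kind_subset_ap_fun: "first_kind S \<subseteq> ap_fun S"
proof
  fix f assume f: "f \<in> first_kind S"
  have "\<exists>g. ap_germ t0 k f g" if k: "k \<in> {-1,1}" for t0 k
  proof (cases "cis t0 \<in> S")
    case True
    then obtain L where "((\<lambda>t. f (cis t0 * cis (k * t))) \<longlongrightarrow> L) (at_right 0)"
      using first_kind_limit[OF f _ k] by blast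
    then show ?thesis using ap_germ_tendsto[of f t0 k L] by (auto simp: cis_mult)
  next
    case False
    then have "continuous (at (cis t0) within circle) f"
      using f by (intro continuous_within_circle[OF closed_S]) (auto simp: first_kind_def)
    from ap_germ_tendsto[OF tendsto_cis_circle[OF this]] show ?thesis by blast
  qed
  then show "f \<in> ap_fun S" using f by (auto simp: ap_fun_def first_kind_def)
qed

end

text \<open>R_S and AP(S) are treated together: the lower inclusion brings in the jump functions,
  the upper one continuity off \<open>S\<close>. With \<open>S\<close> empty both ends are the
  continuous functions on the circle.\<close>

locale intermediate_alg = closed_in_circle S + fun_alg \<A> for S :: "complex set" and \<A> +
  assumes first_kind_subset: "first_kind S \<subseteq> \<A>" and subset_ap_fun: "\<A> \<subseteq> ap_fun S"
begin

lemma continuous_on_mem: "f \<in> \<A> \<Longrightarrow> continuous_on (circle - S) f"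
  using subset_ap_fun by (auto simp: ap_fun_def)

lemma eval_off:
  "\<phi> \<in> characters alg \<Longrightarrow> f \<in> \<A> \<Longrightarrow> \<phi> (ae_class (\<lambda>z. z)) \<notin> S \<Longrightarrow> \<phi> (ae_class f) = f (\<phi> (ae_class (\<lambda>z. z)))"
  by (rule char_eval_continuous[OF _ _ refl continuous_within_circle[OF closed_S continuous_on_mem]])
     (use char_ident_circle in auto)

lemma AE_eq_off:
  assumes "f \<in> \<A>" "g \<in> \<A>" "AE z in arc_length. f z = g z" "w \<in> circle - S"
  shows "f w = g w"
proof -
  have "(\<lambda>z. f z - g z) w \<in> {0}"
    using assms(3)
    by (intro AE_continuous_on_closed[OF closed_S _ _ _ assms(4)] continuous_on_diff continuous_on_mem assms) auto
  then show ?thesis by simp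
qed

lemma eval_character: "w \<in> circle - S \<Longrightarrow> char_of (\<lambda>f. f w) \<in> characters alg"
  by (rule char_of_character) (auto intro: AE_eq_off)

lemma eval_apply: "w \<in> circle - S \<Longrightarrow> f \<in> \<A> \<Longrightarrow> char_of (\<lambda>f. f w) (ae_class f) = f w"
  by (rule char_of_ae_class) (auto intro: AE_eq_off)

text \<open>Over a point off \<open>S\<close> a character is the evaluation there, so the base point
  and the evaluation determine each other; continuity in both directions is immediate for pointwise
  convergence. The result serves three times: with \<open>S\<close> empty for C of the circle, and
  for R_S and AP(S) in statements (2) and (5).\<close>

lemma homeomorphic_maps_off:
  "homeomorphic_maps
    (subtopology (max_ideal_space alg) {\<phi> \<in> characters alg. \<phi> (ae_class (\<lambda>z. z)) \<notin> S})
    (top_of_set (circle - S)) (\<lambda>\<phi>. \<phi> (ae_class (\<lambda>z. z))) (\<lambda>w. char_of (\<lambda>f. f w))"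
  unfolding homeomorphic_maps_def
proof (intro conjI ballI)
  have id: "ae_class (\<lambda>z. z) \<in> alg" using ident_mem by blast
  show "continuous_map (subtopology (max_ideal_space alg) {\<phi> \<in> characters alg. \<phi> (ae_class (\<lambda>z. z)) \<notin> S})
    (top_of_set (circle - S)) (\<lambda>\<phi>. \<phi> (ae_class (\<lambda>z. z)))"
    using char_ident_circle
    by (auto simp: continuous_map_in_subtopology intro!: continuous_map_from_subtopology continuous_map_max_ideal_space_eval id)
  have "continuous_map (top_of_set (circle - S)) (max_ideal_space alg) (\<lambda>w. char_of (\<lambda>f. f w))"
  proof (rule continuous_map_into_max_ideal_space)
    fix F assume "F \<in> alg"
    then obtain f where f: "F = ae_class f" "f \<in> \<A>" by blast
    have "continuous_on (circle - S) (\<lambda>w. char_of (\<lambda>f. f w) F)"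
      using continuous_on_mem[OF f(2)] by (rule continuous_on_eq) (use f eval_apply in auto)
    then show "continuous_map (top_of_set (circle - S)) euclidean (\<lambda>w. char_of (\<lambda>f. f w) F)"
      by simp
  qed (use eval_character in auto)
  then show "continuous_map (top_of_set (circle - S))
    (subtopology (max_ideal_space alg) {\<phi> \<in> characters alg. \<phi> (ae_class (\<lambda>z. z)) \<notin> S}) (\<lambda>w. char_of (\<lambda>f. f w))"
    using eval_character by (auto simp: continuous_map_in_subtopology eval_apply ident_mem)
  fix \<phi> assume "\<phi> \<in> topspace (subtopology (max_ideal_space alg) {\<phi> \<in> characters alg. \<phi> (ae_class (\<lambda>z. z)) \<notin> S})"
  then have \<phi>: "\<phi> \<in> characters alg" "\<phi> (ae_class (\<lambda>z. z)) \<notin> S" by auto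
  then have "\<phi> (ae_class (\<lambda>z. z)) \<in> circle - S" using char_ident_circle by auto
  then show "char_of (\<lambda>f. f (\<phi> (ae_class (\<lambda>z. z)))) = \<phi>"
    by (intro character_eqI eval_character \<phi>) (simp_all only: eval_apply eval_off \<phi> not_False_eq_True)
qed (simp add: eval_apply ident_mem)

end

context closed_in_circle
begin

sublocale R: intermediate_alg S "first_kind S"
  by (intro intermediate_alg.intro fun_alg_first_kind closed_in_circle_axioms intermediate_alg_axioms.intro
      first_kind_subset_ap_fun order_refl)

sublocale AP: intermediate_alg S "ap_fun S"
  by (intro intermediate_alg.intro fun_alg_ap_fun closed_in_circle_axioms intermediate_alg_axioms.intro
      first_kind_subset_ap_fun order_refl)

end

text \<open>No point admits a discontinuity here, so the general results become the description of
  the characters of C of the circle.\<close>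

interpretation C: closed_in_circle "{}"
  by standard auto

lemma C_circle_eq: "C_circle = ae_class ` first_kind {}"
  by (auto simp: C_circle_def first_kind_def)

lemma point_eval_eq: "point_eval z = C.R.char_of (\<lambda>f. f z)"
proof -
  have "(\<lambda>f. f \<in> ess_bounded \<and> continuous_on circle f \<and> F = ae_class f) = (\<lambda>f. f \<in> first_kind {} \<and> ae_class f = F)" for F
    by (auto simp: first_kind_def)
  then show ?thesis
    unfolding point_eval_def C.R.char_of_def C_circle_eq by simp
qed

lemma homeomorphic_maps_point_eval:
  "homeomorphic_maps (max_ideal_space C_circle) (top_of_set circle) (\<lambda>\<phi>. \<phi> (ae_class (\<lambda>z. z))) point_eval"
proof -
  have "point_eval = (\<lambda>w. C.R.char_of (\<lambda>f. f w))" by (simp add: point_eval_eq fun_eq_iff)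
  moreover have "subtopology (max_ideal_space C_circle) (characters C_circle) = max_ideal_space C_circle"
    by (metis subtopology_topspace topspace_max_ideal_space)
  ultimately show ?thesis using C.R.homeomorphic_maps_off by (simp add: C_circle_eq)
qed

section \<open>The dual maps in coordinates and their behaviour off S\<close>

context closed_in_circle
begin

lemma C_circle_subset: "C_circle \<subseteq> R_alg S"
proof -
  have "f \<in> first_kind S" if f: "f \<in> ess_bounded" "continuous_on circle f" for f
  proof -
    have "\<exists>L. ((\<lambda>t. f (z * cis (k * t))) \<longlongrightarrow> L) (at_right 0)" if z: "z \<in> S" for z and k :: real
    proof -
      obtain t0 where t0: "z = cis t0" using z S_circle circle_eq_cis by blast
      have "continuous (at (cis t0) within circle) f"
        using f(2) by (simp add: continuous_on_eq_continuous_within)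
      from tendsto_cis_circle[OF this] show ?thesis by (auto simp: t0 cis_mult)
    qed
    then show ?thesis using f by (auto intro!: first_kindI intro: continuous_on_subset)
  qed
  then show ?thesis by (auto simp: C_circle_def R_alg_def)
qed

lemma R_alg_subset: "R_alg S \<subseteq> AP_alg S"
  unfolding R_alg_def AP_alg_eq using first_kind_subset_ap_fun by blast

lemma restrict_R_alg:
  "\<eta> \<in> characters (AP_alg S) \<Longrightarrow> r_map S \<eta> \<in> characters (R_alg S)"
  unfolding r_map_def
  by (rule restrict_character[OF _ R_alg_subset]) (auto simp: R_alg_def intro!: R.alg_one R.alg_add R.alg_mult R.alg_scaleC simp del: image_iff)

text \<open>A character of C of the circle is the evaluation at its value on the coordinate
  function, so the inverse of \<open>point_eval\<close> hidden in \<open>c_map\<close> becomes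
  explicit.\<close>

lemma c_map_eq:
  assumes "\<phi> \<in> characters (R_alg S)"
  shows "c_map \<phi> = \<phi> (ae_class (\<lambda>z. z))"
proof -
  have "restrict \<phi> C_circle \<in> characters C_circle"
    by (rule restrict_character[OF assms C_circle_subset])
      (unfold C_circle_eq, (fact C.R.alg_one C.R.alg_add C.R.alg_mult C.R.alg_scaleC)+)
  moreover have id: "ae_class (\<lambda>z. z) \<in> C_circle" using C.R.ident_mem by (auto simp: C_circle_eq)
  ultimately have *: "point_eval (\<phi> (ae_class (\<lambda>z. z))) = restrict \<phi> C_circle" "\<phi> (ae_class (\<lambda>z. z)) \<in> circle"
    using homeomorphic_maps_point_eval R.char_ident_circle[of \<phi>] assms
    by (auto simp: homeomorphic_maps_def R_alg_def)
  have "inj_on point_eval circle"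
    using homeomorphic_maps_point_eval unfolding homeomorphic_maps_def
    by (intro inj_on_inverseI[where g="\<lambda>\<phi>. \<phi> (ae_class (\<lambda>z. z))"]) auto
  from inv_into_f_f[OF this *(2)] show ?thesis unfolding c_map_def *(1)[symmetric] .
qed

lemma c_fibre_eq: "c_fibre S T = {\<phi> \<in> characters (R_alg S). \<phi> (ae_class (\<lambda>z. z)) \<in> T}"
  by (auto simp: c_fibre_def c_map_eq)

lemma ident_R_alg: "ae_class (\<lambda>z. z) \<in> R_alg S"
  using R.ident_mem by (auto simp: R_alg_def)

lemma continuous_map_c_map: "continuous_map (max_ideal_space (R_alg S)) (top_of_set circle) c_map"
proof -
  have "continuous_map (max_ideal_space (R_alg S)) (top_of_set circle) (\<lambda>\<phi>. \<phi> (ae_class (\<lambda>z. z)))"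
    using continuous_map_max_ideal_space_eval[OF ident_R_alg] R.char_ident_circle
    by (auto simp: continuous_map_in_subtopology R_alg_def)
  then show ?thesis by (rule continuous_map_eq) (simp add: c_map_eq)
qed

lemma continuous_map_r_map: "continuous_map (max_ideal_space (AP_alg S)) (max_ideal_space (R_alg S)) (r_map S)"
proof (rule continuous_map_into_max_ideal_space)
  fix F assume "F \<in> R_alg S"
  then show "continuous_map (max_ideal_space (AP_alg S)) euclidean (\<lambda>\<eta>. r_map S \<eta> F)"
    using R_alg_subset by (auto simp: r_map_def intro!: continuous_map_max_ideal_space_eval)
qed (use restrict_R_alg in auto)

lemma homeomorphic_maps_c_map_off:
  "homeomorphic_maps (subtopology (max_ideal_space (R_alg S)) (characters (R_alg S) - c_fibre S S))
       (top_of_set (circle - S)) c_map (\<lambda>w. R.char_of (\<lambda>f. f w))"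
proof -
  have "characters (R_alg S) - c_fibre S S = {\<phi> \<in> characters (R_alg S). \<phi> (ae_class (\<lambda>z. z)) \<notin> S}"
    by (auto simp: c_fibre_eq)
  with R.homeomorphic_maps_off[folded R_alg_def] show ?thesis
    by (auto elim!: homeomorphic_maps_eq simp: c_map_eq)
qed

text \<open>Off \<open>S\<close> both spaces are the punctured circle, so base point followed by
  evaluation is a homeomorphism. It coincides with restriction because \<open>\<eta>\<close>
  evaluates every function at its base point.\<close>

lemma homeomorphic_map_r_map_off:
  "homeomorphic_map
       (subtopology (max_ideal_space (AP_alg S)) {\<eta> \<in> characters (AP_alg S). c_map (r_map S \<eta>) \<notin> S})
       (subtopology (max_ideal_space (R_alg S)) (characters (R_alg S) - c_fibre S S)) (r_map S)"
proof -
  have id: "r_map S \<eta> (ae_class (\<lambda>z. z)) = \<eta> (ae_class (\<lambda>z. z))" for \<eta>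
    using ident_R_alg by (simp add: r_map_def)
  have eq: "{\<eta> \<in> characters (AP_alg S). c_map (r_map S \<eta>) \<notin> S} = {\<eta> \<in> characters (AP_alg S). \<eta> (ae_class (\<lambda>z. z)) \<notin> S}"
    by (auto simp: c_map_eq restrict_R_alg id)
  have "homeomorphic_maps (top_of_set (circle - S))
     (subtopology (max_ideal_space (R_alg S)) (characters (R_alg S) - c_fibre S S)) (\<lambda>w. R.char_of (\<lambda>f. f w)) c_map"
    using homeomorphic_maps_c_map_off by (rule homeomorphic_maps_sym[THEN iffD1])
  from homeomorphic_maps_compose[OF conjI[OF AP.homeomorphic_maps_off[folded AP_alg_eq] this]]
  have "homeomorphic_map
       (subtopology (max_ideal_space (AP_alg S)) {\<eta> \<in> characters (AP_alg S). c_map (r_map S \<eta>) \<notin> S})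
       (subtopology (max_ideal_space (R_alg S)) (characters (R_alg S) - c_fibre S S))
       ((\<lambda>w. R.char_of (\<lambda>f. f w)) \<circ> (\<lambda>\<phi>. \<phi> (ae_class (\<lambda>z. z))))"
    unfolding eq homeomorphic_map_maps by blast
  then show ?thesis
  proof (rule homeomorphic_map_eq)
    fix \<eta> assume "\<eta> \<in> topspace (subtopology (max_ideal_space (AP_alg S)) {\<eta> \<in> characters (AP_alg S). c_map (r_map S \<eta>) \<notin> S})"
    then have \<eta>: "\<eta> \<in> characters (AP_alg S)" "\<eta> (ae_class (\<lambda>z. z)) \<notin> S" unfolding eq by auto
    then have w: "\<eta> (ae_class (\<lambda>z. z)) \<in> circle - S" using AP.char_ident_circle by (auto simp: AP_alg_eq)
    have "R.char_of (\<lambda>f. f (\<eta> (ae_class (\<lambda>z. z)))) = r_map S \<eta>"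
    proof (rule R.character_eqI)
      fix f assume f: "f \<in> first_kind S"
      then have "ae_class f \<in> R_alg S" "f \<in> ap_fun S" using first_kind_subset_ap_fun by (auto simp: R_alg_def)
      then show "R.char_of (\<lambda>f. f (\<eta> (ae_class (\<lambda>z. z)))) (ae_class f) = r_map S \<eta> (ae_class f)"
        using R.eval_apply[OF w f] AP.eval_off[of \<eta> f] \<eta> by (simp add: r_map_def AP_alg_eq)
    qed (use R.eval_character[OF w] restrict_R_alg[OF \<eta>(1)] in \<open>auto simp: R_alg_def\<close>)
    then show "((\<lambda>w. R.char_of (\<lambda>f. f w)) \<circ> (\<lambda>\<phi>. \<phi> (ae_class (\<lambda>z. z)))) \<eta> = r_map S \<eta>" by simp
  qed
qed

end

section \<open>Jump functions and one-sided characters\<close>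

lemma arc_coord_flip: "k \<in> {-1,1} \<Longrightarrow> arc_coord w (- k) z = 2 * pi - arc_coord w k z"
  by (auto simp: arc_coord_def)

lemma arc_coord_tendsto:
  assumes k: "k \<in> {-1,1}"
  shows "((\<lambda>u. arc_coord (cis t0) k (cis (t0 + k * u))) \<longlongrightarrow> 0) (at_right 0)"
    and "((\<lambda>u. arc_coord (cis t0) (- k) (cis (t0 + k * u))) \<longlongrightarrow> 2 * pi) (at_right 0)"
proof -
  have ev: "\<forall>\<^sub>F u in at_right 0. 0 < u \<and> u < 2 * pi"
    unfolding eventually_at_right_field by (intro exI[of _ "2 * pi"]) auto
  have "\<forall>\<^sub>F u in at_right 0. arc_coord (cis t0) k (cis (t0 + k * u)) = u"
    using ev by eventually_elim (simp add: arc_coord_cis[OF k])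
  from tendsto_cong[OF this] show *: "((\<lambda>u. arc_coord (cis t0) k (cis (t0 + k * u))) \<longlongrightarrow> 0) (at_right 0)"
    by (simp add: tendsto_ident_at)
  have "((\<lambda>u. 2 * pi - arc_coord (cis t0) k (cis (t0 + k * u))) \<longlongrightarrow> 2 * pi - 0) (at_right 0)"
    by (intro tendsto_intros *)
  then show "((\<lambda>u. arc_coord (cis t0) (- k) (cis (t0 + k * u))) \<longlongrightarrow> 2 * pi) (at_right 0)"
    by (simp only: arc_coord_flip[OF k] diff_0_right)
qed

lemma continuous_arc_coord:
  assumes "w \<in> circle" "z \<in> circle" "z \<noteq> w"
  shows "continuous (at z within circle) (arc_coord w k)"
proof -
  have "at z within circle = at z within (circle - {w})"
    by (rule at_within_nhd[of z "- {w}"]) (use assms in auto)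
  then show ?thesis
    using continuous_on_arc_coord[OF assms(1), of k] assms by (simp add: continuous_on_eq_continuous_within)
qed

text \<open>A detector of sides: the one-sided limits at \<open>w\<close> are 0 on side
  \<open>k\<close> and 2 pi on the other, so the choice of side \<open>k\<close> becomes the
  vanishing of a character on \<open>jump w k\<close>.\<close>

definition jump :: "complex \<Rightarrow> real \<Rightarrow> complex \<Rightarrow> complex" where
  "jump w k z = of_real (arc_coord w k z)"

lemma jump_flip: "k \<in> {-1,1} \<Longrightarrow> jump w (- k) z = of_real (2 * pi) - jump w k z"
  by (simp only: jump_def arc_coord_flip of_real_diff)

lemma jump_measurable: "jump w k \<in> borel_measurable borel"
  unfolding jump_def[abs_def] by measurable

lemma AE_arc_length_neq:
  assumes "w \<in> circle"
  shows "AE z in arc_length. z \<noteq> w"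
proof (rule AE_arc_length_if_lborel)
  obtain t0 where t0: "w = cis t0" using assms circle_eq_cis by blast
  have "AE u in lborel. \<forall>n::int. - t0 + 1 * u - 2 * pi * of_int n \<noteq> 0"
    by (rule AE_lborel_affine_sign[OF AE_lborel_singleton]) simp
  then show "AE t in lborel. cis t \<noteq> w"
  proof eventually_elim
    case (elim t)
    show ?case
    proof
      assume "cis t = w"
      then have "cis (t - t0) = 1" using t0 by (simp add: cis_divide[symmetric])
      then obtain n :: int where "t - t0 = 2 * pi * of_int n"
        by (auto simp: complex_eq_iff cos_one_2pi_int)
      then show False using elim[rule_format, of n] by simp
    qed
  qed
  have "{z \<in> circle. z \<noteq> w} = circle - {w}" by auto
  then show "{z \<in> circle. z \<noteq> w} \<in> sets arc_length" by (simp add: arc_length_sets_iff)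
qed

lemma ess_bounded_near_sets:
  assumes "f \<in> ess_bounded"
  shows "{z \<in> circle_arc t0 k s. cmod (f z - L) < e} \<in> sets borel"
proof -
  have [measurable]: "f \<in> borel_measurable arc_length" using assms by (simp add: ess_bounded_def)
  have "{z \<in> space arc_length. cmod (f z - L) < e} \<in> sets arc_length" by measurable
  then have "{z \<in> circle. cmod (f z - L) < e} \<in> sets borel"
    unfolding arc_length_sets_iff by simp
  moreover have "{z \<in> circle_arc t0 k s. cmod (f z - L) < e} = {z \<in> circle. cmod (f z - L) < e} \<inter> circle_arc t0 k s"
    by (auto simp: circle_arc_def)
  ultimately show ?thesis by (simp only: circle_arc_sets sets.Int)
qed

context closed_in_circle
begin

lemma jump_first_kind:
  assumes w: "w \<in> S" and k: "k \<in> {-1,1}"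
  shows "jump w k \<in> first_kind S"
proof (rule first_kindI)
  have wc: "w \<in> circle" using w S_circle by auto
  show "jump w k \<in> ess_bounded"
    by (rule ess_boundedI[where B="2 * pi"]) (use arc_coord_bounds in \<open>auto simp: jump_def jump_measurable\<close>)
  show "continuous_on (circle - S) (jump w k)"
    unfolding jump_def[abs_def]
    by (intro continuous_intros continuous_on_subset[OF continuous_on_arc_coord[OF wc]]) (use w in auto)
  fix z k' assume z: "z \<in> S" and k': "k' \<in> {-1,1::real}"
  obtain t0 where t0: "z = cis t0" using z S_circle circle_eq_cis by blast
  have "\<exists>L. ((\<lambda>t. arc_coord w k (cis (t0 + k' * t))) \<longlongrightarrow> L) (at_right 0)"
  proof (cases "z = w")
    case True
    have "k = k' \<or> k = - k'" using k k' by auto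
    then show ?thesis using arc_coord_tendsto[OF k', of t0] True t0 by auto
  next
    case False
    have "z \<in> circle" using z S_circle by auto
    from tendsto_cis_circle[OF continuous_arc_coord[OF wc this False, unfolded t0]] show ?thesis by blast
  qed
  then obtain L where "((\<lambda>t. arc_coord w k (cis (t0 + k' * t))) \<longlongrightarrow> L) (at_right 0)" by blast
  from tendsto_of_real[OF this]
  show "\<exists>L. ((\<lambda>t. jump w k (z * cis (k' * t))) \<longlongrightarrow> L) (at_right 0)"
    unfolding t0 cis_mult jump_def by blast
qed

end

section \<open>How a character over S chooses a side\<close>

context intermediate_alg
begin

lemma jump_mem: "w \<in> S \<Longrightarrow> k \<in> {-1,1} \<Longrightarrow> jump w k \<in> \<A>"
  using jump_first_kind first_kind_subset by blast

lemma char_jump_flip: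
  assumes "\<phi> \<in> characters alg" "w \<in> S" "k \<in> {-1,1}"
  shows "\<phi> (ae_class (jump w (- k))) = of_real (2 * pi) - \<phi> (ae_class (jump w k))"
proof -
  have "jump w (- k) = (\<lambda>z. of_real (2 * pi) + (\<lambda>_. - 1) z * jump w k z)"
    using assms(3) by (auto simp: jump_flip)
  then show ?thesis
    using char_add[OF assms(1) const_mem mult_mem[OF const_mem jump_mem[OF assms(2,3)]], of "of_real (2 * pi)" "- 1"]
      char_mult[OF assms(1) const_mem jump_mem[OF assms(2,3)], of "- 1"] char_const[OF assms(1)]
    by simp
qed

text \<open>The value \<open>x\<close> of the character on \<open>jump w 1\<close> lies in
  \<open>[0, 2 pi]\<close>. On the circle \<open>z\<close> equals \<open>w * cis\<close> of the
  coordinate; if \<open>cis x\<close> were not 1, points with coordinate near \<open>x\<close> would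
  stay away from \<open>w\<close>, against \<open>char_not_AE_far\<close>. So \<open>x\<close> is 0
  or 2 pi, and in the second case \<open>jump w (-1)\<close> is sent to 0.\<close>

lemma char_jump_dichotomy:
  assumes \<phi>: "\<phi> \<in> characters alg" and w: "\<phi> (ae_class (\<lambda>z. z)) = w" "w \<in> S"
  shows "\<exists>k\<in>{-1,1}. \<phi> (ae_class (jump w k)) = 0"
proof -
  have wc: "w \<in> circle" using w S_circle by auto
  define c where "c = \<phi> (ae_class (jump w 1))"
  have J: "jump w 1 \<in> \<A>" using jump_mem[OF w(2)] by simp
  have "c \<in> of_real ` {0..2 * pi}"
    unfolding c_def
  proof (rule char_mem_closed[OF \<phi> J])
    show "closed (complex_of_real ` {0..2 * pi})"
      by (intro compact_imp_closed compact_continuous_image continuous_intros) auto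
    show "AE z in arc_length. jump w 1 z \<in> complex_of_real ` {0..2 * pi}"
      using arc_coord_bounds by (intro AE_I2) (auto simp: jump_def)
  qed
  then obtain x where x: "c = of_real x" "0 \<le> x" "x \<le> 2 * pi" by auto
  have "cis x = 1"
  proof (rule ccontr)
    assume n: "cis x \<noteq> 1"
    define e where "e = dist (cis x) 1 / 2"
    have e: "e > 0" using n by (simp add: e_def)
    have "continuous_on UNIV cis" by (intro continuous_intros)
    then have "isCont cis x" by (simp add: continuous_on_eq_continuous_at)
    then obtain d where d: "d > 0" "\<And>y. dist y x < d \<Longrightarrow> dist (cis y) (cis x) < e"
      using e by (auto simp: continuous_at_eps_delta)
    show False
    proof (rule char_not_AE_far[OF \<phi> J ident_mem, of "min d e"])
      show "AE z in arc_length. \<not> (cmod (jump w 1 z - \<phi> (ae_class (jump w 1))) < min d e \<and>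
        cmod (z - \<phi> (ae_class (\<lambda>z. z))) < min d e)"
      proof (rule AE_I2, rule notI)
        fix z assume "z \<in> space arc_length"
          and *: "cmod (jump w 1 z - \<phi> (ae_class (jump w 1))) < min d e \<and> cmod (z - \<phi> (ae_class (\<lambda>z. z))) < min d e"
        then have z: "z \<in> circle" by simp
        have "cmod (of_real (arc_coord w 1 z - x)) < d"
          using * by (simp add: jump_def c_def[symmetric] x)
        then have 1: "dist (cis (arc_coord w 1 z)) (cis x) < e"
          by (intro d(2)) (simp only: norm_of_real dist_real_def)
        have "z - w = w * (cis (arc_coord w 1 z) - 1)"
          using cis_arc_coord[OF wc z, of 1] by (simp add: algebra_simps)
        then have "cmod (z - w) = dist (cis (arc_coord w 1 z)) 1"
          using wc by (simp add: norm_mult dist_norm)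
        then have "dist (cis (arc_coord w 1 z)) 1 < e" using * w by simp
        with 1 show False
          unfolding e_def by (metis dist_commute dist_triangle_half_r less_irrefl)
      qed
    qed (use d e in auto)
  qed
  then have "cos x = 1" by (simp add: complex_eq_iff)
  then obtain n :: int where n: "x = of_int n * 2 * pi" by (auto simp: cos_one_2pi_int)
  have "0 \<le> n" using x(2) n pi_gt_zero by (simp add: zero_le_mult_iff not_le[symmetric])
  moreover have "n \<le> 1" using x(3) n by (simp add: mult.commute)
  ultimately have "n = 0 \<or> n = 1" by linarith
  then have "c = 0 \<or> c = of_real (2 * pi)" using x(1) n by auto
  then show ?thesis
    using char_jump_flip[OF \<phi> w(2), of 1] by (auto simp: c_def)
qed

text \<open>The set where \<open>jump w k\<close> is close to \<open>0\<close> is a one-sided neighbourhood of \<open>w\<close>.\<close>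

lemma char_one_sided_limit:
  assumes \<phi>: "\<phi> \<in> characters alg" and f: "f \<in> \<A>" and w: "cis t0 \<in> S" and k: "k \<in> {-1,1}"
    and J: "\<phi> (ae_class (jump (cis t0) k)) = 0"
    and L: "((\<lambda>u. f (cis (t0 + k * u))) \<longlongrightarrow> L) essR"
  shows "\<phi> (ae_class f) = L"
proof (rule ccontr)
  let ?w = "cis t0"
  assume n: "\<phi> (ae_class f) \<noteq> L"
  define e where "e = dist (\<phi> (ae_class f)) L / 2"
  have e: "e > 0" using n by (simp add: e_def)
  have "\<forall>\<^sub>F u in essR. cmod (f (cis (t0 + k * u)) - L) < e"
    using tendstoD[OF L e] by (simp add: dist_norm)
  from essR_imp_AE_circle_arc[of "\<lambda>z. cmod (f z - L) < e", OF this k ess_bounded_near_sets[OF ess_bdd[OF f]]]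
  obtain s where s: "s > 0" "AE z in arc_length. z \<in> circle_arc t0 k s \<longrightarrow> cmod (f z - L) < e"
    by blast
  have wc: "?w \<in> circle" by simp
  show False
  \<comment> \<open>One tolerance does two jobs: \<open>s\<close> confines \<open>z\<close> to the
    arc on which \<open>f\<close> is close to \<open>L\<close>, and \<open>e\<close>, half the
    distance from \<open>L\<close> to the supposed value, makes the two estimates for
    \<open>f z\<close> incompatible.\<close>
  proof (rule char_not_AE_far[OF \<phi> jump_mem[OF w k] f, of "min s e"])
    show "AE z in arc_length. \<not> (cmod (jump ?w k z - \<phi> (ae_class (jump ?w k))) < min s e \<and>
        cmod (f z - \<phi> (ae_class f)) < min s e)"
      \<comment> \<open>The base point is discarded because for \<open>k = 1\<close> its coordinate
        is 0, which is below \<open>s\<close> but is no parameter of the open arc.\<close>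
      using s(2) AE_arc_length_neq[OF wc] AE_space[of arc_length]
    proof eventually_elim
      case (elim z)
      show ?case
      proof
        assume *: "cmod (jump ?w k z - \<phi> (ae_class (jump ?w k))) < min s e \<and> cmod (f z - \<phi> (ae_class f)) < min s e"
        have z: "z \<in> circle" using elim by simp
        have "\<bar>arc_coord ?w k z\<bar> < s" using * by (simp add: J jump_def)
        moreover have "0 < arc_coord ?w k z" by (rule arc_coord_strict_bounds[OF wc z elim(2)])
        moreover have "z = cis (t0 + k * arc_coord ?w k z)"
          using cis_arc_coord[OF wc z k] by (simp add: cis_mult)
        ultimately have "z \<in> circle_arc t0 k s" unfolding circle_arc_def by auto
        then have "dist (f z) L < e" using elim(1) by (simp add: dist_norm)
        moreover have "dist (f z) (\<phi> (ae_class f)) < e" using * by (simp add: dist_norm)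
        ultimately show False
          unfolding e_def by (metis dist_commute dist_triangle_half_l less_irrefl)
      qed
    qed
  qed (use s e in auto)
qed

end

section \<open>The two points of R_S over a point of S\<close>

context closed_in_circle
begin

definition side_char :: "complex \<Rightarrow> real \<Rightarrow> circle_Linf \<Rightarrow> complex" where
  "side_char w k = R.char_of (\<lambda>f. Lim (at_right 0) (\<lambda>t. f (w * cis (k * t))))"

text \<open>Both limits are also limits along \<open>essR\<close>, where the two functions agree
  eventually, and \<open>essR\<close> is not the trivial filter.\<close>

lemma side_limit_AE_cong:
  assumes f: "f \<in> first_kind S" and g: "g \<in> first_kind S" and AE: "AE z in arc_length. f z = g z"
    and w: "w \<in> S" and k: "k \<in> {-1,1}"
  shows "Lim (at_right 0) (\<lambda>t. f (w * cis (k * t))) = Lim (at_right 0) (\<lambda>t. g (w * cis (k * t)))"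
proof -
  obtain t0 where t0: "w = cis t0" using w S_circle circle_eq_cis by blast
  obtain L where L: "((\<lambda>t. f (w * cis (k * t))) \<longlongrightarrow> L) (at_right 0)" using first_kind_limit[OF f w k] by blast
  obtain M where M: "((\<lambda>t. g (w * cis (k * t))) \<longlongrightarrow> M) (at_right 0)" using first_kind_limit[OF g w k] by blast
  have "\<forall>\<^sub>F u in essR. f (w * cis (k * u)) = g (w * cis (k * u))"
    using AE_imp_essR[OF AE k, of t0] by (simp add: t0 cis_mult)
  from tendsto_cong[OF this] have "((\<lambda>t. g (w * cis (k * t))) \<longlongrightarrow> L) essR"
    using tendsto_mono[OF essR_le L] by simp
  from tendsto_unique[OF essR_neq_bot this tendsto_mono[OF essR_le M]] have "L = M" .
  then show ?thesis using tendsto_Lim[OF _ L] tendsto_Lim[OF _ M] by simp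
qed

lemma side_char_apply:
  assumes "f \<in> first_kind S" "w \<in> S" "k \<in> {-1,1}" "((\<lambda>t. f (w * cis (k * t))) \<longlongrightarrow> L) (at_right 0)"
  shows "side_char w k (ae_class f) = L"
proof -
  have "side_char w k (ae_class f) = Lim (at_right 0) (\<lambda>t. f (w * cis (k * t)))"
    unfolding side_char_def by (rule R.char_of_ae_class[OF side_limit_AE_cong[OF _ _ _ assms(2,3)] assms(1)])
  also have "\<dots> = L" by (rule tendsto_Lim[OF _ assms(4)]) simp
  finally show ?thesis .
qed

lemma side_char_character:
  assumes w: "w \<in> S" and k: "k \<in> {-1,1}"
  shows "side_char w k \<in> characters (R_alg S)"
  unfolding side_char_def R_alg_def
proof (rule R.char_of_character)
  fix f g assume f: "f \<in> first_kind S" and g: "g \<in> first_kind S"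
  obtain L where L: "((\<lambda>t. f (w * cis (k * t))) \<longlongrightarrow> L) (at_right 0)" using first_kind_limit[OF f w k] by blast
  obtain M where M: "((\<lambda>t. g (w * cis (k * t))) \<longlongrightarrow> M) (at_right 0)" using first_kind_limit[OF g w k] by blast
  show "Lim (at_right 0) (\<lambda>t. f (w * cis (k * t)) + g (w * cis (k * t))) =
    Lim (at_right 0) (\<lambda>t. f (w * cis (k * t))) + Lim (at_right 0) (\<lambda>t. g (w * cis (k * t)))"
    using tendsto_Lim[OF _ L] tendsto_Lim[OF _ M] tendsto_Lim[OF _ tendsto_add[OF L M]] by simp
  show "Lim (at_right 0) (\<lambda>t. f (w * cis (k * t)) * g (w * cis (k * t))) =
    Lim (at_right 0) (\<lambda>t. f (w * cis (k * t))) * Lim (at_right 0) (\<lambda>t. g (w * cis (k * t)))"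
    using tendsto_Lim[OF _ L] tendsto_Lim[OF _ M] tendsto_Lim[OF _ tendsto_mult[OF L M]] by simp
qed (rule side_limit_AE_cong[OF _ _ _ w k], assumption+, simp add: tendsto_Lim)

lemma tendsto_side_char:
  assumes "f \<in> first_kind S" "w \<in> S" "k \<in> {-1,1}"
  shows "((\<lambda>t. f (w * cis (k * t))) \<longlongrightarrow> side_char w k (ae_class f)) (at_right 0)"
proof -
  obtain L where L: "((\<lambda>t. f (w * cis (k * t))) \<longlongrightarrow> L) (at_right 0)"
    using first_kind_limit[OF assms] by blast
  with side_char_apply[OF assms L] show ?thesis by simp
qed

lemma side_char_jump:
  assumes "w \<in> S" "k \<in> {-1,1}"
  shows "side_char w k (ae_class (jump w k)) = 0"
proof (rule side_char_apply[OF jump_first_kind[OF assms] assms])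
  obtain t0 where t0: "w = cis t0" using assms S_circle circle_eq_cis by blast
  show "((\<lambda>t. jump w k (w * cis (k * t))) \<longlongrightarrow> 0) (at_right 0)"
    using tendsto_of_real[OF arc_coord_tendsto(1)[OF assms(2)]] by (simp add: jump_def t0 cis_mult)
qed

lemma side_char_ident:
  assumes "w \<in> S" "k \<in> {-1,1}"
  shows "side_char w k (ae_class (\<lambda>z. z)) = w"
proof (rule side_char_apply[OF R.ident_mem assms])
  have "((\<lambda>t. w * cis (k * t)) \<longlongrightarrow> w * cis (k * 0)) (at_right 0)" by (intro tendsto_intros)
  then show "((\<lambda>t. w * cis (k * t)) \<longlongrightarrow> w) (at_right 0)" by simp
qed

text \<open>A single scalar equation identifies a character of R_S: it fixes the side, and on that
  side every function of the algebra has a limit.\<close>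

lemma side_char_unique:
  assumes \<phi>: "\<phi> \<in> characters (R_alg S)" and w: "w \<in> S" and k: "k \<in> {-1,1}"
    and J: "\<phi> (ae_class (jump w k)) = 0"
  shows "\<phi> = side_char w k"
proof (rule R.character_eqI)
  obtain t0 where t0: "w = cis t0" using w S_circle circle_eq_cis by blast
  show "\<phi> \<in> characters R.alg" "side_char w k \<in> characters R.alg"
    using \<phi> side_char_character[OF w k] by (simp_all add: R_alg_def)
  fix f assume f: "f \<in> first_kind S"
  show "\<phi> (ae_class f) = side_char w k (ae_class f)"
  proof (rule R.char_one_sided_limit[of \<phi> f t0 k])
    show "((\<lambda>u. f (cis (t0 + k * u))) \<longlongrightarrow> side_char w k (ae_class f)) essR"
      using tendsto_mono[OF essR_le tendsto_side_char[OF f w k]] by (simp add: t0 cis_mult)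
  qed (use \<phi> f w k J t0 in \<open>simp_all add: R_alg_def\<close>)
qed

lemma fibre_point:
  assumes "\<phi> \<in> characters (R_alg S)" "\<phi> (ae_class (\<lambda>z. z)) = w" "w \<in> S"
  obtains k where "k \<in> {-1,1}" "\<phi> = side_char w k"
proof -
  obtain k where k: "k \<in> {-1,1}" "\<phi> (ae_class (jump w k)) = 0"
    using R.char_jump_dichotomy[OF assms(1)[unfolded R_alg_def] assms(2,3)] by blast
  show ?thesis by (rule that[OF k(1) side_char_unique[OF assms(1,3) k]])
qed

lemma side_char_jump_flip:
  assumes "w \<in> S" "k \<in> {-1,1}"
  shows "side_char w k (ae_class (jump w (- k))) = of_real (2 * pi)"
  by (simp only: R.char_jump_flip[OF side_char_character[OF assms, unfolded R_alg_def] assms] side_char_jump[OF assms] diff_0_right)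

lemma c_fibre_singleton:
  assumes w: "w \<in> S"
  shows "c_fibre S {w} = {side_char w 1, side_char w (-1)}" "side_char w 1 \<noteq> side_char w (-1)"
proof -
  show "c_fibre S {w} = {side_char w 1, side_char w (-1)}"
    unfolding c_fibre_eq
  proof (intro set_eqI iffI)
    fix \<phi> assume "\<phi> \<in> {\<phi> \<in> characters (R_alg S). \<phi> (ae_class (\<lambda>z. z)) \<in> {w}}"
    then obtain k where "k \<in> {-1,1}" "\<phi> = side_char w k" using fibre_point[OF _ _ w] by blast
    then show "\<phi> \<in> {side_char w 1, side_char w (-1)}" by blast
  qed (use side_char_character[OF w] side_char_ident[OF w] in auto)
  \<comment> \<open>\<open>jump w 1\<close> separates the two, with values 0 and 2 pi.\<close>
  show "side_char w 1 \<noteq> side_char w (-1)"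
    using side_char_jump[OF w, of 1] side_char_jump_flip[OF w, of "-1"] by auto
qed

section \<open>The fibre over \<open>S\<close> is totally disconnected\<close>

lemma closedin_c_fibre: "closedin (max_ideal_space (R_alg S)) (c_fibre S S)"
proof -
  have "closedin (top_of_set circle) S"
    using closed_S S_circle by (simp add: closed_subset)
  from closedin_continuous_map_preimage[OF continuous_map_c_map this]
  show ?thesis by (simp add: c_fibre_def)
qed

lemma compact_space_c_fibre: "compact_space (subtopology (max_ideal_space (R_alg S)) (c_fibre S S))"
  using closedin_compact_space[OF R.compact_space_alg[folded R_alg_def] closedin_c_fibre]
  by (rule compact_space_subtopology)

lemma connectedin_finite_valued:
  assumes C: "connectedin X C" and h: "continuous_map X euclidean h" and K: "finite K" "h ` C \<subseteq> K"
    and x: "x \<in> C" "y \<in> C"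
  shows "h x = (h y :: complex)"
proof -
  have "connected (h ` C)"
    using connectedin_continuous_map_image[OF h C] by simp
  moreover have "finite (h ` C)" using K finite_subset by blast
  ultimately have "h ` C = {} \<or> (\<exists>a. h ` C = {a})" using connected_finite_iff_sing by blast
  then show ?thesis using x by (metis empty_iff image_eqI singletonD)
qed

text \<open>The difference of two jump functions takes two values, and separates the two arcs between the jumps.\<close>

lemma connected_c_image_subsingleton:
  assumes C: "connectedin (max_ideal_space (R_alg S)) C" and CS: "C \<subseteq> c_fibre S S"
    and ab: "\<phi> \<in> C" "\<psi> \<in> C"
  shows "\<phi> (ae_class (\<lambda>z. z)) = \<psi> (ae_class (\<lambda>z. z))"
proof (rule ccontr)
  assume n: "\<phi> (ae_class (\<lambda>z. z)) \<noteq> \<psi> (ae_class (\<lambda>z. z))"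
  define D where "D = (\<lambda>\<phi>. \<phi> (ae_class (\<lambda>z. z))) ` C"
  have "connected D"
    unfolding D_def
    using connectedin_continuous_map_image[OF continuous_map_max_ideal_space_eval[OF ident_R_alg] C] by simp
  moreover have "\<not> (D = {} \<or> (\<exists>a. D = {a}))"
    using n ab unfolding D_def by (metis empty_iff image_eqI singletonD)
  ultimately have inf: "infinite D" using connected_finite_iff_sing by blast
  have DS: "D \<subseteq> S" using CS by (auto simp: D_def c_fibre_eq)
  have char: "\<zeta> \<in> characters R.alg" if "\<zeta> \<in> C" for \<zeta>
    using that CS by (auto simp: c_fibre_eq R_alg_def)
  \<comment> \<open>Four points of \<open>D\<close> are used: the jumps will sit at
    \<open>b1\<close> and \<open>b3\<close>, while \<open>a\<close> and \<open>b2\<close> are test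
    points on the two complementary arcs. The angular coordinate from \<open>a\<close> orders the
    other three.\<close>
  obtain a where a: "a \<in> D" using inf by fastforce
  have ac: "a \<in> circle" using a DS S_circle by auto
  obtain \<tau> where \<tau>: "a = cis \<tau>" using ac circle_eq_cis by blast
  have pt: "z = cis (\<tau> + arc_coord a 1 z)" "0 < arc_coord a 1 z" "arc_coord a 1 z < 2 * pi"
    if "z \<in> D - {a}" for z
  proof -
    have z: "z \<in> circle" "z \<noteq> a" using that DS S_circle by auto
    show "z = cis (\<tau> + arc_coord a 1 z)" using cis_arc_coord[OF ac z(1), of 1] by (simp add: \<tau> cis_mult)
    show "0 < arc_coord a 1 z" "arc_coord a 1 z < 2 * pi" using arc_coord_strict_bounds[OF ac z] by blast+
  qed
  have "inj_on (arc_coord a 1) (D - {a})" by (intro inj_onI) (metis pt(1))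
  then have "infinite (arc_coord a 1 ` (D - {a}))"
    using inf by (simp add: finite_image_iff)
  then obtain B where B: "B \<subseteq> arc_coord a 1 ` (D - {a})" "finite B" "card B = 3"
    using infinite_arbitrarily_large by metis
  have Bne: "B \<noteq> {}" using B(3) by auto
  define t1 t3 where "t1 = Min B" and "t3 = Max B"
  have "B - {t1, t3} \<noteq> {}"
  proof
    assume "B - {t1, t3} = {}"
    then have "card B \<le> card {t1, t3}" by (intro card_mono) auto
    also have "\<dots> \<le> 2" by (simp add: card_insert_if)
    finally show False using B(3) by simp
  qed
  then obtain t2 where t2: "t2 \<in> B" "t2 \<noteq> t1" "t2 \<noteq> t3" by blast
  have t13: "t1 \<in> B" "t3 \<in> B" using Min_in[OF B(2) Bne] Max_in[OF B(2) Bne] by (simp_all add: t1_def t3_def)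
  have ord: "t1 < t2" "t2 < t3"
    using Min_le[OF B(2) t2(1)] Max_ge[OF B(2) t2(1)] t2 unfolding t1_def t3_def by linarith+
  have tD: "cis (\<tau> + t) \<in> D" "0 < t" "t < 2 * pi" if t: "t \<in> B" for t
  proof -
    obtain z where "t = arc_coord a 1 z" "z \<in> D - {a}" using t B(1) by blast
    then show "cis (\<tau> + t) \<in> D" "0 < t" "t < 2 * pi" using pt[of z] by auto
  qed
  note bd = tD(2,3)[OF t13(1)] tD(2,3)[OF t13(2)]
  define b1 b2 b3 where "b1 = cis (\<tau> + t1)" and "b2 = cis (\<tau> + t2)" and "b3 = cis (\<tau> + t3)"
  have bD: "b1 \<in> D" "b2 \<in> D" "b3 \<in> D" using tD(1) t2 t13 by (simp_all add: b1_def b2_def b3_def)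
  have bS: "b1 \<in> S" "b3 \<in> S" and bc: "b1 \<in> circle" "b2 \<in> circle" "b3 \<in> circle" using bD DS S_circle by auto
  \<comment> \<open>Off \<open>b1\<close> and \<open>b3\<close> this function is locally constant:
    it equals \<open>t3 - t1 - 2 pi\<close> on the arc from \<open>b1\<close> to \<open>b3\<close>
    containing \<open>b2\<close>, and \<open>t3 - t1\<close> on the arc containing
    \<open>a\<close>.\<close>
  define F where "F z = jump b1 1 z + - 1 * jump b3 1 z" for z
  have F: "F \<in> first_kind S"
    unfolding F_def[abs_def]
    by (intro R.add_mem R.mult_mem R.const_mem jump_first_kind bS) auto
  have Fv: "F z = of_real (arc_coord b1 1 z - arc_coord b3 1 z)" for z
    by (simp add: F_def jump_def)
  \<comment> \<open>Two branches of the argument differ by a constant modulo 2 pi, and both lie in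
    \<open>[0, 2 pi]\<close>, which leaves these \<open>n\<close>. Connectedness asks only for a
    finite set containing the values.\<close>
  define K where "K = (\<lambda>n::int. complex_of_real (t3 - t1 + 2 * pi * of_int n)) ` {-1,0,1}"
  have FK: "F z \<in> K" if "z \<in> circle" for z
  proof -
    have "b1 * cis (1 * arc_coord b1 1 z) = b3 * cis (1 * arc_coord b3 1 z)"
      by (rule trans[OF cis_arc_coord[OF bc(1) that, symmetric] cis_arc_coord[OF bc(3) that]]) auto
    then have "cis (\<tau> + t1 + arc_coord b1 1 z) = cis (\<tau> + t3 + arc_coord b3 1 z)"
      by (simp add: b1_def b3_def cis_mult)
    then have "cis ((\<tau> + t1 + arc_coord b1 1 z) - (\<tau> + t3 + arc_coord b3 1 z)) = 1"
      by (simp only: cis_divide[symmetric]) (simp add: cis_neq_zero)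
    then have "cos ((\<tau> + t1 + arc_coord b1 1 z) - (\<tau> + t3 + arc_coord b3 1 z)) = 1"
      by (metis cis.sel(1) one_complex.sel(1))
    then obtain n :: int where "(\<tau> + t1 + arc_coord b1 1 z) - (\<tau> + t3 + arc_coord b3 1 z) = of_int n * 2 * pi"
      by (auto simp: cos_one_2pi_int)
    then have n: "arc_coord b1 1 z - arc_coord b3 1 z = t3 - t1 + 2 * pi * of_int n" by (simp add: algebra_simps)
    have "\<bar>arc_coord b1 1 z - arc_coord b3 1 z\<bar> \<le> 2 * pi"
      using arc_coord_bounds[of b1 1 z] arc_coord_bounds[of b3 1 z] by linarith
    then have "2 * pi * of_int n < 2 * pi * 2" "2 * pi * (- 2) < 2 * pi * of_int n"
      using bd ord n by linarith+
    then have "of_int n < (2::real)" "- 2 < (of_int n :: real)"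
      by (simp_all only: mult_less_cancel_left_pos[of "2 * pi"] mult_pos_pos pi_gt_zero zero_less_numeral)
    then have "n \<in> {-1,0,1}" by auto
    then show ?thesis unfolding Fv n K_def by blast
  qed
  have fin: "finite K" by (simp add: K_def)
  have "\<zeta> (ae_class F) \<in> K" if "\<zeta> \<in> C" for \<zeta>
    by (rule R.char_mem_closed[OF char[OF that] F finite_imp_closed[OF fin]]) (use FK in \<open>auto intro: AE_I2\<close>)
  then have const: "\<zeta>1 (ae_class F) = \<zeta>2 (ae_class F)" if "\<zeta>1 \<in> C" "\<zeta>2 \<in> C" for \<zeta>1 \<zeta>2
    using F that
    by (intro connectedin_finite_valued[OF C continuous_map_max_ideal_space_eval fin]) (auto simp: R_alg_def)
  \<comment> \<open>The test points lie in \<open>S\<close>, so a character over them is not an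
    evaluation on the whole algebra; on \<open>F\<close> it is one, because \<open>F\<close> is
    continuous there.\<close>
  have val: "\<zeta> (ae_class F) = F z" if "\<zeta> \<in> C" "\<zeta> (ae_class (\<lambda>z. z)) = z" "z \<in> circle" "z \<noteq> b1" "z \<noteq> b3" for \<zeta> z
  proof (rule R.char_eval_continuous[OF char[OF that(1)] F that(2)])
    show "continuous (at z within circle) F"
      unfolding Fv[abs_def]
      by (intro continuous_intros continuous_arc_coord bc that)
  qed
  have coords: "arc_coord b1 1 a = 2 * pi - t1" "arc_coord b3 1 a = 2 * pi - t3"
    "arc_coord b1 1 b2 = t2 - t1" "arc_coord b3 1 b2 = 2 * pi + t2 - t3"
    using arc_coord_cis[of 1 "2 * pi - t1" "\<tau> + t1"] arc_coord_cis[of 1 "2 * pi - t3" "\<tau> + t3"]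
      arc_coord_cis[of 1 "t2 - t1" "\<tau> + t1"] arc_coord_cis[of 1 "2 * pi + t2 - t3" "\<tau> + t3"] bd ord
    by (simp_all add: b1_def b2_def b3_def \<tau> cis_mult[symmetric] cis_divide[symmetric])
  have zero: "arc_coord z 1 z = 0" if "z \<in> circle" for z
  proof -
    have "z / z = 1" using that by auto
    then show ?thesis by (simp add: arc_coord_def Arg2pi_of_real[of 1, simplified])
  qed
  have neq: "a \<noteq> b1" "a \<noteq> b3" "b2 \<noteq> b1" "b2 \<noteq> b3"
    using coords zero[OF bc(1)] zero[OF bc(3)] bd ord by auto
  obtain \<zeta>a where \<zeta>a: "\<zeta>a \<in> C" "\<zeta>a (ae_class (\<lambda>z. z)) = a" using a by (auto simp: D_def)
  obtain \<zeta>b where \<zeta>b: "\<zeta>b \<in> C" "\<zeta>b (ae_class (\<lambda>z. z)) = b2" using bD(2) by (auto simp: D_def)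
  have "F a = F b2"
    using const[OF \<zeta>a(1) \<zeta>b(1)] val[OF \<zeta>a ac neq(1,2)] val[OF \<zeta>b bc(2) neq(3,4)] by simp
  then show False unfolding Fv coords of_real_eq_iff using pi_gt_zero by linarith
qed

text \<open>A connected set lies over one point by \<open>connected_c_image_subsingleton\<close>,
  hence in a fibre of two points, on which \<open>jump w 1\<close> takes the distinct values 0 and 2
  pi.\<close>

lemma totally_disconnected_c_fibre:
  "totally_disconnected_space (subtopology (max_ideal_space (R_alg S)) (c_fibre S S))"
  unfolding totally_disconnected_space_def
proof (intro allI impI)
  fix C assume "connectedin (subtopology (max_ideal_space (R_alg S)) (c_fibre S S)) C"
  then have C: "connectedin (max_ideal_space (R_alg S)) C" "C \<subseteq> c_fibre S S"
    by (auto simp: connectedin_subtopology)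
  have "\<phi> = \<psi>" if \<phi>: "\<phi> \<in> C" and \<psi>: "\<psi> \<in> C" for \<phi> \<psi>
  proof -
    define w where "w = \<phi> (ae_class (\<lambda>z. z))"
    have w: "\<zeta> (ae_class (\<lambda>z. z)) = w" if "\<zeta> \<in> C" for \<zeta>
      unfolding w_def by (rule connected_c_image_subsingleton[OF C that \<phi>])
    have wS: "w \<in> S" using w[OF \<phi>] \<phi> C(2) by (auto simp: c_fibre_eq)
    have side: "\<exists>k\<in>{-1,1}. \<zeta> = side_char w k" if "\<zeta> \<in> C" for \<zeta>
    proof -
      have "\<zeta> \<in> characters (R_alg S)" using that C(2) by (auto simp: c_fibre_eq)
      from fibre_point[OF this w[OF that] wS] show ?thesis by blast
    qed
    have "\<phi> (ae_class (jump w 1)) = \<psi> (ae_class (jump w 1))"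
    proof (rule connectedin_finite_valued[OF C(1) continuous_map_max_ideal_space_eval _ _ \<phi> \<psi>])
      show "ae_class (jump w 1) \<in> R_alg S" using jump_first_kind[OF wS, of 1] by (simp add: R_alg_def)
      show "(\<lambda>\<phi>. \<phi> (ae_class (jump w 1))) ` C \<subseteq> {0, of_real (2 * pi)}"
        using side side_char_jump[OF wS, of 1] side_char_jump_flip[OF wS, of "-1"] by fastforce
    qed auto
    then show ?thesis
      using side[OF \<phi>] side[OF \<psi>] side_char_jump[OF wS, of 1] side_char_jump_flip[OF wS, of "-1"] by auto
  qed
  then show "\<exists>a. C \<subseteq> {a}" by blast
qed

end

section \<open>The fibres of \<open>r\<^sub>S\<close>\<close>

lemma ap_germ_base_cong:
  assumes "cis t0 = cis t1"
  shows "ap_germ t0 k f g \<longleftrightarrow> ap_germ t1 k f g"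
  using assms by (simp add: ap_germ_def cis_mult[symmetric])

lemma character_bohr_const:
  assumes "\<psi> \<in> characters {f. almost_periodic f}"
  shows "\<psi> (\<lambda>_. c) = c"
proof -
  have 1: "(1 :: real \<Rightarrow> complex) \<in> {f. almost_periodic f}"
    using almost_periodic_const[of 1] by (simp add: one_fun_def)
  have "\<psi> (scaleC c 1) = c * \<psi> 1" using assms 1 unfolding characters_def by blast
  moreover have "scaleC c 1 = (\<lambda>_::real. c)" by (simp add: scaleC_fun_def scaleC_complex_def)
  ultimately show ?thesis using character_one[OF assms 1] by simp
qed

definition germ_at :: "real \<Rightarrow> real \<Rightarrow> (complex \<Rightarrow> complex) \<Rightarrow> real \<Rightarrow> complex" where
  "germ_at t0 k f = (THE g. ap_germ t0 k f g)"

lemma germ_at_eq: "ap_germ t0 k f g \<Longrightarrow> germ_at t0 k f = g"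
  unfolding germ_at_def by (rule the_equality) (auto intro: ap_germ_unique)

text \<open>A linear right inverse of the germ map on side \<open>k\<close>: the first factor tends
  to 1 on that side and to 0 on the other, where the section gets germ 0.\<close>

definition germ_section :: "real \<Rightarrow> real \<Rightarrow> (real \<Rightarrow> complex) \<Rightarrow> complex \<Rightarrow> complex" where
  "germ_section t0 k g z = (1 - jump (cis t0) k z / of_real (2 * pi)) * arc_lift (cis t0) k g z"

text \<open>At distance \<open>u\<close> from the base point the deviation from
  \<open>g (ln u)\<close> is \<open>- u / (2 pi)\<close> times \<open>g (ln u)\<close> on side
  \<open>k\<close>; on the other side the section is \<open>u / (2 pi)\<close> times
  \<open>g (ln (2 pi - u))\<close>. Both tend to 0 because \<open>g\<close> is bounded.\<close>

lemma ap_germ_germ_section: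
  assumes g: "almost_periodic g" and k: "k \<in> {-1,1}"
  shows "ap_germ t0 k (germ_section t0 k g) g" and "ap_germ t0 (- k) (germ_section t0 k g) (\<lambda>_. 0)"
proof -
  have ev: "\<forall>\<^sub>F u in essR. 0 < u \<and> u < 2 * pi"
    unfolding eventually_essR by (intro exI[of _ "2 * pi"]) auto
  have u0: "((\<lambda>u::real. u) \<longlongrightarrow> 0) essR"
    by (rule tendsto_mono[OF essR_le tendsto_ident_at])
  have "((\<lambda>u. - (complex_of_real u / of_real (2 * pi))) \<longlongrightarrow> - (of_real 0 / of_real (2 * pi))) essR"
    by (intro tendsto_intros u0) auto
  then have d: "((\<lambda>u. - (complex_of_real u / of_real (2 * pi))) \<longlongrightarrow> 0) essR" by simp
  have "((\<lambda>u. - (complex_of_real u / of_real (2 * pi)) * g (ln u)) \<longlongrightarrow> 0) essR"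
    by (rule tendsto_mult_ap_0[OF d g])
  moreover have "\<forall>\<^sub>F u in essR. - (complex_of_real u / of_real (2 * pi)) * g (ln u) =
      germ_section t0 k g (cis (t0 + k * u)) - g (ln u)"
    using ev
  proof eventually_elim
    case (elim u)
    then show ?case
      using k by (simp add: germ_section_def jump_def arc_coord_cis arc_lift_cis left_diff_distrib)
  qed
  ultimately have "((\<lambda>u. germ_section t0 k g (cis (t0 + k * u)) - g (ln u)) \<longlongrightarrow> 0) essR"
    by (rule Lim_transform_eventually)
  then show "ap_germ t0 k (germ_section t0 k g) g" using g by (simp add: ap_germ_def)
  have "((\<lambda>u. - (- (complex_of_real u / of_real (2 * pi)) * g (ln (2 * pi - u)))) \<longlongrightarrow> - 0) essR"
    by (intro tendsto_minus tendsto_mult_ap_0[OF d g])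
  moreover have "\<forall>\<^sub>F u in essR. - (- (complex_of_real u / of_real (2 * pi)) * g (ln (2 * pi - u))) =
      germ_section t0 k g (cis (t0 + - k * u)) - 0"
    using ev
  proof eventually_elim
    case (elim u)
    have mk: "- k \<in> {-1,1}" using k by auto
    have "arc_coord (cis t0) k (cis (t0 + - k * u)) = 2 * pi - u"
      using arc_coord_flip[OF mk, of "cis t0" "cis (t0 + - k * u)"] arc_coord_cis[OF mk, of u t0] elim by simp
    then show ?case
      by (simp add: germ_section_def jump_def arc_lift_def diff_divide_distrib)
  qed
  ultimately have "((\<lambda>u. germ_section t0 k g (cis (t0 + - k * u)) - 0) \<longlongrightarrow> - 0) essR"
    by (rule Lim_transform_eventually)
  then show "ap_germ t0 (- k) (germ_section t0 k g) (\<lambda>_. 0)" by (simp add: ap_germ_def almost_periodic_const)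
qed

lemma ap_germ_jump: "k \<in> {-1,1} \<Longrightarrow> ap_germ t0 k (jump (cis t0) k) (\<lambda>_. 0)"
  using ap_germ_tendsto[OF tendsto_of_real[OF arc_coord_tendsto(1)]] by (simp add: jump_def[abs_def])

context closed_in_circle
begin

lemma ap_germ_germ_at:
  assumes "f \<in> ap_fun S" "k \<in> {-1,1}"
  shows "ap_germ t0 k f (germ_at t0 k f)"
proof -
  obtain g where "ap_germ t0 k f g" using assms unfolding ap_fun_def by blast
  with germ_at_eq[OF this] show ?thesis by simp
qed

text \<open>The section is continuous away from \<open>cis t0\<close>, so its germs at all other
  points, including those of \<open>S\<close>, are constants.\<close>

lemma germ_section_ap_fun:
  assumes g: "almost_periodic g" and k: "k \<in> {-1,1}" and w: "cis t0 \<in> S"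
  shows "germ_section t0 k g \<in> ap_fun S"
proof -
  have wc: "cis t0 \<in> circle" by simp
  have gc: "continuous_on UNIV g" by (rule almost_periodic_continuous[OF g])
  have cont: "continuous_on (circle - {cis t0}) (germ_section t0 k g)"
    unfolding germ_section_def[abs_def] jump_def
    by (intro continuous_intros continuous_on_arc_coord continuous_on_arc_lift wc gc) auto
  have [measurable]: "jump (cis t0) k \<in> borel_measurable borel" "arc_lift (cis t0) k g \<in> borel_measurable borel"
    by (intro jump_measurable arc_lift_measurable gc)+
  obtain B where B: "B > 0" "\<And>t. cmod (g t) \<le> B" using almost_periodic_bounded[OF g] by blast
  have "germ_section t0 k g \<in> ess_bounded"
  proof (rule ess_boundedI)
    show "germ_section t0 k g \<in> borel_measurable borel"
      unfolding germ_section_def[abs_def] by measurable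
    fix z
    have "1 - jump (cis t0) k z / of_real (2 * pi) = of_real (1 - arc_coord (cis t0) k z / (2 * pi))"
      by (simp add: jump_def)
    moreover have "0 \<le> arc_coord (cis t0) k z / (2 * pi)" "arc_coord (cis t0) k z / (2 * pi) \<le> 1"
      using arc_coord_bounds[of "cis t0" k z] by simp_all
    ultimately have "cmod (1 - jump (cis t0) k z / of_real (2 * pi)) \<le> 1"
      by (simp only: norm_of_real)
    then show "cmod (germ_section t0 k g z) \<le> 1 * B"
      unfolding germ_section_def norm_mult arc_lift_def by (intro mult_mono B(2)) auto
  qed
  moreover have "\<exists>h. ap_germ t1 k' (germ_section t0 k g) h" if k': "k' \<in> {-1,1}" for t1 k'
  proof (cases "cis t1 = cis t0")
    case True
    have "k' = k \<or> k' = - k" using k k' by auto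
    then show ?thesis using ap_germ_germ_section[OF g k, of t0] ap_germ_base_cong[OF True] by blast
  next
    case False
    then have "continuous (at (cis t1) within circle) (germ_section t0 k g)"
      by (intro continuous_within_circle[OF _ cont]) auto
    from ap_germ_tendsto[OF tendsto_cis_circle[OF this]] show ?thesis by blast
  qed
  moreover have "continuous_on (circle - S) (germ_section t0 k g)"
    by (rule continuous_on_subset[OF cont]) (use w in auto)
  ultimately show ?thesis by (simp add: ap_fun_def)
qed

text \<open>The difference has germ 0, that is it tends to 0 on the side chosen by
  \<open>\<eta>\<close>, so \<open>char_one_sided_limit\<close> annihilates it. In this sense the
  character factors through the germ.\<close>

lemma char_eq_if_same_germ:
  assumes \<eta>: "\<eta> \<in> characters AP.alg" and w: "cis t0 \<in> S" and k: "k \<in> {-1,1}"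
    and J: "\<eta> (ae_class (jump (cis t0) k)) = 0"
    and f: "f1 \<in> ap_fun S" "f2 \<in> ap_fun S" and g: "ap_germ t0 k f1 g" "ap_germ t0 k f2 g"
  shows "\<eta> (ae_class f1) = \<eta> (ae_class f2)"
proof -
  have d: "(\<lambda>z. f1 z + - 1 * f2 z) \<in> ap_fun S" "(\<lambda>z. - 1 * f2 z) \<in> ap_fun S"
    by (intro AP.add_mem AP.mult_mem AP.const_mem f)+
  have "((\<lambda>u. (f1 (cis (t0 + k * u)) - g (ln u)) - (f2 (cis (t0 + k * u)) - g (ln u))) \<longlongrightarrow> 0 - 0) essR"
    using g by (intro tendsto_diff) (auto simp: ap_germ_def)
  then have "((\<lambda>u. f1 (cis (t0 + k * u)) + - 1 * f2 (cis (t0 + k * u))) \<longlongrightarrow> 0) essR" by simp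
  from AP.char_one_sided_limit[OF \<eta> d(1) w k J this]
  have "\<eta> (ae_class f1) + \<eta> (ae_class (\<lambda>z. - 1 * f2 z)) = 0"
    using AP.char_add[OF \<eta> f(1) d(2)] by simp
  then show ?thesis
    using AP.char_mult[OF \<eta> AP.const_mem f(2), of "- 1"] AP.char_const[OF \<eta>, of "- 1"] by simp
qed

definition germ_char :: "real \<Rightarrow> real \<Rightarrow> ((real \<Rightarrow> complex) \<Rightarrow> complex) \<Rightarrow> circle_Linf \<Rightarrow> complex" where
  "germ_char t0 k \<psi> = AP.char_of (\<lambda>f. \<psi> (germ_at t0 k f))"

lemma germ_at_AE_cong:
  assumes "f1 \<in> ap_fun S" "AE z in arc_length. f1 z = f2 z" "k \<in> {-1,1}"
  shows "germ_at t0 k f1 = germ_at t0 k f2"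
  using germ_at_eq[OF ap_germ_AE_cong[OF ap_germ_germ_at[OF assms(1,3)] assms(2,3)]] by (rule sym)

lemma germ_char_apply:
  assumes "k \<in> {-1,1}" "f \<in> ap_fun S"
  shows "germ_char t0 k \<psi> (ae_class f) = \<psi> (germ_at t0 k f)"
  unfolding germ_char_def
  by (rule AP.char_of_ae_class[OF arg_cong[where f=\<psi>, OF germ_at_AE_cong[OF _ _ assms(1)]] assms(2)])

text \<open>Uniqueness of germs makes the germ map an algebra homomorphism, along which
  \<open>\<psi>\<close> is pulled back.\<close>

lemma germ_char_character:
  assumes \<psi>: "\<psi> \<in> characters {f. almost_periodic f}" and k: "k \<in> {-1,1}"
  shows "germ_char t0 k \<psi> \<in> characters (AP_alg S)"
  unfolding germ_char_def AP_alg_eq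
proof (rule AP.char_of_character)
  fix f1 f2 assume f: "f1 \<in> ap_fun S" "f2 \<in> ap_fun S"
  note g1 = ap_germ_germ_at[OF f(1) k, of t0] and g2 = ap_germ_germ_at[OF f(2) k, of t0]
  have ap: "germ_at t0 k f1 \<in> {f. almost_periodic f}" "germ_at t0 k f2 \<in> {f. almost_periodic f}"
    using g1 g2 by (simp_all add: ap_germ_def)
  have "germ_at t0 k (\<lambda>z. f1 z + f2 z) = germ_at t0 k f1 + germ_at t0 k f2"
    using germ_at_eq[OF ap_germ_add[OF g1 g2]] by (simp add: plus_fun_def)
  then show "\<psi> (germ_at t0 k (\<lambda>z. f1 z + f2 z)) = \<psi> (germ_at t0 k f1) + \<psi> (germ_at t0 k f2)"
    using \<psi> ap unfolding characters_def by simp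
  have "germ_at t0 k (\<lambda>z. f1 z * f2 z) = germ_at t0 k f1 * germ_at t0 k f2"
    using germ_at_eq[OF ap_germ_mult[OF g1 g2]] by (simp add: times_fun_def)
  then show "\<psi> (germ_at t0 k (\<lambda>z. f1 z * f2 z)) = \<psi> (germ_at t0 k f1) * \<psi> (germ_at t0 k f2)"
    using \<psi> ap unfolding characters_def by simp
next
  fix c show "\<psi> (germ_at t0 k (\<lambda>_. c)) = c"
    by (simp only: germ_at_eq[OF ap_germ_const] character_bohr_const[OF \<psi>])
qed (rule arg_cong[where f=\<psi>, OF germ_at_AE_cong[OF _ _ k]])

lemma germ_char_jump:
  assumes \<psi>: "\<psi> \<in> characters {f. almost_periodic f}" and k: "k \<in> {-1,1}" and w: "cis t0 \<in> S"
  shows "germ_char t0 k \<psi> (ae_class (jump (cis t0) k)) = 0"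
  using germ_char_apply[OF k AP.jump_mem[OF w k]] germ_at_eq[OF ap_germ_jump[OF k]]
    character_bohr_const[OF \<psi>] by simp

text \<open>Describes a fibre of r_S by one scalar equation, since a character of R_S is already
  determined by its vanishing on the jump.\<close>

lemma fibre_iff_jump:
  assumes \<eta>: "\<eta> \<in> characters (AP_alg S)" and w: "w \<in> S" and k: "k \<in> {-1,1}"
  shows "r_map S \<eta> = side_char w k \<longleftrightarrow> \<eta> (ae_class (jump w k)) = 0"
proof -
  have "ae_class (jump w k) \<in> R_alg S" using jump_first_kind[OF w k] by (simp add: R_alg_def)
  then have "r_map S \<eta> (ae_class (jump w k)) = \<eta> (ae_class (jump w k))" by (simp add: r_map_def)
  then show ?thesis
    using side_char_unique[OF restrict_R_alg[OF \<eta>] w k] side_char_jump[OF w k] by metis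
qed

text \<open>\<open>germ_section\<close> is not multiplicative, but the section of a product and the
  product of the sections have the same germ, so \<open>\<eta>\<close> cannot tell them apart. The
  same comparison handles sums, scalars and the unit.\<close>

lemma germ_section_character:
  assumes \<eta>: "\<eta> \<in> characters (AP_alg S)" and w: "cis t0 \<in> S" and k: "k \<in> {-1,1}"
    and J: "\<eta> (ae_class (jump (cis t0) k)) = 0"
  shows "(\<lambda>g\<in>{f. almost_periodic f}. \<eta> (ae_class (germ_section t0 k g))) \<in> characters {f. almost_periodic f}"
    (is "?\<psi> \<in> _")
proof -
  have \<eta>': "\<eta> \<in> characters AP.alg" using \<eta> by (simp add: AP_alg_eq)
  note mem = germ_section_ap_fun[OF _ k w] and germ = ap_germ_germ_section(1)[OF _ k, of _ t0]
  note same = char_eq_if_same_germ[OF \<eta>' w k J]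
  have add: "almost_periodic (x + y)" and mult: "almost_periodic (x * y)" and scale: "almost_periodic (scaleC c x)"
    if "almost_periodic x" "almost_periodic y" for x y c
    using almost_periodic_add[OF that] almost_periodic_mult[OF that] almost_periodic_mult[OF almost_periodic_const that(1), of c]
    by (simp_all add: plus_fun_def times_fun_def scaleC_fun_def scaleC_complex_def)
  have "?\<psi> (x + y) = ?\<psi> x + ?\<psi> y" if x: "almost_periodic x" and y: "almost_periodic y" for x y
  proof -
    have "\<eta> (ae_class (germ_section t0 k (x + y))) = \<eta> (ae_class (\<lambda>z. germ_section t0 k x z + germ_section t0 k y z))"
      by (rule same[OF mem[OF add[OF x y]] AP.add_mem[OF mem[OF x] mem[OF y]] germ[OF add[OF x y]]])
         (use ap_germ_add[OF germ[OF x] germ[OF y]] in \<open>simp add: plus_fun_def\<close>)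
    then show ?thesis using AP.char_add[OF \<eta>' mem[OF x] mem[OF y]] x y add by simp
  qed
  moreover have "?\<psi> (x * y) = ?\<psi> x * ?\<psi> y" if x: "almost_periodic x" and y: "almost_periodic y" for x y
  proof -
    have "\<eta> (ae_class (germ_section t0 k (x * y))) = \<eta> (ae_class (\<lambda>z. germ_section t0 k x z * germ_section t0 k y z))"
      by (rule same[OF mem[OF mult[OF x y]] AP.mult_mem[OF mem[OF x] mem[OF y]] germ[OF mult[OF x y]]])
         (use ap_germ_mult[OF germ[OF x] germ[OF y]] in \<open>simp add: times_fun_def\<close>)
    then show ?thesis using AP.char_mult[OF \<eta>' mem[OF x] mem[OF y]] x y mult by simp
  qed
  moreover have "?\<psi> (scaleC c x) = c * ?\<psi> x" if x: "almost_periodic x" for x c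
  proof -
    have "\<eta> (ae_class (germ_section t0 k (scaleC c x))) = \<eta> (ae_class (\<lambda>z. c * germ_section t0 k x z))"
      by (rule same[OF mem[OF scale[OF x x]] AP.mult_mem[OF AP.const_mem mem[OF x]] germ[OF scale[OF x x]]])
         (use ap_germ_mult[OF ap_germ_const germ[OF x], of c] in \<open>simp add: scaleC_fun_def scaleC_complex_def\<close>)
    then show ?thesis
      using AP.char_mult[OF \<eta>' AP.const_mem mem[OF x], of c] AP.char_const[OF \<eta>'] x scale by simp
  qed
  moreover have "?\<psi> (\<lambda>_. 1) \<noteq> 0"
  proof -
    have "\<eta> (ae_class (germ_section t0 k (\<lambda>_. 1))) = \<eta> (ae_class (\<lambda>_. 1))"
      by (rule same[OF mem AP.const_mem germ ap_germ_const]) (rule almost_periodic_const)+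
    then show ?thesis using AP.char_const[OF \<eta>', of 1] by (simp add: almost_periodic_const)
  qed
  then have "\<exists>x\<in>{f. almost_periodic f}. ?\<psi> x \<noteq> 0" using almost_periodic_const by blast
  ultimately show ?thesis by (simp add: characters_def del: restrict_apply restrict_apply')
qed

text \<open>The two maps compose characters with the section and with the germ map. The germ of a
  section is the given function, which settles one composite; the section of a germ differs from the
  function by something of germ 0, which settles the other by \<open>char_eq_if_same_germ\<close>.
  Both maps are continuous because each of their coordinates is an evaluation.\<close>

lemma fibre_homeomorphic_bohr:
  assumes \<xi>: "\<xi> \<in> c_fibre S S"
  shows "subtopology (max_ideal_space (AP_alg S)) {\<eta> \<in> characters (AP_alg S). r_map S \<eta> = \<xi>}
         homeomorphic_space bohr_compactification"
proof -
  let ?B = "{f. almost_periodic f}"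
  obtain w where w: "\<xi> \<in> characters (R_alg S)" "\<xi> (ae_class (\<lambda>z. z)) = w" "w \<in> S"
    using \<xi> by (auto simp: c_fibre_eq)
  obtain k where k: "k \<in> {-1,1}" and \<xi>k: "\<xi> = side_char w k" using fibre_point[OF w] by blast
  obtain t0 where t0: "w = cis t0" using w(3) S_circle circle_eq_cis by blast
  have wS: "cis t0 \<in> S" using w(3) t0 by simp
  define E where "E = {\<eta> \<in> characters (AP_alg S). \<eta> (ae_class (jump (cis t0) k)) = 0}"
  have E: "{\<eta> \<in> characters (AP_alg S). r_map S \<eta> = \<xi>} = E"
    unfolding E_def \<xi>k using fibre_iff_jump[OF _ w(3) k] t0 by blast
  define \<Phi> where "\<Phi> \<eta> = (\<lambda>g\<in>?B. \<eta> (ae_class (germ_section t0 k g)))" for \<eta> :: "circle_Linf \<Rightarrow> complex"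
  have mem: "ae_class (germ_section t0 k g) \<in> AP_alg S" if "almost_periodic g" for g
    using germ_section_ap_fun[OF that k wS] by (simp add: AP_alg_eq)
  have "homeomorphic_maps (subtopology (max_ideal_space (AP_alg S)) E) (max_ideal_space ?B) \<Phi> (germ_char t0 k)"
    unfolding homeomorphic_maps_def
  proof (intro conjI ballI)
    show "continuous_map (subtopology (max_ideal_space (AP_alg S)) E) (max_ideal_space ?B) \<Phi>"
    proof (rule continuous_map_into_max_ideal_space)
      fix \<eta> assume "\<eta> \<in> topspace (subtopology (max_ideal_space (AP_alg S)) E)"
      then show "\<Phi> \<eta> \<in> characters ?B"
        unfolding \<Phi>_def by (intro germ_section_character[OF _ wS k]) (auto simp: E_def)
    next
      fix g assume "g \<in> ?B"
      then show "continuous_map (subtopology (max_ideal_space (AP_alg S)) E) euclidean (\<lambda>\<eta>. \<Phi> \<eta> g)"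
        by (auto simp: \<Phi>_def intro!: continuous_map_from_subtopology continuous_map_max_ideal_space_eval mem)
    qed
    have "continuous_map (max_ideal_space ?B) (max_ideal_space (AP_alg S)) (germ_char t0 k)"
    proof (rule continuous_map_into_max_ideal_space)
      fix F assume "F \<in> AP_alg S"
      then obtain f where f: "F = ae_class f" "f \<in> ap_fun S" by (auto simp: AP_alg_eq)
      have "germ_at t0 k f \<in> ?B" using ap_germ_germ_at[OF f(2) k, of t0] by (simp add: ap_germ_def)
      then show "continuous_map (max_ideal_space ?B) euclidean (\<lambda>\<psi>. germ_char t0 k \<psi> F)"
        unfolding f(1) germ_char_apply[OF k f(2)] by (rule continuous_map_max_ideal_space_eval)
    qed (use germ_char_character k in auto)
    then show "continuous_map (max_ideal_space ?B) (subtopology (max_ideal_space (AP_alg S)) E) (germ_char t0 k)"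
      using germ_char_character[OF _ k] germ_char_jump[OF _ k wS] by (auto simp: continuous_map_in_subtopology E_def)
  next
    fix \<eta> assume "\<eta> \<in> topspace (subtopology (max_ideal_space (AP_alg S)) E)"
    then have \<eta>: "\<eta> \<in> characters (AP_alg S)" "\<eta> (ae_class (jump (cis t0) k)) = 0" by (auto simp: E_def)
    have \<Phi>: "\<Phi> \<eta> \<in> characters ?B" unfolding \<Phi>_def by (rule germ_section_character[OF \<eta>(1) wS k \<eta>(2)])
    show "germ_char t0 k (\<Phi> \<eta>) = \<eta>"
    proof (rule AP.character_eqI)
      show "germ_char t0 k (\<Phi> \<eta>) \<in> characters AP.alg" "\<eta> \<in> characters AP.alg"
        using germ_char_character[OF \<Phi> k] \<eta>(1) by (simp_all add: AP_alg_eq)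
      fix f assume f: "f \<in> ap_fun S"
      have g: "ap_germ t0 k f (germ_at t0 k f)" by (rule ap_germ_germ_at[OF f k])
      then have ap: "almost_periodic (germ_at t0 k f)" by (simp add: ap_germ_def)
      have "\<eta> (ae_class (germ_section t0 k (germ_at t0 k f))) = \<eta> (ae_class f)"
        by (rule char_eq_if_same_germ[OF \<eta>(1)[unfolded AP_alg_eq] wS k \<eta>(2) germ_section_ap_fun[OF ap k wS] f
              ap_germ_germ_section(1)[OF ap k] g])
      then show "germ_char t0 k (\<Phi> \<eta>) (ae_class f) = \<eta> (ae_class f)"
        unfolding germ_char_apply[OF k f] using ap by (simp add: \<Phi>_def)
    qed
  next
    fix \<psi> assume "\<psi> \<in> topspace (max_ideal_space ?B)"
    then have \<psi>: "\<psi> \<in> characters ?B" by simp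
    show "\<Phi> (germ_char t0 k \<psi>) = \<psi>"
    proof (rule extensionalityI[of _ ?B])
      show "\<psi> \<in> extensional ?B" by (rule character_extensional[OF \<psi>])
      fix g assume "g \<in> ?B"
      then have g: "almost_periodic g" by simp
      show "\<Phi> (germ_char t0 k \<psi>) g = \<psi> g"
        using g germ_char_apply[OF k germ_section_ap_fun[OF g k wS]] germ_at_eq[OF ap_germ_germ_section(1)[OF g k]]
        by (simp add: \<Phi>_def)
    qed (simp add: \<Phi>_def)
  qed
  then show ?thesis unfolding E bohr_compactification_def homeomorphic_space_def by blast
qed

text \<open>Supplies one point of the Bohr compactification, from which \<open>r_map_image\<close>
  builds a preimage of every one-sided character.\<close>

lemma eval_zero_character: "(\<lambda>g\<in>{f. almost_periodic f}. g 0) \<in> characters {f. almost_periodic f}"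
proof -
  have "(\<lambda>_. 1) \<in> {f. almost_periodic f}" "(\<lambda>g\<in>{f. almost_periodic f}. g 0) (\<lambda>_. 1) \<noteq> (0::complex)"
    by (simp_all add: almost_periodic_const)
  then have "\<exists>x\<in>{f. almost_periodic f}. (\<lambda>g\<in>{f. almost_periodic f}. g 0) x \<noteq> (0::complex)" by blast
  moreover have "almost_periodic (f + g)" "almost_periodic (f * g)" "almost_periodic (scaleC c f)"
    if "almost_periodic f" "almost_periodic g" for f g c
    using almost_periodic_add[OF that] almost_periodic_mult[OF that]
      almost_periodic_mult[OF almost_periodic_const that(1), of c]
    by (simp_all add: plus_fun_def times_fun_def scaleC_fun_def scaleC_complex_def)
  ultimately show ?thesis
    unfolding characters_def
    by (intro CollectI conjI ballI allI) (assumption | simp add: scaleC_fun_def scaleC_complex_def)+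
qed

text \<open>Over \<open>S\<close> a preimage is the pullback of a character of the almost periodic
  functions along the germ on the right side; off \<open>S\<close> surjectivity is part of the
  homeomorphism already obtained.\<close>

lemma r_map_image: "r_map S ` characters (AP_alg S) = characters (R_alg S)"
proof (intro set_eqI iffI)
  fix \<xi> assume \<xi>: "\<xi> \<in> characters (R_alg S)"
  define w where "w = \<xi> (ae_class (\<lambda>z. z))"
  show "\<xi> \<in> r_map S ` characters (AP_alg S)"
  proof (cases "w \<in> S")
    case True
    obtain k where k: "k \<in> {-1,1}" "\<xi> = side_char w k" using fibre_point[OF \<xi> w_def[symmetric] True] by blast
    obtain t0 where t0: "w = cis t0" using True S_circle circle_eq_cis by blast
    have \<eta>: "germ_char t0 k (\<lambda>g\<in>{f. almost_periodic f}. g 0) \<in> characters (AP_alg S)"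
      by (rule germ_char_character[OF eval_zero_character k(1)])
    have "r_map S (germ_char t0 k (\<lambda>g\<in>{f. almost_periodic f}. g 0)) = side_char w k"
      by (rule fibre_iff_jump[OF \<eta> True k(1), THEN iffD2])
         (use germ_char_jump[OF eval_zero_character k(1), of t0] True t0 in simp)
    then show ?thesis using \<eta> k(2) by (metis image_eqI)
  next
    case False
    then have "\<xi> \<in> topspace (subtopology (max_ideal_space (R_alg S)) (characters (R_alg S) - c_fibre S S))"
      using \<xi> by (auto simp: c_fibre_eq w_def)
    then have "\<xi> \<in> r_map S ` topspace (subtopology (max_ideal_space (AP_alg S)) {\<eta> \<in> characters (AP_alg S). c_map (r_map S \<eta>) \<notin> S})"
      using homeomorphic_imp_surjective_map[OF homeomorphic_map_r_map_off] by simp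
    then show ?thesis by auto
  qed
qed (use restrict_R_alg in auto)

lemma c_map_image: "c_map ` characters (R_alg S) = circle"
proof (intro set_eqI iffI)
  fix w assume w: "w \<in> circle"
  show "w \<in> c_map ` characters (R_alg S)"
  proof (cases "w \<in> S")
    case True
    then show ?thesis
      using side_char_character[OF True, of 1] side_char_ident[OF True, of 1]
      by (intro image_eqI[of _ _ "side_char w 1"]) (simp_all add: c_map_eq)
  next
    case False
    then have "w \<in> circle - S" using w by blast
    from R.eval_character[OF this] R.eval_apply[OF this R.ident_mem] show ?thesis
      by (intro image_eqI[of _ _ "R.char_of (\<lambda>f. f w)"]) (simp_all add: c_map_eq R_alg_def)
  qed
next
  fix w assume "w \<in> c_map ` characters (R_alg S)"
  then show "w \<in> circle" using R.char_ident_circle[folded R_alg_def] by (auto simp: c_map_eq)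
qed

end

theorem theorem1p6:
  fixes S :: "complex set"
  assumes "closed S" and "S \<subseteq> circle" and "S \<noteq> {}"
  shows
    "(C_circle \<subseteq> R_alg S \<and> R_alg S \<subseteq> AP_alg S \<and>
      homeomorphic_map (top_of_set circle) (max_ideal_space C_circle) point_eval \<and>
      continuous_map (max_ideal_space (AP_alg S)) (max_ideal_space (R_alg S)) (r_map S) \<and>
      r_map S ` characters (AP_alg S) = characters (R_alg S) \<and>
      continuous_map (max_ideal_space (R_alg S)) (top_of_set circle) c_map \<and>
      c_map ` characters (R_alg S) = circle) \<and>
     (\<forall>z\<in>S. \<exists>z_plus z_minus. c_fibre S {z} = {z_plus, z_minus} \<and> z_plus \<noteq> z_minus \<and>
       (\<forall>f\<in>first_kind S.
          ((\<lambda>t. f (z * cis t)) \<longlongrightarrow> z_plus (ae_class f)) (at_right 0) \<and>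
          ((\<lambda>t. f (z * cis (- t))) \<longlongrightarrow> z_minus (ae_class f)) (at_right 0))) \<and>
     homeomorphic_map
       (subtopology (max_ideal_space (R_alg S)) (characters (R_alg S) - c_fibre S S))
       (top_of_set (circle - S)) c_map \<and>
     (totally_disconnected_space (subtopology (max_ideal_space (R_alg S)) (c_fibre S S)) \<and>
      compact_space (subtopology (max_ideal_space (R_alg S)) (c_fibre S S)) \<and>
      Hausdorff_space (subtopology (max_ideal_space (R_alg S)) (c_fibre S S))) \<and>
     (\<forall>\<xi>\<in>c_fibre S S.
       subtopology (max_ideal_space (AP_alg S)) {\<eta> \<in> characters (AP_alg S). r_map S \<eta> = \<xi>}
         homeomorphic_space bohr_compactification) \<and>
     homeomorphic_map
       (subtopology (max_ideal_space (AP_alg S)) {\<eta> \<in> characters (AP_alg S). c_map (r_map S \<eta>) \<notin> S})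
       (subtopology (max_ideal_space (R_alg S)) (characters (R_alg S) - c_fibre S S)) (r_map S)"
proof -
  interpret closed_in_circle S by (rule closed_in_circle.intro[OF assms(1,2)])
  have point_eval: "homeomorphic_map (top_of_set circle) (max_ideal_space C_circle) point_eval"
    using homeomorphic_maps_sym[THEN iffD1, OF homeomorphic_maps_point_eval] homeomorphic_map_maps by blast
  have off: "homeomorphic_map (subtopology (max_ideal_space (R_alg S)) (characters (R_alg S) - c_fibre S S))
       (top_of_set (circle - S)) c_map"
    using homeomorphic_maps_c_map_off homeomorphic_map_maps by blast
  have fibres: "\<exists>z_plus z_minus. c_fibre S {z} = {z_plus, z_minus} \<and> z_plus \<noteq> z_minus \<and>
       (\<forall>f\<in>first_kind S.
          ((\<lambda>t. f (z * cis t)) \<longlongrightarrow> z_plus (ae_class f)) (at_right 0) \<and>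
          ((\<lambda>t. f (z * cis (- t))) \<longlongrightarrow> z_minus (ae_class f)) (at_right 0))" if z: "z \<in> S" for z
    using c_fibre_singleton[OF z] tendsto_side_char[OF _ z, of _ 1] tendsto_side_char[OF _ z, of _ "-1"]
    by (intro exI[of _ "side_char z 1"] exI[of _ "side_char z (-1)"]) simp
  show ?thesis
    by (intro conjI ballI C_circle_subset R_alg_subset point_eval continuous_map_r_map r_map_image
        continuous_map_c_map c_map_image fibres off totally_disconnected_c_fibre compact_space_c_fibre
        Hausdorff_space_subtopology Hausdorff_max_ideal_space fibre_homeomorphic_bohr homeomorphic_map_r_map_off)
qed

end
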